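(* Let $\{\delta_j\}_{j=1}^{\infty}$ be a sequence with $\delta_j>0$ and $\sum_{j=1}^{\infty}\delta_j<\infty$. There is a constant $C>0$ such that for any divergence-free vector field $u\in C_0^\infty(\mathbb{R}^3)$, $$\|[(-\Delta)^{1/2},u\cdot\nabla]u\|_{L^2}\le C\|\nabla u\|_{L^\infty}\|(-\Delta)^{1/2}u\|_{L^2}\,F_1^\infty(Z)+C\|\nabla u\|_{L^\infty}\|(-\Delta)^{1}u\|_{L^2}\,F_2^\infty(Z),$$ where $Z=\|(-\Delta)^{1/2+\sigma}u\|_{L^2}$ for some small $\sigma>0$, and $$F_1^\infty(Z)=L_1(Z)\prod_{j=2}^{\infty}(1+L_j(Z))^{-\delta_j},\qquad F_2^\infty(Z)=\frac{1}{L_1(Z)}\prod_{j=2}^{\infty}(1+L_j(Z))^{\delta_j}.$$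
   Context: Nested logarithms: $L_0(x)=x$, $L_1(x)=\log(e+x)$, $L_k(x)=\log(e+L_{k-1}(x))$ for $k\ge2$. The fractional Laplacian $(-\Delta)^s$ has Fourier symbol $|\xi|^{2s}$. The commutator is $[(-\Delta)^{s},u\cdot\nabla]u=(-\Delta)^{s}((u\cdot\nabla)u)-(u\cdot\nabla)((-\Delta)^{s}u)$. *)

theory Defs
  imports "HOL-Probability.Essential_Supremum"
begin

fun nested_log :: "nat \<Rightarrow> real \<Rightarrow> real" where
  "nested_log 0 x = x"
| "nested_log (Suc k) x = ln (exp 1 + nested_log k x)"

text \<open>The factors of the infinite products are indexed by \<open>j = 2, 3, \<dots>\<close>, hence the shift by 2.\<close>

definition F1_inf :: "(nat \<Rightarrow> real) \<Rightarrow> real \<Rightarrow> real" where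
  "F1_inf \<delta> z = nested_log 1 z * (\<Prod>j. (1 + nested_log (j + 2) z) powr (- \<delta> (j + 2)))"

definition F2_inf :: "(nat \<Rightarrow> real) \<Rightarrow> real \<Rightarrow> real" where
  "F2_inf \<delta> z = 1 / nested_log 1 z * (\<Prod>j. (1 + nested_log (j + 2) z) powr (\<delta> (j + 2)))"

fun Ck_on_UNIV :: "nat \<Rightarrow> ('a::real_normed_vector \<Rightarrow> 'b::real_normed_vector) \<Rightarrow> bool" where
  "Ck_on_UNIV 0 f \<longleftrightarrow> continuous_on UNIV f"
| "Ck_on_UNIV (Suc k) f \<longleftrightarrow>
     (\<forall>x. f differentiable (at x)) \<and> (\<forall>v. Ck_on_UNIV k (\<lambda>x. frechet_derivative f (at x) v))"

definition Cinf_compact_support :: "('a::real_normed_vector \<Rightarrow> 'b::real_normed_vector) \<Rightarrow> bool" where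
  "Cinf_compact_support f \<longleftrightarrow> (\<forall>k. Ck_on_UNIV k f) \<and> compact (closure {x. f x \<noteq> 0})"

definition divergence :: "(real^'n \<Rightarrow> real^'n) \<Rightarrow> real^'n \<Rightarrow> real" where
  "divergence u x = trace (jacobian u (at x))"

text \<open>The convective derivative \<open>(u \<cdot> \<nabla>) v\<close>: at \<open>x\<close>, the derivative of \<open>v\<close> in direction \<open>u x\<close>.\<close>

definition convect :: "('a::real_normed_vector \<Rightarrow> 'a) \<Rightarrow> ('a \<Rightarrow> 'b::real_normed_vector) \<Rightarrow> 'a \<Rightarrow> 'b" where
  "convect u v x = frechet_derivative v (at x) (u x)"

text \<open>The Fourier transform is normalised with kernel \<open>exp (- i \<xi> \<cdot> x)\<close>, so that \<open>- \<Delta>\<close> has the symbol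
  \<open>|\<xi>|\<^sup>2\<close> without factors of \<open>2 \<pi>\<close>; the inverse transform then carries the factor \<open>(2 \<pi>)\<^sup>-\<^sup>n\<close>.\<close>

definition fourier :: "('a::euclidean_space \<Rightarrow> complex) \<Rightarrow> 'a \<Rightarrow> complex" where
  "fourier f \<xi> = (LINT x|lborel. cis (- (\<xi> \<bullet> x)) * f x)"

definition inv_fourier :: "('a::euclidean_space \<Rightarrow> complex) \<Rightarrow> 'a \<Rightarrow> complex" where
  "inv_fourier g x = (LINT \<xi>|lborel. cis (\<xi> \<bullet> x) * g \<xi>) / of_real ((2 * pi) ^ DIM('a))"

text \<open>The integrals converge absolutely for smooth compactly supported \<open>f\<close> and \<open>s \<ge> 0\<close>. For real-valued
  \<open>f\<close> the inverse transform below is real because the symbol is real and even; \<open>Re\<close> only changes the type.\<close>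

definition frac_laplacian :: "real \<Rightarrow> ('a::euclidean_space \<Rightarrow> real) \<Rightarrow> 'a \<Rightarrow> real" where
  "frac_laplacian s f x =
     Re (inv_fourier (\<lambda>\<xi>. of_real (norm \<xi> powr (2 * s)) * fourier (\<lambda>y. of_real (f y)) \<xi>) x)"

definition frac_laplacian_vec ::
    "real \<Rightarrow> ('a::euclidean_space \<Rightarrow> real^'m) \<Rightarrow> 'a \<Rightarrow> real^'m" where
  "frac_laplacian_vec s u x = (\<chi> i. frac_laplacian s (\<lambda>y. u y $ i) x)"

definition commutator :: "real \<Rightarrow> (real^'n \<Rightarrow> real^'n) \<Rightarrow> real^'n \<Rightarrow> real^'n" where
  "commutator s u x =
     frac_laplacian_vec s (convect u u) x - convect u (frac_laplacian_vec s u) x"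

definition in_L2 :: "('a::euclidean_space \<Rightarrow> 'b::euclidean_space) \<Rightarrow> bool" where
  "in_L2 f \<longleftrightarrow> f \<in> borel_measurable lborel \<and> integrable lborel (\<lambda>x. (norm (f x))\<^sup>2)"

text \<open>Only meaningful for functions satisfying \<^const>\<open>in_L2\<close>: a divergent integral has the value 0.\<close>

definition L2_norm :: "('a::euclidean_space \<Rightarrow> 'b::euclidean_space) \<Rightarrow> real" where
  "L2_norm f = sqrt (LINT x|lborel. (norm (f x))\<^sup>2)"

text \<open>For matrix-valued \<open>f\<close>, such as a Jacobian, \<^const>\<open>norm\<close> is the Frobenius norm.\<close>

definition Linf_norm :: "('a::euclidean_space \<Rightarrow> 'b::euclidean_space) \<Rightarrow> real" where
  "Linf_norm f = real_of_ereal (esssup lborel (\<lambda>x. ereal (norm (f x))))"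

end

theory Submission
  imports Defs "HOL-Probability.Characteristic_Functions" "HOL-Real_Asymp.Real_Asymp"
begin

text \<open>
  Write \<open>\<Lambda> = (- \<Delta>)\<^sup>1\<^sup>/\<^sup>2\<close>. The factor \<open>F\<^sub>1\<close> is bounded below by a positive constant and \<open>F\<^sub>2\<close> is
  nonnegative, so it suffices to prove the commutator bound of Calderon type
  \<open>\<parallel>[\<Lambda>, u \<cdot> \<nabla>]u\<parallel> \<le> C \<parallel>\<nabla>u\<parallel>\<^sub>\<infinity> \<parallel>\<Lambda>u\<parallel>\<close>. As \<open>(\<partial>\<^sub>j u\<^sub>k) \<Lambda>u\<^sub>j\<close> obeys this bound trivially, the point is
  \<open>\<parallel>\<Lambda>(f g) - f \<Lambda>g - g \<Lambda>f\<parallel> \<le> C \<parallel>g\<parallel>\<^sub>\<infinity> \<parallel>\<Lambda>f\<parallel>\<close>.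

  Paired with \<open>h\<close>, the left side is a trilinear form on frequencies \<open>\<alpha> + \<beta> + \<gamma> = 0\<close> with symbol
  \<open>|\<gamma>| - |\<alpha>| - |\<beta>| = - 2 (|\<alpha>| |\<beta>| - \<alpha> \<cdot> \<beta>) / S\<close>, where \<open>S = |\<alpha>| + |\<beta>| + |\<gamma>|\<close>. Multiplying numerator
  and denominator by \<open>S\<close> and writing \<open>1 / S\<^sup>2\<close> as the integral of \<open>z exp (- z S)\<close> over \<open>z \<ge> 0\<close> turns the
  form into integrals \<open>\<integral> z \<integral> V (D G) (D' H) dx dz\<close> of Poisson extensions, where \<open>D\<close> and \<open>D'\<close> are first order
  operators and at most one of the two square integrable factors is differentiated.
  By Cauchy-Schwarz they are controlled by the square function \<open>\<integral> z \<parallel>D H\<parallel>\<^sup>2 dz\<close> and by the Carleson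
  type integral \<open>\<integral> z \<integral> V\<^sup>2 |D G|\<^sup>2 dx dz\<close>. The latter is bounded by a Bellman function argument: it amounts to
  integrating the Laplacian of \<open>V\<^sup>2 (8 M\<^sup>2 + G\<^sup>2)\<close> against \<open>z\<close> over the half space, where \<open>|G| \<le> M\<close>
  by positivity of the Poisson kernel.
\<close>

section \<open>Integrals over Euclidean space\<close>

text \<open>The obstacle is that \<open>g\<close>, which stands for an entry of the velocity
  gradient, is merely bounded: its square function is not under control, only its Carleson integral
  is, and that allows a single derivative on the extension of \<open>g\<close>. With
  \<open>P = |\<alpha>| |\<beta>| - \<alpha> \<bullet> \<beta>\<close>, the product
  \<open>P S\<close> contains \<open>|\<beta>| P\<close>, which puts two derivatives on
  \<open>g\<close>. Since the frequencies sum to zero, this term equals a combination of terms with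
  one derivative on \<open>g\<close>. One of the three derivatives in each term is spent on the norm
  of \<Lambda>f; of the remaining two, one falls on \<open>g\<close> and one on a square integrable
  factor.

  Functions are described by their transforms. \<Lambda>u need not be a Schwartz function, because
  |\<xi>| has a corner at the origin, so the admissible symbols are continuous and rapidly
  decreasing but not necessarily smooth. This class is stable under |\<xi>|, derivatives and
  convolution, and Plancherel gives square integrability in the space variable. Integrability in the
  space variable is not automatic and is assumed where it matters.\<close>

lemma borel_measurable_cis [measurable]: "cis \<in> borel_measurable borel"
  by (intro borel_measurable_continuous_onI continuous_on_cis continuous_intros)

lemma lborel_prod_Basis:
  fixes f :: "'a::euclidean_space \<Rightarrow> real \<Rightarrow> complex"
  assumes "\<And>b. b \<in> Basis \<Longrightarrow> integrable lborel (f b)"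
  shows integrable_lborel_prod_Basis: "integrable lborel (\<lambda>x. \<Prod>b\<in>Basis. f b (x \<bullet> b))"
    and integral_lborel_prod_Basis:
      "(LINT x|lborel. (\<Prod>b\<in>Basis. f b (x \<bullet> b))) = (\<Prod>b\<in>Basis. (LINT t|lborel. f b t))"
proof -
  interpret product_sigma_finite "\<lambda>_::'a. lborel :: real measure" ..
  have [measurable]: "f b \<in> borel_measurable borel" if "b \<in> Basis" for b
    using assms[OF that] by auto
  have eq: "(\<Prod>b\<in>Basis. f b ((\<Sum>c\<in>Basis. x c *\<^sub>R c) \<bullet> b)) = (\<Prod>b\<in>Basis. f b (x b))" for x :: "'a \<Rightarrow> real"
    by (intro prod.cong) (auto simp: inner_sum_left inner_Basis if_distrib cong: if_cong)
  show "integrable lborel (\<lambda>x. \<Prod>b\<in>Basis. f b (x \<bullet> b))"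
    by (subst lborel_eq, subst integrable_distr_eq) (auto simp: eq intro!: product_integrable_prod assms)
  show "(LINT x|lborel. (\<Prod>b\<in>Basis. f b (x \<bullet> b))) = (\<Prod>b\<in>Basis. (LINT t|lborel. f b t))"
    by (subst lborel_eq, subst integral_distr) (auto simp: eq intro!: product_integral_prod assms)
qed

lemma lborel_shift:
  fixes f :: "'a::euclidean_space \<Rightarrow> 'b::{banach, second_countable_topology}"
  shows integrable_lborel_shift: "integrable lborel f \<Longrightarrow> integrable lborel (\<lambda>x. f (x + a))"
    and integral_lborel_shift: "integrable lborel f \<Longrightarrow> (LINT x|lborel. f (x + a)) = (LINT x|lborel. f x)"
proof -
  assume i: "integrable lborel f"
  then have [measurable]: "f \<in> borel_measurable borel" by auto
  have d: "lborel = distr lborel borel (\<lambda>x. x + a)"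
    using lborel_distr_plus[of a, symmetric] by (subst add.commute)
  show "integrable lborel (\<lambda>x. f (x + a))"
    using i by (subst (asm) d) (simp add: integrable_distr_eq)
  show "(LINT x|lborel. f (x + a)) = (LINT x|lborel. f x)"
    by (subst (2) d) (simp add: integral_distr)
qed

lemma lborel_scale:
  fixes f :: "'a::euclidean_space \<Rightarrow> 'b::{banach, second_countable_topology}"
  assumes "c \<noteq> 0" and i: "integrable lborel f"
  shows integrable_lborel_scale: "integrable lborel (\<lambda>x. f (c *\<^sub>R x))"
    and integral_lborel_scale: "(LINT x|lborel. f x) = \<bar>c\<bar> ^ DIM('a) *\<^sub>R (LINT x|lborel. f (c *\<^sub>R x))"
proof -
  have [measurable]: "f \<in> borel_measurable borel" using i by auto
  have d: "lborel = density (distr lborel borel (\<lambda>x::'a. c *\<^sub>R x)) (\<lambda>_. ennreal (\<bar>c\<bar> ^ DIM('a)))"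
    using lborel_affine[OF assms(1), where t="0::'a"] by (simp add: ennreal_power)
  have "integrable lborel (\<lambda>x. \<bar>c\<bar> ^ DIM('a) *\<^sub>R f (c *\<^sub>R x))"
    using i by (subst (asm) d) (simp add: integrable_density integrable_distr_eq)
  from integrable_scaleR_right[OF this, of "inverse (\<bar>c\<bar> ^ DIM('a))"]
  show "integrable lborel (\<lambda>x. f (c *\<^sub>R x))"
    using \<open>c \<noteq> 0\<close> by simp
  show "(LINT x|lborel. f x) = \<bar>c\<bar> ^ DIM('a) *\<^sub>R (LINT x|lborel. f (c *\<^sub>R x))"
    by (subst d) (simp add: integral_density integral_distr)
qed

lemma lborel_uminus:
  fixes f :: "'a::euclidean_space \<Rightarrow> 'b::{banach, second_countable_topology}"
  assumes "integrable lborel f"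
  shows integrable_lborel_uminus: "integrable lborel (\<lambda>x. f (- x))"
    and integral_lborel_uminus: "(LINT x|lborel. f (- x)) = (LINT x|lborel. f x)"
  using lborel_scale[of "-1" f] assms by auto

lemma integrable_inverse_quadratic: "integrable lborel (\<lambda>t::real. 1 / (1 + \<bar>t\<bar>)\<^sup>2)"
proof -
  have "set_integrable lborel (einterval (-\<infinity>) \<infinity>) (\<lambda>t::real. inverse (1 + t\<^sup>2))"
    by (rule interval_integral_FTC_nonneg[where F=arctan and A="-pi/2" and B="pi/2"])
       (auto intro!: derivative_eq_intros continuous_intros filterlim_compose[OF tendsto_arctan_at_top] 
          filterlim_compose[OF tendsto_arctan_at_bot]
         simp: ereal_tendsto_simps power2_eq_square add_nonneg_eq_0_iff tendsto_arctan_at_top tendsto_arctan_at_bot)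
  then have *: "integrable lborel (\<lambda>t::real. inverse (1 + t\<^sup>2))"
    by (simp add: set_integrable_def einterval_def)
  have "1 / (1 + \<bar>t\<bar>)\<^sup>2 \<le> inverse (1 + t\<^sup>2)" for t :: real
  proof -
    have "1 + t\<^sup>2 \<le> (1 + \<bar>t\<bar>)\<^sup>2" by (simp add: power2_sum)
    moreover have "1 + t\<^sup>2 > 0" by (simp add: add_pos_nonneg)
    ultimately show ?thesis using le_imp_inverse_le by (auto simp: inverse_eq_divide[symmetric])
  qed
  then show ?thesis
    by (intro Bochner_Integration.integrable_bound[OF *]) auto
qed

text \<open>Each coordinate is bounded by the norm, so the power \<open>2 * DIM('a)\<close> leaves a
  square for every coordinate, and the product of the one-dimensional functions
  \<open>1 / (1 + \<bar>x \<bullet> b\<bar>)\<^sup>2\<close> is an integrable majorant.\<close>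

lemma integrable_decay:
  "integrable lborel (\<lambda>x::'a::euclidean_space. 1 / (1 + norm x) ^ (2 * DIM('a)))"
proof -
  have "integrable lborel (\<lambda>x::'a. \<Prod>b\<in>Basis. complex_of_real (1 / (1 + \<bar>x \<bullet> b\<bar>)\<^sup>2))"
    by (rule integrable_lborel_prod_Basis)
       (rule integrable_of_real[OF integrable_inverse_quadratic])
  then have "integrable lborel (\<lambda>x::'a. Re (\<Prod>b\<in>Basis. complex_of_real (1 / (1 + \<bar>x \<bullet> b\<bar>)\<^sup>2)))"
    by simp
  then have i: "integrable lborel (\<lambda>x::'a. \<Prod>b\<in>Basis. 1 / (1 + \<bar>x \<bullet> b\<bar>)\<^sup>2)"
    by (simp del: of_real_divide of_real_prod add: of_real_prod[symmetric])
  let ?K = "real (Suc DIM('a)) ^ (2 * DIM('a))"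
  let ?p = "\<lambda>x::'a. \<Prod>b\<in>Basis. 1 + \<bar>x \<bullet> b\<bar>"
  show ?thesis
  proof (rule Bochner_Integration.integrable_bound[OF integrable_mult_right[OF i, where c = "?K"]])
    show "AE x::'a in lborel. norm (1 / (1 + norm x) ^ (2 * DIM('a)))
        \<le> norm (?K * (\<Prod>b\<in>Basis. 1 / (1 + \<bar>x \<bullet> b\<bar>)\<^sup>2))"
    proof (intro AE_I2)
      fix x :: 'a
      have p: "?p x > 0" by (intro prod_pos) (auto simp: add_pos_nonneg)
      have a: "(1 + \<bar>x \<bullet> b\<bar>) \<le> 1 + norm x" if "b \<in> Basis" for b
        using Basis_le_norm[OF that, of x] by simp
      have "?p x \<le> (1 + norm x) ^ DIM('a)"
        using prod_mono[of Basis "\<lambda>b. 1 + \<bar>x \<bullet> b\<bar>" "\<lambda>b. 1 + norm x"] a by auto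
      then have "(?p x)\<^sup>2 \<le> ((1 + norm x) ^ DIM('a))\<^sup>2"
        using p by (intro power_mono) auto
      also have "\<dots> = (1 + norm x) ^ (2 * DIM('a))" by (simp add: power_mult[symmetric] mult.commute)
      finally have "1 / (1 + norm x) ^ (2 * DIM('a)) \<le> 1 / (?p x)\<^sup>2"
        using p by (intro divide_left_mono) (auto intro!: mult_pos_pos zero_less_power add_pos_nonneg)
      also have "\<dots> \<le> ?K * (1 / (?p x)\<^sup>2)"
        using mult_right_mono[of 1 ?K "1 / (?p x)\<^sup>2"] by (simp add: one_le_power)
      finally have "1 / (1 + norm x) ^ (2 * DIM('a)) \<le> ?K * (1 / (?p x)\<^sup>2)" .
      moreover have "(\<Prod>b\<in>Basis. 1 / (1 + \<bar>x \<bullet> b\<bar>)\<^sup>2) = 1 / (?p x)\<^sup>2"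
        by (simp add: prod_dividef prod_power_distrib)
      ultimately show "norm (1 / (1 + norm x) ^ (2 * DIM('a)))
        \<le> norm (?K * (\<Prod>b\<in>Basis. 1 / (1 + \<bar>x \<bullet> b\<bar>)\<^sup>2))" by simp
    qed
  qed auto
qed

text \<open>Scaling by \<open>sqrt (2 * t)\<close> reduces both claims to the standard normal
  density and its characteristic function at \<open>a / sqrt (2 * t)\<close>.\<close>

lemma gaussian_real:
  fixes t a :: real
  assumes "t > 0"
  shows integrable_gaussian_real: "integrable lborel (\<lambda>x::real. cis (a * x) * of_real (exp (- t * x\<^sup>2)))"
    and integral_gaussian_real: "(LINT x|lborel. cis (a * x) * of_real (exp (- t * x\<^sup>2)))
      = of_real (sqrt (pi / t) * exp (- a\<^sup>2 / (4 * t)))"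
proof -
  let ?c = "sqrt (2 * t)"
  have c: "?c > 0" using assms by simp
  have g: "integrable lborel (\<lambda>x. std_normal_density x)"
    using integrable_std_normal_moment[of 0] by simp
  have m: "integrable lborel (\<lambda>x. std_normal_density x *\<^sub>R cis (a / ?c * x))"
    by (rule Bochner_Integration.integrable_bound[OF g]) (auto simp: normal_density_nonneg)
  have ch: "(LINT x|lborel. std_normal_density x *\<^sub>R cis (a / ?c * x)) = of_real (exp (- (a/?c)\<^sup>2 / 2))"
    using fun_cong[OF char_std_normal_distribution, of "a / ?c"]
    unfolding char_def by (simp add: integral_density normal_density_nonneg cis_conv_exp)
  have s: "std_normal_density (0 + ?c * x) *\<^sub>R cis (a / ?c * (0 + ?c * x))
     = (1 / sqrt (2 * pi)) *\<^sub>R (cis (a * x) * of_real (exp (- t * x\<^sup>2)))" for x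
    using c assms by (simp add: std_normal_density_def power_mult_distrib scaleR_conv_of_real)
  have "integrable lborel (\<lambda>x. std_normal_density (0 + ?c * x) *\<^sub>R cis (a / ?c * (0 + ?c * x)))"
    using lborel_integrable_real_affine[OF m, of ?c 0] c by simp
  then have "integrable lborel (\<lambda>x. (1 / sqrt (2 * pi)) *\<^sub>R (cis (a * x) * of_real (exp (- t * x\<^sup>2))))"
    unfolding s .
  from integrable_scaleR_right[OF this, of "sqrt (2 * pi)"]
  show "integrable lborel (\<lambda>x::real. cis (a * x) * of_real (exp (- t * x\<^sup>2)))"
    by simp
  have "(LINT x|lborel. std_normal_density x *\<^sub>R cis (a / ?c * x)) =
     ?c *\<^sub>R (1 / sqrt (2 * pi)) *\<^sub>R (LINT x|lborel. cis (a * x) * of_real (exp (- t * x\<^sup>2)))"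
    using lborel_integral_real_affine[of ?c "\<lambda>x. std_normal_density x *\<^sub>R cis (a / ?c * x)" 0] c
    unfolding s by simp
  then have "(LINT x|lborel. cis (a * x) * of_real (exp (- t * x\<^sup>2))) =
     (sqrt (2 * pi) / ?c) *\<^sub>R complex_of_real (exp (- (a/?c)\<^sup>2 / 2))"
    using c unfolding ch by (simp add: field_simps scaleR_conv_of_real)
  also have "\<dots> = of_real (sqrt (pi / t) * exp (- a\<^sup>2 / (4 * t)))"
    using assms by (simp add: scaleR_conv_of_real power_divide real_sqrt_divide[symmetric])
  finally show "(LINT x|lborel. cis (a * x) * of_real (exp (- t * x\<^sup>2)))
      = of_real (sqrt (pi / t) * exp (- a\<^sup>2 / (4 * t)))" .
qed

lemma cis_sum: "finite A \<Longrightarrow> cis (\<Sum>a\<in>A. f a) = (\<Prod>a\<in>A. cis (f a))"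
  by (induction A rule: finite_induct) (auto simp: cis_mult[symmetric])

lemma norm_sq_Basis: "(norm (x::'a::euclidean_space))\<^sup>2 = (\<Sum>b\<in>Basis. (x \<bullet> b)\<^sup>2)"
  unfolding power2_norm_eq_inner by (subst euclidean_inner) (simp add: power2_eq_square)

lemma gaussian:
  fixes \<xi> :: "'a::euclidean_space"
  assumes "t > 0"
  shows integrable_cis_gaussian:
      "integrable lborel (\<lambda>x::'a. cis (\<xi> \<bullet> x) * of_real (exp (- t * (norm x)\<^sup>2)))"
    and integral_cis_gaussian: "(LINT x|lborel. cis (\<xi> \<bullet> x) * of_real (exp (- t * (norm x)\<^sup>2)))
      = of_real (sqrt (pi / t) ^ DIM('a) * exp (- (norm \<xi>)\<^sup>2 / (4 * t)))"
proof -
  have eq: "cis (\<xi> \<bullet> x) * of_real (exp (- t * (norm x)\<^sup>2)) =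
     (\<Prod>b\<in>Basis. cis ((\<xi> \<bullet> b) * (x \<bullet> b)) * of_real (exp (- t * (x \<bullet> b)\<^sup>2)))" for x :: 'a
    by (subst euclidean_inner, subst norm_sq_Basis)
       (simp add: cis_sum prod.distrib sum_distrib_left exp_sum[symmetric] of_real_prod[symmetric]
          sum_negf[symmetric] del: of_real_prod of_real_exp)
  show "integrable lborel (\<lambda>x::'a. cis (\<xi> \<bullet> x) * of_real (exp (- t * (norm x)\<^sup>2)))"
    unfolding eq
    using integrable_lborel_prod_Basis[of "\<lambda>b s. cis ((\<xi> \<bullet> b) * s) * of_real (exp (- t * s\<^sup>2))"]
      integrable_gaussian_real[OF assms] by simp
  have "(LINT x|lborel. cis (\<xi> \<bullet> x) * of_real (exp (- t * (norm x)\<^sup>2)))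
     = (\<Prod>b\<in>Basis. complex_of_real (sqrt (pi / t) * exp (- (\<xi> \<bullet> b)\<^sup>2 / (4 * t))))"
    unfolding eq
    using integral_lborel_prod_Basis[of "\<lambda>b s. cis ((\<xi> \<bullet> b) * s) * of_real (exp (- t * s\<^sup>2))"]
      integrable_gaussian_real[OF assms] integral_gaussian_real[OF assms] by simp
  also have "\<dots> = of_real (\<Prod>b\<in>Basis. sqrt (pi / t) * exp (- (\<xi> \<bullet> b)\<^sup>2 / (4 * t)))"
    by simp
  also have "(\<Prod>b\<in>Basis. sqrt (pi / t) * exp (- (\<xi> \<bullet> b)\<^sup>2 / (4 * t))) =
     sqrt (pi / t) ^ DIM('a) * exp (- (norm \<xi>)\<^sup>2 / (4 * t))"
    by (subst norm_sq_Basis) (simp add: prod.distrib exp_sum[symmetric] sum_negf sum_divide_distrib)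
  finally show "(LINT x|lborel. cis (\<xi> \<bullet> x) * of_real (exp (- t * (norm x)\<^sup>2)))
      = of_real (sqrt (pi / t) ^ DIM('a) * exp (- (norm \<xi>)\<^sup>2 / (4 * t)))" .
qed

section \<open>Gaussian kernels and Fourier inversion\<close>

lemma continuous_on_lebesgue_integral:
  fixes F :: "'a::metric_space \<Rightarrow> 'b \<Rightarrow> 'c::{banach, second_countable_topology}"
  assumes "\<And>y. continuous_on UNIV (\<lambda>x. F x y)" "\<And>x. F x \<in> borel_measurable M"
    "\<And>x y. norm (F x y) \<le> w y" "integrable M w"
  shows "continuous_on UNIV (\<lambda>x. LINT y|M. F x y)"
  unfolding continuous_on_eq_continuous_at[OF open_UNIV]
proof
  fix x
  show "isCont (\<lambda>x. LINT y|M. F x y) x"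
  proof (rule continuous_at_sequentiallyI)
    fix u assume u: "u \<longlonglongrightarrow> x"
    show "(\<lambda>n. LINT y|M. F (u n) y) \<longlonglongrightarrow> (LINT y|M. F x y)"
    proof (rule integral_dominated_convergence)
      have "isCont (\<lambda>x. F x y) x" for y
        using assms(1)[of y] by (simp add: continuous_on_eq_continuous_at)
      then show "AE y in M. (\<lambda>n. F (u n) y) \<longlonglongrightarrow> F x y"
        using u by (intro AE_I2) (rule isCont_tendsto_compose[where g="\<lambda>x. F x _"])
    qed (use assms in auto)
  qed
qed

lemma (in pair_sigma_finite) integrable_mult_pair:
  fixes f :: "'a \<Rightarrow> 'c::{real_normed_field, banach, second_countable_topology}"
  assumes f: "integrable M1 f" and g: "integrable M2 g"
  shows "integrable (M1 \<Otimes>\<^sub>M M2) (\<lambda>(x, y). f x * g y)"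
proof (rule Fubini_integrable)
  have [measurable]: "f \<in> borel_measurable M1" "g \<in> borel_measurable M2"
    using f g by auto
  show "(\<lambda>(x, y). f x * g y) \<in> borel_measurable (M1 \<Otimes>\<^sub>M M2)" by measurable
  show "integrable M1 (\<lambda>x. LINT y|M2. norm (case (x, y) of (x, y) \<Rightarrow> f x * g y))"
    using f by (simp add: norm_mult)
  show "AE x in M1. integrable M2 (\<lambda>y. case (x, y) of (x, y) \<Rightarrow> f x * g y)"
    using g by simp
qed

lemma lborel_reflect_shift:
  fixes f :: "'a::euclidean_space \<Rightarrow> 'b::{banach, second_countable_topology}"
  assumes "integrable lborel f"
  shows integrable_lborel_reflect_shift: "integrable lborel (\<lambda>y. f (x - y))"
    and integral_lborel_reflect_shift: "(LINT y|lborel. f (x - y)) = (LINT y|lborel. f y)"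
  using lborel_uminus[of "\<lambda>y. f (y + x)"] lborel_shift[OF assms, of x]
  by (auto simp: add.commute)

text \<open>The transform of \<open>exp (- t * (norm \<xi>)\<^sup>2)\<close>, hence
  \<open>(2 * pi) ^ DIM('a)\<close> times the heat kernel at time \<open>t\<close>; this is why its
  mass is not 1.\<close>

definition gauss_kernel :: "real \<Rightarrow> 'a::euclidean_space \<Rightarrow> real" where
  "gauss_kernel t x = sqrt (pi / t) ^ DIM('a) * exp (- (norm x)\<^sup>2 / (4 * t))"

lemma gauss_kernel_nonneg: "t > 0 \<Longrightarrow> gauss_kernel t x \<ge> 0"
  by (simp add: gauss_kernel_def)

lemma measurable_gauss_kernel [measurable]: "gauss_kernel t \<in> borel_measurable borel"
  unfolding gauss_kernel_def[abs_def] by measurable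

lemma gaussian_mass:
  assumes "t > 0"
  shows integrable_gaussian: "integrable lborel (\<lambda>x::'a::euclidean_space. exp (- t * (norm x)\<^sup>2))"
    and integral_gaussian: "(LINT x::'a|lborel. exp (- t * (norm x)\<^sup>2)) = sqrt (pi / t) ^ DIM('a)"
proof -
  have eq: "cis (0 \<bullet> x) * complex_of_real (exp (- t * (norm x)\<^sup>2)) = complex_of_real (exp (- t * (norm x)\<^sup>2))"
    for x :: 'a by simp
  note 1 = integrable_cis_gaussian[OF assms, of "0::'a"] and 2 = integral_cis_gaussian[OF assms, of "0::'a"]
  show "integrable lborel (\<lambda>x::'a. exp (- t * (norm x)\<^sup>2))"
    using 1 unfolding eq using complex_of_real_integrable_eq by blast
  have "complex_of_real (LINT x::'a|lborel. exp (- t * (norm x)\<^sup>2)) = complex_of_real (sqrt (pi / t) ^ DIM('a))"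
    using 2 unfolding eq by (simp del: of_real_exp of_real_power add: integral_complex_of_real)
  then show "(LINT x::'a|lborel. exp (- t * (norm x)\<^sup>2)) = sqrt (pi / t) ^ DIM('a)"
    using of_real_eq_iff by blast
qed

lemma gauss_kernel_mass:
  assumes "t > 0"
  shows integrable_gauss_kernel: "integrable lborel (gauss_kernel t :: 'a::euclidean_space \<Rightarrow> real)"
    and integral_gauss_kernel: "(LINT x::'a|lborel. gauss_kernel t x) = (2 * pi) ^ DIM('a)"
proof -
  have t: "1 / (4 * t) > 0" using assms by simp
  have eq: "gauss_kernel t = (\<lambda>x::'a. sqrt (pi / t) ^ DIM('a) * exp (- (1 / (4 * t)) * (norm x)\<^sup>2))"
    by (auto simp: gauss_kernel_def)
  show "integrable lborel (gauss_kernel t :: 'a::euclidean_space \<Rightarrow> real)"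
    unfolding eq using integrable_gaussian[OF t] by (rule integrable_mult_right)
  have "(LINT x::'a|lborel. gauss_kernel t x) = (sqrt (pi / t) * sqrt (pi / (1 / (4 * t)))) ^ DIM('a)"
    unfolding eq using integral_gaussian[OF t, where 'a='a] by (simp add: power_mult_distrib)
  also have "sqrt (pi / t) * sqrt (pi / (1 / (4 * t))) = sqrt ((2 * pi)\<^sup>2)"
    using assms by (simp add: real_sqrt_mult[symmetric] power2_eq_square)
  also have "sqrt ((2 * pi)\<^sup>2) = 2 * pi" by (rule real_sqrt_unique) auto
  finally show "(LINT x::'a|lborel. gauss_kernel t x) = (2 * pi) ^ DIM('a)" .
qed

lemma integrable_bounded_gauss_kernel:
  fixes \<phi> :: "'a::euclidean_space \<Rightarrow> complex"
  assumes "t > 0" and [measurable]: "\<phi> \<in> borel_measurable borel" and "\<And>x. norm (\<phi> x) \<le> C"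
  shows "integrable lborel (\<lambda>x. \<phi> x * of_real (gauss_kernel t x))"
proof (rule Bochner_Integration.integrable_bound)
  show "integrable lborel (\<lambda>x::'a. C * gauss_kernel t x)"
    using integrable_gauss_kernel[OF assms(1)] by (rule integrable_mult_right)
  have "0 \<le> C" using assms(3) norm_ge_zero order_trans by blast
  then show "AE x in lborel. norm (\<phi> x * of_real (gauss_kernel t x)) \<le> norm (C * gauss_kernel t x)"
    using assms(3) gauss_kernel_nonneg[OF assms(1)]
    by (intro AE_I2) (simp add: norm_mult abs_mult mult_right_mono)
qed measurable

lemma norm_integral_gauss_kernel_le:
  fixes \<phi> :: "'a::euclidean_space \<Rightarrow> complex"
  assumes "t > 0" and [measurable]: "\<phi> \<in> borel_measurable borel" and "\<And>x. norm (\<phi> x) \<le> C"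
  shows "norm (LINT x|lborel. \<phi> x * of_real (gauss_kernel t x)) \<le> C * (2 * pi) ^ DIM('a)"
proof -
  have "norm (LINT x|lborel. \<phi> x * of_real (gauss_kernel t x)) \<le> (LINT x|lborel. C * gauss_kernel t (x::'a))"
    by (rule Bochner_Integration.integral_norm_bound_integral[OF integrable_bounded_gauss_kernel[OF assms]
         integrable_mult_right[OF integrable_gauss_kernel[OF assms(1)]]])
      (simp add: norm_mult abs_of_nonneg mult_right_mono assms(3) gauss_kernel_nonneg[OF assms(1)])
  then show ?thesis using integral_gauss_kernel[OF assms(1), where 'a='a] by simp
qed

text \<open>Rescaling moves the dependence on \<open>k\<close> from the kernel into the argument of
  \<open>\<phi>\<close>. There continuity at 0 and the bound \<open>C\<close> suffice for dominated
  convergence against one fixed Gaussian.\<close>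

lemma gauss_kernel_approx_identity:
  fixes \<phi> :: "'a::euclidean_space \<Rightarrow> complex"
  assumes cont: "continuous_on UNIV \<phi>" and bd: "\<And>x. norm (\<phi> x) \<le> C"
  shows "(\<lambda>k. LINT x|lborel. \<phi> x * of_real (gauss_kernel (inverse (real (Suc k))) x))
     \<longlonglongrightarrow> (2 * pi) ^ DIM('a) * \<phi> 0"
proof -
  have [measurable]: "\<phi> \<in> borel_measurable borel"
    using cont by (rule borel_measurable_continuous_onI)
  define r where "r k = 2 * sqrt (inverse (real (Suc k)))" for k
  have r: "r k > 0" for k by (simp add: r_def)
  let ?g = "\<lambda>x::'a. exp (- 1 * (norm x)\<^sup>2)"
  have g: "integrable lborel ?g" by (rule integrable_gaussian) simp
  have k: "(LINT x|lborel. \<phi> x * of_real (gauss_kernel (inverse (real (Suc k))) x))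
      = (2 * sqrt pi) ^ DIM('a) *\<^sub>R (LINT x|lborel. \<phi> (r k *\<^sub>R x) * of_real (?g x))" for k
  proof -
    let ?t = "inverse (real (Suc k))"
    have e: "gauss_kernel ?t (r k *\<^sub>R x) = sqrt (pi / ?t) ^ DIM('a) * ?g x" for x :: 'a
      using r[of k] by (simp add: gauss_kernel_def r_def power_mult_distrib)
    have m: "(r k * sqrt (pi / ?t)) = 2 * sqrt pi"
      by (simp add: r_def real_sqrt_mult[symmetric] real_sqrt_divide real_sqrt_inverse)
    have "(LINT x|lborel. \<phi> x * of_real (gauss_kernel ?t x))
      = \<bar>r k\<bar> ^ DIM('a) *\<^sub>R (LINT x|lborel. \<phi> (r k *\<^sub>R x) * of_real (gauss_kernel ?t (r k *\<^sub>R x)))"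
      using r[of k] by (intro integral_lborel_scale integrable_bounded_gauss_kernel[OF _ _ bd]) auto
    also have "\<dots> = r k ^ DIM('a) *\<^sub>R sqrt (pi / ?t) ^ DIM('a) *\<^sub>R (LINT x|lborel. \<phi> (r k *\<^sub>R x) * of_real (?g x))"
    proof -
      have "\<phi> (r k *\<^sub>R x) * of_real (sqrt (pi / ?t) ^ DIM('a) * ?g x) =
        of_real (sqrt (pi / ?t) ^ DIM('a)) * (\<phi> (r k *\<^sub>R x) * of_real (?g x))" for x
        by (simp only: of_real_mult mult.left_commute)
      then show ?thesis using r[of k] unfolding e
        by (simp only: integral_mult_right_zero scaleR_conv_of_real abs_of_pos)
    qed
    finally show ?thesis unfolding m[symmetric] by (simp add: power_mult_distrib)
  qed
  have "(\<lambda>k. LINT x|lborel. \<phi> (r k *\<^sub>R x) * of_real (?g x)) \<longlonglongrightarrow> (LINT x|lborel. \<phi> 0 * of_real (?g x))"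
  proof (rule integral_dominated_convergence[where w="\<lambda>x. C * ?g x"])
    have "r \<longlonglongrightarrow> 2 * sqrt 0"
      unfolding r_def by (intro tendsto_intros LIMSEQ_inverse_real_of_nat)
    then have "(\<lambda>k. r k *\<^sub>R x) \<longlonglongrightarrow> 0 *\<^sub>R x" for x :: 'a
      by (intro tendsto_intros) auto
    then have "(\<lambda>k. \<phi> (r k *\<^sub>R x)) \<longlonglongrightarrow> \<phi> 0" for x
      using cont by (intro isCont_tendsto_compose[where g=\<phi>]) (auto simp: continuous_on_eq_continuous_at)
    then show "AE x in lborel. (\<lambda>k. \<phi> (r k *\<^sub>R x) * of_real (?g x)) \<longlonglongrightarrow> \<phi> 0 * of_real (?g x)"
      by (intro AE_I2 tendsto_intros)
    show "integrable lborel (\<lambda>x. C * ?g x)" using g by (rule integrable_mult_right)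
  qed (use bd in \<open>auto simp: norm_mult intro!: mult_right_mono\<close>)
  then have "(\<lambda>k. (2 * sqrt pi) ^ DIM('a) *\<^sub>R (LINT x|lborel. \<phi> (r k *\<^sub>R x) * of_real (?g x)))
    \<longlonglongrightarrow> (2 * sqrt pi) ^ DIM('a) *\<^sub>R (LINT x|lborel. \<phi> 0 * of_real (?g x))"
    by (intro tendsto_intros)
  also have "(LINT x|lborel. \<phi> 0 * of_real (?g x)) = \<phi> 0 * of_real (sqrt pi ^ DIM('a))"
    using integral_gaussian[of 1, where 'a='a] g
    by (simp del: of_real_exp)
  also have "(2 * sqrt pi) ^ DIM('a) *\<^sub>R (\<phi> 0 * of_real (sqrt pi ^ DIM('a)))
     = (2 * (sqrt pi * sqrt pi)) ^ DIM('a) *\<^sub>R \<phi> 0"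
    by (simp add: scaleR_conv_of_real power_mult_distrib del: real_sqrt_mult_self)
  finally show ?thesis unfolding k by (simp add: scaleR_conv_of_real)
qed

lemma norm_fourier_le:
  "integrable lborel f \<Longrightarrow> norm (fourier f \<xi>) \<le> (LINT x|lborel. norm (f x))"
  unfolding fourier_def by (rule order_trans[OF integral_norm_bound]) (simp add: norm_mult)

lemma continuous_on_fourier:
  fixes f :: "'a::euclidean_space \<Rightarrow> complex"
  assumes "integrable lborel f"
  shows "continuous_on UNIV (fourier f)"
  unfolding fourier_def
proof (rule continuous_on_lebesgue_integral)
  have [measurable]: "f \<in> borel_measurable borel" using assms by auto
  show "(\<lambda>x. cis (- (\<xi> \<bullet> x)) * f x) \<in> borel_measurable lborel" for \<xi> by measurable
  show "integrable lborel (\<lambda>x. norm (f x))" using assms by simp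
  show "continuous_on UNIV (\<lambda>\<xi>. cis (- (\<xi> \<bullet> x)) * f x)" for x
    by (intro continuous_intros continuous_on_cis)
qed (simp add: norm_mult)

text \<open>The Gaussian factor makes the double integral absolutely convergent although
  \<open>fourier f\<close> itself may fail to be integrable, so Fubini applies and the inner
  integral is the Gauss kernel.\<close>

lemma fourier_gauss:
  fixes f :: "'a::euclidean_space \<Rightarrow> complex"
  assumes f: "integrable lborel f" and t: "t > 0" and bd: "\<And>x. norm (f x) \<le> C"
  shows "(LINT \<xi>|lborel. cis (\<xi> \<bullet> x) * (of_real (exp (- t * (norm \<xi>)\<^sup>2)) * fourier f \<xi>))
    = (LINT y|lborel. f (x - y) * of_real (gauss_kernel t y))"
proof -
  have [measurable]: "f \<in> borel_measurable borel" using f by auto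
  have [measurable]: "fourier f \<in> borel_measurable borel"
    using continuous_on_fourier[OF f] by (rule borel_measurable_continuous_onI)
  let ?e = "\<lambda>\<xi>::'a. complex_of_real (exp (- t * (norm \<xi>)\<^sup>2))"
  have e: "integrable lborel ?e"
    using integrable_gaussian[OF t] by (rule integrable_of_real)
  have "integrable (lborel \<Otimes>\<^sub>M lborel) (\<lambda>(\<xi>, y). ?e \<xi> * f y)"
    by (rule lborel_pair.integrable_mult_pair[OF e f])
  then have i: "integrable (lborel \<Otimes>\<^sub>M lborel) (\<lambda>(\<xi>, y). cis (\<xi> \<bullet> (x - y)) * ?e \<xi> * f y)"
    by (rule Bochner_Integration.integrable_bound) (auto simp: norm_mult)
  have "(LINT \<xi>|lborel. cis (\<xi> \<bullet> x) * (?e \<xi> * fourier f \<xi>))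
     = (LINT \<xi>|lborel. (LINT y|lborel. cis (\<xi> \<bullet> (x - y)) * ?e \<xi> * f y))"
    unfolding fourier_def
  proof (rule Bochner_Integration.integral_cong[OF refl])
    fix \<xi>
    have "cis (\<xi> \<bullet> x) * (?e \<xi> * (LINT y|lborel. cis (- (\<xi> \<bullet> y)) * f y))
      = (LINT y|lborel. cis (\<xi> \<bullet> x) * ?e \<xi> * (cis (- (\<xi> \<bullet> y)) * f y))"
      by (simp only: mult.assoc integral_mult_right_zero)
    also have "\<dots> = (LINT y|lborel. cis (\<xi> \<bullet> (x - y)) * ?e \<xi> * f y)"
      by (intro Bochner_Integration.integral_cong refl)
         (simp add: inner_diff_right cis_mult)
    finally show "cis (\<xi> \<bullet> x) * (?e \<xi> * (LINT y|lborel. cis (- (\<xi> \<bullet> y)) * f y))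
      = (LINT y|lborel. cis (\<xi> \<bullet> (x - y)) * ?e \<xi> * f y)" .
  qed
  also have "\<dots> = (LINT y|lborel. (LINT \<xi>|lborel. cis (\<xi> \<bullet> (x - y)) * ?e \<xi> * f y))"
    by (rule lborel_pair.Fubini_integral[OF i, symmetric])
  also have "\<dots> = (LINT y|lborel. f y * of_real (gauss_kernel t (x - y)))"
  proof (rule Bochner_Integration.integral_cong[OF refl])
    fix y
    have "(LINT \<xi>|lborel. cis (\<xi> \<bullet> (x - y)) * ?e \<xi> * f y) = (LINT \<xi>|lborel. cis ((x - y) \<bullet> \<xi>) * ?e \<xi>) * f y"
      by (simp add: inner_commute)
    also have "\<dots> = f y * of_real (gauss_kernel t (x - y))"
      unfolding integral_cis_gaussian[OF t] gauss_kernel_def by simp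
    finally show "(LINT \<xi>|lborel. cis (\<xi> \<bullet> (x - y)) * ?e \<xi> * f y) = f y * of_real (gauss_kernel t (x - y))" .
  qed
  also have "\<dots> = (LINT y|lborel. f (x - y) * of_real (gauss_kernel t y))"
  proof -
    have "integrable lborel (\<lambda>y. f (x - y) * of_real (gauss_kernel t y))"
      by (intro integrable_bounded_gauss_kernel[OF t _ bd]) measurable
    from integral_lborel_reflect_shift[OF this, of x] show ?thesis by simp
  qed
  finally show ?thesis .
qed

text \<open>The Gaussian means of the inversion integral have two limits: dominated convergence
  removes the damping because \<open>fourier f\<close> is integrable, and the approximate identity
  gives the value of \<open>f\<close>.\<close>

theorem fourier_inversion:
  fixes f :: "'a::euclidean_space \<Rightarrow> complex"
  assumes f: "integrable lborel f" and cont: "continuous_on UNIV f" and bd: "\<And>x. norm (f x) \<le> C"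
    and ff: "integrable lborel (fourier f)"
  shows "inv_fourier (fourier f) x = f x"
proof -
  have [measurable]: "fourier f \<in> borel_measurable borel" using ff by auto
  let ?t = "\<lambda>k. inverse (real (Suc k))"
  let ?s = "\<lambda>k. LINT \<xi>|lborel. cis (\<xi> \<bullet> x) * (of_real (exp (- ?t k * (norm \<xi>)\<^sup>2)) * fourier f \<xi>)"
  have "?s \<longlonglongrightarrow> (LINT \<xi>|lborel. cis (\<xi> \<bullet> x) * (of_real (exp (- 0 * (norm \<xi>)\<^sup>2)) * fourier f \<xi>))"
  proof (rule integral_dominated_convergence[where w="\<lambda>\<xi>. norm (fourier f \<xi>)"])
    show "AE \<xi> in lborel. (\<lambda>k. cis (\<xi> \<bullet> x) * (of_real (exp (- ?t k * (norm \<xi>)\<^sup>2)) * fourier f \<xi>))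
       \<longlonglongrightarrow> cis (\<xi> \<bullet> x) * (of_real (exp (- 0 * (norm \<xi>)\<^sup>2)) * fourier f \<xi>)"
      by (intro AE_I2 tendsto_intros LIMSEQ_inverse_real_of_nat)
  qed (use ff in \<open>auto simp: norm_mult intro!: mult_left_le_one_le\<close>)
  moreover have "?s \<longlonglongrightarrow> (2 * pi) ^ DIM('a) * f (x - 0)"
    unfolding fourier_gauss[OF f _ bd, of "?t _" x, OF inverse_positive_iff_positive[THEN iffD2], OF of_nat_0_less_iff[THEN iffD2], OF zero_less_Suc]
    using cont by (intro gauss_kernel_approx_identity[where C=C] bd continuous_on_compose2[OF cont] continuous_intros) auto
  ultimately have "(LINT \<xi>|lborel. cis (\<xi> \<bullet> x) * (of_real (exp (- 0 * (norm \<xi>)\<^sup>2)) * fourier f \<xi>))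
      = (2 * pi) ^ DIM('a) * f (x - 0)"
    by (rule LIMSEQ_unique)
  then show ?thesis by (simp add: inv_fourier_def)
qed

text \<open>The sup norm contraction of the heat semigroup, which subordination later transfers to
  the Poisson semigroup.\<close>

lemma norm_inv_fourier_gauss_le:
  fixes f :: "'a::euclidean_space \<Rightarrow> complex"
  assumes f: "integrable lborel f" and t: "t > 0" and bd: "\<And>x. norm (f x) \<le> C"
  shows "norm (inv_fourier (\<lambda>\<xi>. of_real (exp (- t * (norm \<xi>)\<^sup>2)) * fourier f \<xi>) x) \<le> C"
proof -
  have [measurable]: "f \<in> borel_measurable borel" using f by auto
  show ?thesis
    unfolding inv_fourier_def fourier_gauss[OF f t bd] norm_divide
    using norm_integral_gauss_kernel_le[OF t _ bd, of "\<lambda>y. x - y"]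
    by (simp add: divide_le_eq norm_power norm_mult)
qed

section \<open>Plancherel for rapidly decreasing functions\<close>

lemma borel_measurable_cnj [measurable]: "cnj \<in> borel_measurable borel"
  by (intro borel_measurable_continuous_onI continuous_intros)

lemma cnj_fourier:
  "cnj (fourier f \<xi>) = (LINT x|lborel. cis (\<xi> \<bullet> x) * cnj (f x))"
proof -
  have "(LINT x|lborel. cnj (cis (- (\<xi> \<bullet> x)) * f x)) = cnj (fourier f \<xi>)"
    unfolding fourier_def by (rule Bochner_Integration.integral_cnj)
  then show ?thesis by (simp add: cis_cnj)
qed

lemma fourier_gauss_pairing:
  fixes f1 f2 :: "'a::euclidean_space \<Rightarrow> complex"
  assumes f1: "integrable lborel f1" and f2: "integrable lborel f2"
    and bd: "\<And>x. norm (f1 x) \<le> C" and t: "t > 0"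
  shows "(LINT \<xi>|lborel. of_real (exp (- t * (norm \<xi>)\<^sup>2)) * (fourier f1 \<xi> * cnj (fourier f2 \<xi>)))
    = (LINT x|lborel. cnj (f2 x) * (LINT y|lborel. f1 (x - y) * of_real (gauss_kernel t y)))"
proof -
  have [measurable]: "f1 \<in> borel_measurable borel" "f2 \<in> borel_measurable borel" using f1 f2 by auto
  have [measurable]: "fourier f1 \<in> borel_measurable borel"
    using continuous_on_fourier[OF f1] by (rule borel_measurable_continuous_onI)
  let ?e = "\<lambda>\<xi>::'a. complex_of_real (exp (- t * (norm \<xi>)\<^sup>2)) * fourier f1 \<xi>"
  let ?B = "LINT x|lborel. norm (f1 x)"
  have e: "integrable lborel ?e"
  proof (rule Bochner_Integration.integrable_bound)
    show "integrable lborel (\<lambda>\<xi>::'a. ?B * exp (- t * (norm \<xi>)\<^sup>2))"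
      using integrable_gaussian[OF t] by (rule integrable_mult_right)
    show "AE \<xi> in lborel. norm (?e \<xi>) \<le> norm (?B * exp (- t * (norm \<xi>)\<^sup>2))"
      using norm_fourier_le[OF f1] by (intro AE_I2) (simp add: norm_mult abs_mult)
  qed measurable
  have "integrable (lborel \<Otimes>\<^sub>M lborel) (\<lambda>(\<xi>, x). ?e \<xi> * cnj (f2 x))"
    using f2 by (intro lborel_pair.integrable_mult_pair[OF e]) simp
  then have i: "integrable (lborel \<Otimes>\<^sub>M lborel) (\<lambda>(\<xi>, x). ?e \<xi> * (cis (\<xi> \<bullet> x) * cnj (f2 x)))"
    by (rule Bochner_Integration.integrable_bound) (auto simp: norm_mult)
  have "(LINT \<xi>|lborel. of_real (exp (- t * (norm \<xi>)\<^sup>2)) * (fourier f1 \<xi> * cnj (fourier f2 \<xi>)))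
     = (LINT \<xi>|lborel. (LINT x|lborel. ?e \<xi> * (cis (\<xi> \<bullet> x) * cnj (f2 x))))"
    by (simp only: integral_mult_right_zero cnj_fourier mult.assoc)
  also have "\<dots> = (LINT x|lborel. (LINT \<xi>|lborel. ?e \<xi> * (cis (\<xi> \<bullet> x) * cnj (f2 x))))"
    by (rule lborel_pair.Fubini_integral[OF i, symmetric])
  also have "\<dots> = (LINT x|lborel. cnj (f2 x) * (LINT \<xi>|lborel. cis (\<xi> \<bullet> x) * ?e \<xi>))"
  proof (rule Bochner_Integration.integral_cong[OF refl])
    fix x
    have "(LINT \<xi>|lborel. ?e \<xi> * (cis (\<xi> \<bullet> x) * cnj (f2 x))) = (LINT \<xi>|lborel. cnj (f2 x) * (cis (\<xi> \<bullet> x) * ?e \<xi>))"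
      by (intro Bochner_Integration.integral_cong refl) (simp only: mult_ac)
    then show "(LINT \<xi>|lborel. ?e \<xi> * (cis (\<xi> \<bullet> x) * cnj (f2 x))) = cnj (f2 x) * (LINT \<xi>|lborel. cis (\<xi> \<bullet> x) * ?e \<xi>)"
      by (simp only: integral_mult_right_zero)
  qed
  finally show ?thesis unfolding fourier_gauss[OF f1 t bd] .
qed

text \<open>The damped pairing has a limit before the product of the two transforms is known to be
  integrable. With both functions equal, this limit is what proves square integrability of the
  transform.\<close>

lemma fourier_gauss_pairing_tendsto:
  fixes f1 f2 :: "'a::euclidean_space \<Rightarrow> complex"
  assumes f1: "integrable lborel f1" and f2: "integrable lborel f2"
    and bd: "\<And>x. norm (f1 x) \<le> C" and cont: "continuous_on UNIV f1"
  shows "(\<lambda>k. LINT \<xi>|lborel. of_real (exp (- inverse (real (Suc k)) * (norm \<xi>)\<^sup>2)) * (fourier f1 \<xi> * cnj (fourier f2 \<xi>)))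
    \<longlonglongrightarrow> (2 * pi) ^ DIM('a) * (LINT x|lborel. f1 x * cnj (f2 x))"
proof -
  have [measurable]: "f1 \<in> borel_measurable borel" "f2 \<in> borel_measurable borel" using f1 f2 by auto
  let ?t = "\<lambda>k. inverse (real (Suc k))"
  have t: "?t k > 0" for k by simp
  have "(\<lambda>k. LINT x|lborel. cnj (f2 x) * (LINT y|lborel. f1 (x - y) * of_real (gauss_kernel (?t k) y)))
    \<longlonglongrightarrow> (LINT x|lborel. cnj (f2 x) * ((2 * pi) ^ DIM('a) * f1 x))"
  proof (rule integral_dominated_convergence[where w="\<lambda>x. norm (f2 x) * (C * (2 * pi) ^ DIM('a))"])
    show "AE x in lborel. (\<lambda>k. cnj (f2 x) * (LINT y|lborel. f1 (x - y) * of_real (gauss_kernel (?t k) y)))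
       \<longlonglongrightarrow> cnj (f2 x) * ((2 * pi) ^ DIM('a) * f1 x)"
    proof (intro AE_I2 tendsto_intros)
      fix x
      show "(\<lambda>k. LINT y|lborel. f1 (x - y) * of_real (gauss_kernel (?t k) y)) \<longlonglongrightarrow> (2 * pi) ^ DIM('a) * f1 x"
      proof -
        have "continuous_on UNIV (\<lambda>y. f1 (x - y))"
          by (rule continuous_on_compose2[OF cont]) (auto intro!: continuous_intros)
        from gauss_kernel_approx_identity[OF this bd] show ?thesis by simp
      qed
    qed
    show "integrable lborel (\<lambda>x. norm (f2 x) * (C * (2 * pi) ^ DIM('a)))" using f2 by simp
    show "AE x in lborel. norm (cnj (f2 x) * (LINT y|lborel. f1 (x - y) * of_real (gauss_kernel (?t k) y)))
       \<le> norm (f2 x) * (C * (2 * pi) ^ DIM('a))" for k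
    proof (rule AE_I2)
      fix x
      have "norm (LINT y|lborel. f1 (x - y) * of_real (gauss_kernel (?t k) y)) \<le> C * (2 * pi) ^ DIM('a)"
        by (rule norm_integral_gauss_kernel_le[OF t _ bd]) measurable
      then show "norm (cnj (f2 x) * (LINT y|lborel. f1 (x - y) * of_real (gauss_kernel (?t k) y)))
         \<le> norm (f2 x) * (C * (2 * pi) ^ DIM('a))"
        unfolding norm_mult complex_mod_cnj by (rule mult_left_mono) simp
    qed
  qed measurable
  then show ?thesis
    unfolding fourier_gauss_pairing[OF f1 f2 bd t]
    by (simp only: mult.left_commute[of "cnj _"] integral_mult_right_zero) (simp add: mult.commute)
qed

text \<open>The damped integrals of the squared modulus increase with \<open>k\<close> and converge,
  so monotone convergence yields integrability of the limit.\<close>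

lemma integrable_fourier_sq:
  fixes f :: "'a::euclidean_space \<Rightarrow> complex"
  assumes f: "integrable lborel f" and bd: "\<And>x. norm (f x) \<le> C" and cont: "continuous_on UNIV f"
  shows "integrable lborel (\<lambda>\<xi>. (norm (fourier f \<xi>))\<^sup>2)"
proof -
  have [measurable]: "fourier f \<in> borel_measurable borel"
    using continuous_on_fourier[OF f] by (rule borel_measurable_continuous_onI)
  let ?t = "\<lambda>k. inverse (real (Suc k))"
  let ?B = "LINT x|lborel. norm (f x)"
  let ?e = "\<lambda>k \<xi>. exp (- ?t k * (norm \<xi>)\<^sup>2) * (norm (fourier f \<xi>))\<^sup>2"
  have i: "integrable lborel (?e k)" for k
  proof (rule Bochner_Integration.integrable_bound)
    show "integrable lborel (\<lambda>\<xi>::'a. exp (- ?t k * (norm \<xi>)\<^sup>2) * ?B\<^sup>2)"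
      by (intro integrable_mult_left integrable_gaussian) simp
    show "AE \<xi> in lborel. norm (?e k \<xi>) \<le> norm (exp (- ?t k * (norm \<xi>)\<^sup>2) * ?B\<^sup>2)"
      using norm_fourier_le[OF f] by (intro AE_I2) (auto simp: norm_mult intro!: power_mono)
  qed measurable
  have e: "of_real (exp (- ?t k * (norm \<xi>)\<^sup>2)) * (fourier f \<xi> * cnj (fourier f \<xi>)) = complex_of_real (?e k \<xi>)"
    for k \<xi> by (simp only: complex_norm_square of_real_mult of_real_power[symmetric])
  have "(\<lambda>k. complex_of_real (integral\<^sup>L lborel (?e k))) \<longlonglongrightarrow> (2 * pi) ^ DIM('a) * (LINT x|lborel. f x * cnj (f x))"
    using fourier_gauss_pairing_tendsto[OF f f bd cont] unfolding e integral_complex_of_real .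
  then have lim: "(\<lambda>k. integral\<^sup>L lborel (?e k)) \<longlonglongrightarrow> Re ((2 * pi) ^ DIM('a) * (LINT x|lborel. f x * cnj (f x)))"
    using tendsto_Re by fastforce
  show ?thesis
  proof (rule integrable_monotone_convergence[OF i _ _ lim])
    show "AE \<xi> in lborel. mono (\<lambda>k. ?e k \<xi>)"
      by (intro AE_I2 monoI mult_right_mono) (auto intro!: mult_right_mono simp: field_simps)
    show "AE \<xi> in lborel. (\<lambda>k. ?e k \<xi>) \<longlonglongrightarrow> (norm (fourier f \<xi>))\<^sup>2"
    proof (rule AE_I2)
      fix \<xi>
      have "(\<lambda>k. ?e k \<xi>) \<longlonglongrightarrow> exp (- 0 * (norm \<xi>)\<^sup>2) * (norm (fourier f \<xi>))\<^sup>2"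
        by (intro tendsto_intros LIMSEQ_inverse_real_of_nat)
      then show "(\<lambda>k. ?e k \<xi>) \<longlonglongrightarrow> (norm (fourier f \<xi>))\<^sup>2" by simp
    qed
  qed measurable
qed

lemma integrable_mult_of_squares:
  fixes f g :: "'a \<Rightarrow> 'b::{real_normed_field, banach, second_countable_topology}"
  assumes [measurable]: "f \<in> borel_measurable M" "g \<in> borel_measurable M"
    and "integrable M (\<lambda>x. (norm (f x))\<^sup>2)" "integrable M (\<lambda>x. (norm (g x))\<^sup>2)"
  shows "integrable M (\<lambda>x. f x * g x)"
proof (rule Bochner_Integration.integrable_bound)
  show "integrable M (\<lambda>x. (norm (f x))\<^sup>2 + (norm (g x))\<^sup>2)" using assms by simp
  have "norm (f x * g x) \<le> (norm (f x))\<^sup>2 + (norm (g x))\<^sup>2" for x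
  proof -
    have "2 * (norm (f x) * norm (g x)) \<le> (norm (f x))\<^sup>2 + (norm (g x))\<^sup>2"
      using sum_squares_bound[of "norm (f x)" "norm (g x)"] by simp
    moreover have "0 \<le> norm (f x) * norm (g x)" by simp
    ultimately show ?thesis by (simp only: norm_mult)
  qed
  then show "AE x in M. norm (f x * g x) \<le> norm ((norm (f x))\<^sup>2 + (norm (g x))\<^sup>2)"
    by (intro AE_I2) simp
qed measurable

text \<open>Once the transforms are square integrable, their product is a majorant of its damped
  versions, and the damping can be removed by dominated convergence.\<close>

theorem plancherel:
  fixes f1 f2 :: "'a::euclidean_space \<Rightarrow> complex"
  assumes f1: "integrable lborel f1" "\<And>x. norm (f1 x) \<le> C1" "continuous_on UNIV f1"
    and f2: "integrable lborel f2" "\<And>x. norm (f2 x) \<le> C2" "continuous_on UNIV f2"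
  shows integrable_fourier_mult_cnj: "integrable lborel (\<lambda>\<xi>. fourier f1 \<xi> * cnj (fourier f2 \<xi>))"
    and integral_fourier_mult_cnj: "(LINT \<xi>|lborel. fourier f1 \<xi> * cnj (fourier f2 \<xi>))
      = (2 * pi) ^ DIM('a) * (LINT x|lborel. f1 x * cnj (f2 x))"
proof -
  have [measurable]: "fourier f1 \<in> borel_measurable borel" "fourier f2 \<in> borel_measurable borel"
    using continuous_on_fourier f1 f2 by (auto intro!: borel_measurable_continuous_onI)
  show i: "integrable lborel (\<lambda>\<xi>. fourier f1 \<xi> * cnj (fourier f2 \<xi>))"
    using integrable_fourier_sq[OF f1] integrable_fourier_sq[OF f2]
    by (intro integrable_mult_of_squares) auto
  let ?t = "\<lambda>k. inverse (real (Suc k))"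
  let ?s = "\<lambda>k. LINT \<xi>|lborel. of_real (exp (- ?t k * (norm \<xi>)\<^sup>2)) * (fourier f1 \<xi> * cnj (fourier f2 \<xi>))"
  have "?s \<longlonglongrightarrow> (LINT \<xi>|lborel. of_real (exp (- 0 * (norm \<xi>)\<^sup>2)) * (fourier f1 \<xi> * cnj (fourier f2 \<xi>)))"
  proof (rule integral_dominated_convergence[where w="\<lambda>\<xi>. norm (fourier f1 \<xi> * cnj (fourier f2 \<xi>))"])
    show "AE \<xi> in lborel. (\<lambda>k. of_real (exp (- ?t k * (norm \<xi>)\<^sup>2)) * (fourier f1 \<xi> * cnj (fourier f2 \<xi>)))
       \<longlonglongrightarrow> of_real (exp (- 0 * (norm \<xi>)\<^sup>2)) * (fourier f1 \<xi> * cnj (fourier f2 \<xi>))"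
      by (intro AE_I2 tendsto_intros LIMSEQ_inverse_real_of_nat)
    show "integrable lborel (\<lambda>\<xi>. norm (fourier f1 \<xi> * cnj (fourier f2 \<xi>)))"
      using i by (rule integrable_norm)
  qed (auto simp: norm_mult intro!: mult_left_le_one_le)
  from LIMSEQ_unique[OF this fourier_gauss_pairing_tendsto[OF f1(1) f2(1) f1(2,3)]]
  show "(LINT \<xi>|lborel. fourier f1 \<xi> * cnj (fourier f2 \<xi>))
      = (2 * pi) ^ DIM('a) * (LINT x|lborel. f1 x * cnj (f2 x))" by simp
qed

section \<open>Hermitian rapidly decreasing symbols and Plancherel for their inverse
  transforms\<close>

text \<open>The symmetry \<open>g (- \<xi>) = cnj (g \<xi>)\<close> makes the inverse transform of \<open>g\<close> real; in \<open>synth\<close> below,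
  \<^const>\<open>Re\<close> only changes the type.\<close>

definition rapid :: "('a::euclidean_space \<Rightarrow> complex) \<Rightarrow> bool" where
  "rapid g \<longleftrightarrow> continuous_on UNIV g \<and> (\<forall>\<xi>. g (- \<xi>) = cnj (g \<xi>)) \<and>
     (\<forall>N. \<exists>C. \<forall>\<xi>. (1 + norm \<xi>) ^ N * norm (g \<xi>) \<le> C)"

definition synth :: "('a::euclidean_space \<Rightarrow> complex) \<Rightarrow> 'a \<Rightarrow> real" where
  "synth g x = Re (inv_fourier g x)"

lemma rapid_continuous: "rapid g \<Longrightarrow> continuous_on UNIV g"
  by (simp add: rapid_def)

lemma rapid_uminus_arg: "rapid g \<Longrightarrow> g (- \<xi>) = cnj (g \<xi>)"
  by (simp add: rapid_def)

lemma rapid_decay: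
  assumes "rapid g"
  obtains C where "C \<ge> 0" "\<And>\<xi>. (1 + norm \<xi>) ^ N * norm (g \<xi>) \<le> C"
proof -
  obtain C where C: "\<And>\<xi>. (1 + norm \<xi>) ^ N * norm (g \<xi>) \<le> C"
    using assms unfolding rapid_def by blast
  moreover have "C \<ge> 0" using order_trans[OF _ C[of 0]] by simp
  ultimately show ?thesis using that by blast
qed

lemma rapid_bounded:
  assumes "rapid g" obtains C where "C \<ge> 0" "\<And>\<xi>. norm (g \<xi>) \<le> C"
  using rapid_decay[OF assms, of 0] by auto

lemma rapid_measurable: "rapid g \<Longrightarrow> g \<in> borel_measurable borel"
  by (rule borel_measurable_continuous_onI) (rule rapid_continuous)

lemma rapid_integrable_weight:
  fixes g :: "'a::euclidean_space \<Rightarrow> complex"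
  assumes g: "rapid g"
  shows "integrable lborel (\<lambda>\<xi>. (1 + norm \<xi>) ^ k * norm (g \<xi>))"
proof -
  have [measurable]: "g \<in> borel_measurable borel" using g by (rule rapid_measurable)
  obtain C where C: "C \<ge> 0" "\<And>\<xi>. (1 + norm \<xi>) ^ (k + 2 * DIM('a)) * norm (g \<xi>) \<le> C"
    using rapid_decay[OF g] by blast
  show ?thesis
  proof (rule Bochner_Integration.integrable_bound)
    show "integrable lborel (\<lambda>\<xi>::'a. C * (1 / (1 + norm \<xi>) ^ (2 * DIM('a))))"
      using integrable_decay by (rule integrable_mult_right)
    show "AE \<xi> in lborel. norm ((1 + norm \<xi>) ^ k * norm (g \<xi>)) \<le> norm (C * (1 / (1 + norm \<xi>) ^ (2 * DIM('a))))"
    proof (rule AE_I2)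
      fix \<xi> :: 'a
      have p: "(1 + norm \<xi>) ^ (2 * DIM('a)) > 0" by (intro zero_less_power) (simp add: add_pos_nonneg)
      have "(1 + norm \<xi>) ^ k * norm (g \<xi>) \<le> C / (1 + norm \<xi>) ^ (2 * DIM('a))"
        using C(2)[of \<xi>] p by (simp add: pos_le_divide_eq power_add mult_ac)
      then show "norm ((1 + norm \<xi>) ^ k * norm (g \<xi>)) \<le> norm (C * (1 / (1 + norm \<xi>) ^ (2 * DIM('a))))"
        using C(1) p by simp
    qed
  qed measurable
qed

lemma rapid_integrable: "rapid g \<Longrightarrow> integrable lborel g"
  using rapid_integrable_weight[of g 0] rapid_measurable[of g] by (auto simp: integrable_norm_iff)

lemma inv_fourier_eq_fourier:
  fixes g :: "'a::euclidean_space \<Rightarrow> complex"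
  shows "inv_fourier g x = fourier g (- x) / (2 * pi) ^ DIM('a)"
  by (simp add: inv_fourier_def fourier_def inner_commute)

lemma fourier_uminus_arg:
  fixes g :: "'a::euclidean_space \<Rightarrow> complex"
  assumes "integrable lborel g"
  shows "fourier g (- x) = fourier (\<lambda>\<xi>. g (- \<xi>)) x"
proof -
  have [measurable]: "g \<in> borel_measurable borel" using assms by auto
  have "integrable lborel (\<lambda>\<xi>. cis (- (- x \<bullet> \<xi>)) * g \<xi>)"
    by (rule Bochner_Integration.integrable_bound[OF assms]) (auto simp: norm_mult)
  from integral_lborel_uminus[OF this] show ?thesis by (simp add: fourier_def)
qed

lemma cnj_fourier_hermitian:
  assumes "integrable lborel g" "\<And>\<xi>. g (- \<xi>) = cnj (g \<xi>)"
  shows "cnj (fourier g x) = fourier g x"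
proof -
  have "cnj (fourier g x) = fourier (\<lambda>\<xi>. cnj (g \<xi>)) (- x)"
    unfolding cnj_fourier by (simp add: fourier_def)
  also have "\<dots> = fourier g x"
    using assms by (subst fourier_uminus_arg) (auto simp: complex_cnj_cnj)
  finally show ?thesis .
qed

lemma of_real_synth:
  assumes "rapid g" shows "of_real (synth g x) = inv_fourier g x"
proof -
  have "cnj (inv_fourier g x) = inv_fourier g x"
    unfolding inv_fourier_eq_fourier
    using cnj_fourier_hermitian[OF rapid_integrable[OF assms] rapid_uminus_arg[OF assms]] by simp
  then show ?thesis
    unfolding synth_def by (simp add: complex_eq_iff)
qed

lemma continuous_on_synth:
  assumes "rapid g" shows "continuous_on UNIV (synth g)"
proof -
  have "continuous_on UNIV (\<lambda>x. fourier g (- x))"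
    using continuous_on_fourier[OF rapid_integrable[OF assms]]
    by (rule continuous_on_compose2) (auto intro!: continuous_intros)
  then show ?thesis
    unfolding synth_def[abs_def] inv_fourier_eq_fourier by (intro continuous_intros) auto
qed

lemma synth_bounded:
  fixes g :: "'a::euclidean_space \<Rightarrow> complex"
  assumes "rapid g"
  obtains C where "C \<ge> 0" "\<And>x. \<bar>synth g x\<bar> \<le> C"
proof
  let ?C = "(LINT \<xi>|lborel. norm (g \<xi>)) / (2 * pi) ^ DIM('a)"
  show "?C \<ge> 0" by simp
  fix x
  have "\<bar>synth g x\<bar> \<le> norm (inv_fourier g x)" unfolding synth_def by (rule abs_Re_le_cmod)
  also have "\<dots> \<le> ?C"
    unfolding inv_fourier_eq_fourier using norm_fourier_le[OF rapid_integrable[OF assms]]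
    by (simp add: norm_divide norm_mult norm_power divide_right_mono)
  finally show "\<bar>synth g x\<bar> \<le> ?C" .
qed

text \<open>By the Hermitian symmetry \<open>synth g\<close> is, up to the power of 2 pi, the
  forward transform of \<open>cnj g\<close>, so Plancherel for forward transforms applies with the
  roles of space and frequency exchanged.\<close>

theorem synth_plancherel:
  fixes g1 g2 :: "'a::euclidean_space \<Rightarrow> complex"
  assumes g1: "rapid g1" and g2: "rapid g2"
  shows integrable_synth_mult: "integrable lborel (\<lambda>x. synth g1 x * synth g2 x)"
    and integral_synth_mult: "complex_of_real (LINT x|lborel. synth g1 x * synth g2 x)
      = (LINT \<xi>|lborel. g1 \<xi> * cnj (g2 \<xi>)) / (2 * pi) ^ DIM('a)"
proof -
  let ?h = "\<lambda>g. \<lambda>\<xi>::'a. cnj (g \<xi>)"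
  let ?c = "complex_of_real ((2 * pi) ^ DIM('a))"
  have c: "?c \<noteq> 0" by simp
  have s: "complex_of_real (synth g x) = fourier (?h g) x / ?c"
    if "rapid g" for g and x :: 'a
    using that by (simp add: of_real_synth inv_fourier_eq_fourier fourier_uminus_arg rapid_integrable rapid_uminus_arg)
  have p: "complex_of_real (synth g1 x * synth g2 x) = (fourier (?h g1) x * cnj (fourier (?h g2) x)) / (?c * ?c)" for x
  proof -
    have "complex_of_real (synth g1 x * synth g2 x) = of_real (synth g1 x) * cnj (of_real (synth g2 x))" by simp
    then show ?thesis unfolding s[OF g1] s[OF g2] by (simp add: field_simps)
  qed
  obtain C1 C2 where C: "\<And>\<xi>. norm (g1 \<xi>) \<le> C1" "\<And>\<xi>. norm (g2 \<xi>) \<le> C2"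
    using rapid_bounded[OF g1] rapid_bounded[OF g2] by metis
  have a: "integrable lborel (?h g1)" "integrable lborel (?h g2)"
    using rapid_integrable[OF g1] rapid_integrable[OF g2] by auto
  have b: "continuous_on UNIV (?h g1)" "continuous_on UNIV (?h g2)"
    using rapid_continuous[OF g1] rapid_continuous[OF g2] by (auto intro!: continuous_intros)
  have d: "norm (?h g1 \<xi>) \<le> C1" "norm (?h g2 \<xi>) \<le> C2" for \<xi> using C by auto
  note P = plancherel[OF a(1) d(1) b(1) a(2) d(2) b(2)]
  have "integrable lborel (\<lambda>x. complex_of_real (synth g1 x * synth g2 x))"
    unfolding p using P(1) by (rule integrable_divide_zero)
  then show "integrable lborel (\<lambda>x. synth g1 x * synth g2 x)"
    using complex_of_real_integrable_eq by blast
  have "complex_of_real (LINT x|lborel. synth g1 x * synth g2 x) = (LINT x|lborel. complex_of_real (synth g1 x * synth g2 x))"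
    by (rule integral_complex_of_real[symmetric])
  also have "\<dots> = ?c * (LINT \<xi>|lborel. cnj (g1 \<xi>) * g2 \<xi>) / (?c * ?c)"
    unfolding p using P(2) by simp
  also have "\<dots> = (LINT \<xi>|lborel. cnj (g1 \<xi>) * g2 \<xi>) / ?c" using c by simp
  \<comment> \<open>The reflection \<xi> to -\<xi> turns each symbol into its conjugate and so moves
    the conjugation to the other factor.\<close>
  also have "(LINT \<xi>|lborel. cnj (g1 \<xi>) * g2 \<xi>) = (LINT \<xi>|lborel. g1 \<xi> * cnj (g2 \<xi>))"
  proof -
    have [measurable]: "g1 \<in> borel_measurable borel" "g2 \<in> borel_measurable borel"
      using g1 g2 by (auto intro: rapid_measurable)
    have "integrable lborel (\<lambda>\<xi>. cnj (g1 \<xi>) * g2 \<xi>)"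
    proof (rule Bochner_Integration.integrable_bound)
      show "integrable lborel (\<lambda>\<xi>. of_real C1 * g2 \<xi>)" using rapid_integrable[OF g2] by simp
      show "AE \<xi> in lborel. norm (cnj (g1 \<xi>) * g2 \<xi>) \<le> norm (of_real C1 * g2 \<xi>)"
        using C(1) by (intro AE_I2) (auto simp: norm_mult intro!: mult_right_mono order_trans[OF C(1) abs_ge_self])
    qed measurable
    from integral_lborel_uminus[OF this] show ?thesis
      using g1 g2 by (simp add: rapid_uminus_arg)
  qed
  finally show "complex_of_real (LINT x|lborel. synth g1 x * synth g2 x)
      = (LINT \<xi>|lborel. g1 \<xi> * cnj (g2 \<xi>)) / (2 * pi) ^ DIM('a)" by simp
qed

text \<open>Inversion applied to \<open>g\<close> itself, with \<open>fourier g\<close> known to be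
  integrable through \<open>synth g\<close>. Continuity and decay of \<open>g\<close> alone do not
  make \<open>synth g\<close> integrable, hence the separate hypothesis.\<close>

lemma fourier_synth:
  fixes g :: "'a::euclidean_space \<Rightarrow> complex"
  assumes g: "rapid g" and i: "integrable lborel (synth g)"
  shows "fourier (\<lambda>x. of_real (synth g x)) \<xi> = g \<xi>"
proof -
  let ?c = "complex_of_real ((2 * pi) ^ DIM('a))"
  have c: "?c \<noteq> 0" by simp
  obtain C where C: "\<And>\<xi>. norm (g \<xi>) \<le> C" using rapid_bounded[OF g] by metis
  have s: "fourier g x = ?c * of_real (synth g (- x))" for x
    using c by (simp add: of_real_synth[OF g] inv_fourier_eq_fourier)
  have i': "integrable lborel (fourier g)"
    unfolding s using integrable_lborel_uminus[OF i] by (intro integrable_mult_right integrable_of_real)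
  have "fourier (\<lambda>x. of_real (synth g x)) \<xi> = fourier (\<lambda>x. of_real (synth g (- x))) (- \<xi>)"
    using fourier_uminus_arg[of "\<lambda>x. complex_of_real (synth g x)" "- \<xi>"] i by simp
  also have "\<dots> = inv_fourier (fourier g) \<xi>"
  proof -
    have "fourier (fourier g) (- \<xi>) = (LINT x|lborel. ?c * (cis (- (- \<xi> \<bullet> x)) * of_real (synth g (- x))))"
      unfolding s fourier_def[of "\<lambda>x. _ x * _ x"] fourier_def[of "\<lambda>x. ?c * _ x"]
      by (intro Bochner_Integration.integral_cong refl) (simp only: mult_ac)
    also have "\<dots> = ?c * fourier (\<lambda>x. of_real (synth g (- x))) (- \<xi>)"
      by (simp only: integral_mult_right_zero fourier_def)
    finally show ?thesis unfolding inv_fourier_eq_fourier using c by simp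
  qed
  also have "\<dots> = g \<xi>"
    by (rule fourier_inversion[OF rapid_integrable[OF g] rapid_continuous[OF g] C i'])
  finally show ?thesis .
qed

section \<open>Stability of rapidly decreasing symbols under linear operations and
  multipliers\<close>

lemma rapidI:
  assumes "continuous_on UNIV g" "\<And>\<xi>. g (- \<xi>) = cnj (g \<xi>)" "\<And>N. \<exists>C. \<forall>\<xi>. (1 + norm \<xi>) ^ N * norm (g \<xi>) \<le> C"
  shows "rapid g"
  using assms by (auto simp: rapid_def)

lemma rapid_zero [simp]: "rapid (\<lambda>_. 0)"
  by (rule rapidI) (auto intro: exI[of _ 0])

lemma rapid_add:
  assumes f: "rapid f" and g: "rapid g" shows "rapid (\<lambda>\<xi>. f \<xi> + g \<xi>)"
proof (rule rapidI)
  fix N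
  obtain C where C: "\<And>\<xi>. (1 + norm \<xi>) ^ N * norm (f \<xi>) \<le> C" using rapid_decay[OF f] by metis
  obtain D where D: "\<And>\<xi>. (1 + norm \<xi>) ^ N * norm (g \<xi>) \<le> D" using rapid_decay[OF g] by metis
  show "\<exists>C. \<forall>\<xi>. (1 + norm \<xi>) ^ N * norm (f \<xi> + g \<xi>) \<le> C"
  proof (intro exI allI)
    fix \<xi>
    have "(1 + norm \<xi>) ^ N * norm (f \<xi> + g \<xi>) \<le> (1 + norm \<xi>) ^ N * (norm (f \<xi>) + norm (g \<xi>))"
      by (intro mult_left_mono norm_triangle_ineq) auto
    also have "\<dots> \<le> C + D" using C[of \<xi>] D[of \<xi>] by (simp add: distrib_left)
    finally show "(1 + norm \<xi>) ^ N * norm (f \<xi> + g \<xi>) \<le> C + D" .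
  qed
qed (use rapid_continuous[OF f] rapid_continuous[OF g] in
  \<open>auto simp: rapid_uminus_arg[OF f] rapid_uminus_arg[OF g] intro!: continuous_intros\<close>)

text \<open>Multipliers that preserve \<open>rapid\<close>. Only continuity is asked, so that
  |\<xi>| and the Poisson factors, which are not smooth at the origin, are included.\<close>

definition symb :: "('a::euclidean_space \<Rightarrow> complex) \<Rightarrow> bool" where
  "symb p \<longleftrightarrow> continuous_on UNIV p \<and> (\<forall>\<xi>. p (- \<xi>) = cnj (p \<xi>)) \<and>
     (\<exists>k C. \<forall>\<xi>. norm (p \<xi>) \<le> C * (1 + norm \<xi>) ^ k)"

lemma symb_measurable: "symb p \<Longrightarrow> p \<in> borel_measurable borel"
  unfolding symb_def by (blast intro: borel_measurable_continuous_onI)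

lemma rapid_symb_mult:
  assumes p: "symb p" and g: "rapid g" shows "rapid (\<lambda>\<xi>. p \<xi> * g \<xi>)"
proof (rule rapidI)
  fix N
  obtain k C where C: "\<And>\<xi>. norm (p \<xi>) \<le> C * (1 + norm \<xi>) ^ k" using p unfolding symb_def by blast
  obtain D where D: "\<And>\<xi>. (1 + norm \<xi>) ^ (N + k) * norm (g \<xi>) \<le> D" using rapid_decay[OF g] by metis
  have C0: "C \<ge> 0" using order_trans[OF norm_ge_zero C[of 0]] by simp
  show "\<exists>C. \<forall>\<xi>. (1 + norm \<xi>) ^ N * norm (p \<xi> * g \<xi>) \<le> C"
  proof (intro exI allI)
    fix \<xi>
    have "(1 + norm \<xi>) ^ N * norm (p \<xi> * g \<xi>) \<le> (1 + norm \<xi>) ^ N * (C * (1 + norm \<xi>) ^ k * norm (g \<xi>))"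
      unfolding norm_mult using C by (intro mult_left_mono mult_right_mono) auto
    also have "\<dots> = C * ((1 + norm \<xi>) ^ (N + k) * norm (g \<xi>))" by (simp add: power_add)
    also have "\<dots> \<le> C * D" using C0 D by (intro mult_left_mono)
    finally show "(1 + norm \<xi>) ^ N * norm (p \<xi> * g \<xi>) \<le> C * D" .
  qed
qed (use p rapid_continuous[OF g] in
  \<open>auto simp: symb_def rapid_uminus_arg[OF g] intro!: continuous_intros\<close>)

lemma symb_const [simp]: "symb (\<lambda>_. of_real c)"
  unfolding symb_def by (intro conjI exI[of _ "\<bar>c\<bar>"] exI[of _ 0]) auto

lemma symb_norm [simp]: "symb (\<lambda>\<xi>. of_real (norm \<xi>))"
  unfolding symb_def by (intro conjI exI[of _ 1]) (auto intro!: continuous_intros)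

lemma symb_inner [simp]: "symb (\<lambda>\<xi>. \<i> * of_real (\<xi> \<bullet> v))"
  unfolding symb_def
proof (intro conjI exI[of _ "norm v"] exI[of _ 1] allI)
  fix \<xi>
  have "norm (\<i> * complex_of_real (\<xi> \<bullet> v)) \<le> norm \<xi> * norm v"
    by (simp add: norm_mult Cauchy_Schwarz_ineq2)
  also have "\<dots> \<le> norm v * (1 + norm \<xi>) ^ 1" by (simp add: algebra_simps)
  finally show "norm (\<i> * complex_of_real (\<xi> \<bullet> v)) \<le> norm v * (1 + norm \<xi>) ^ 1" .
qed (auto intro!: continuous_intros)

lemma symb_poisson [simp]: "z \<ge> 0 \<Longrightarrow> symb (\<lambda>\<xi>. of_real (exp (- (z * norm \<xi>))))"
  unfolding symb_def by (intro conjI exI[of _ 1] exI[of _ 0]) (auto intro!: continuous_intros)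

lemma rapid_cmult: "rapid g \<Longrightarrow> rapid (\<lambda>\<xi>. of_real c * g \<xi>)"
  by (rule rapid_symb_mult) auto

lemma rapid_diff: "rapid f \<Longrightarrow> rapid g \<Longrightarrow> rapid (\<lambda>\<xi>. f \<xi> - g \<xi>)"
  using rapid_add[of f "\<lambda>\<xi>. of_real (-1) * g \<xi>"] rapid_cmult[of g "-1"] by simp

lemma rapid_sum: "(\<And>i. i \<in> I \<Longrightarrow> rapid (g i)) \<Longrightarrow> rapid (\<lambda>\<xi>. \<Sum>i\<in>I. g i \<xi>)"
  by (induction I rule: infinite_finite_induct) (auto intro: rapid_add)

lemma integrable_cis_mult:
  fixes g :: "'a::euclidean_space \<Rightarrow> complex"
  assumes "integrable lborel g" shows "integrable lborel (\<lambda>\<xi>. cis (\<xi> \<bullet> x) * g \<xi>)"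
proof -
  have [measurable]: "g \<in> borel_measurable borel" using assms by auto
  show ?thesis
    by (rule Bochner_Integration.integrable_bound[OF assms]) (auto simp: norm_mult)
qed

lemma synth_add:
  assumes "rapid f" "rapid g" shows "synth (\<lambda>\<xi>. f \<xi> + g \<xi>) x = synth f x + synth g x"
  using assms[THEN rapid_integrable, THEN integrable_cis_mult[where x=x]]
  by (simp add: synth_def inv_fourier_def distrib_left add_divide_distrib)

lemma synth_cmult: "synth (\<lambda>\<xi>. of_real c * g \<xi>) x = c * synth g x"
proof -
  have "(LINT \<xi>|lborel. cis (\<xi> \<bullet> x) * (of_real c * g \<xi>)) = of_real c * (LINT \<xi>|lborel. cis (\<xi> \<bullet> x) * g \<xi>)"
    by (simp only: mult.left_commute[of _ "of_real c"] integral_mult_right_zero)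
  then have "inv_fourier (\<lambda>\<xi>. of_real c * g \<xi>) x = of_real c * inv_fourier g x"
    by (simp add: inv_fourier_def)
  then show ?thesis by (simp add: synth_def)
qed

lemma synth_diff:
  assumes "rapid f" "rapid g" shows "synth (\<lambda>\<xi>. f \<xi> - g \<xi>) x = synth f x - synth g x"
  using synth_add[OF assms(1) rapid_cmult[OF assms(2), of "-1"], of x] synth_cmult[of "-1" g x] by simp

lemma synth_sum:
  assumes "\<And>i. i \<in> I \<Longrightarrow> rapid (g i)"
  shows "synth (\<lambda>\<xi>. \<Sum>i\<in>I. g i \<xi>) x = (\<Sum>i\<in>I. synth (g i) x)"
  using assms
proof (induction I rule: infinite_finite_induct)
  case (insert i I)
  then show ?case by (simp add: synth_add rapid_sum)
qed (simp_all add: synth_def inv_fourier_def)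

section \<open>Derivatives and products of inverse transforms\<close>

lemma norm_cis_minus_linear: "norm (cis a - 1 - \<i> * of_real a) \<le> a\<^sup>2 / 2"
proof -
  have "norm (iexp a - (\<Sum>k\<le>1. (\<i> * a) ^ k / fact k)) \<le> \<bar>a\<bar> ^ Suc 1 / fact (Suc 1)"
    by (rule iexp_approx1)
  then show ?thesis by (simp add: cis_conv_exp power2_eq_square abs_mult_self_eq algebra_simps)
qed

text \<open>The first order Taylor remainder of the character is at most
  \<open>(\<xi> \<bullet> h)\<^sup>2 / 2\<close>. Integrated against \<open>norm (g \<xi>)\<close>
  it gives a quadratic error in \<open>h\<close>, uniformly in \<open>x\<close>, since
  \<open>g\<close> has finite second moment.\<close>

theorem synth_has_derivative:
  fixes g :: "'a::euclidean_space \<Rightarrow> complex"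
  assumes g: "rapid g"
  shows "(synth g has_derivative (\<lambda>v. synth (\<lambda>\<xi>. \<i> * of_real (\<xi> \<bullet> v) * g \<xi>) x)) (at x)"
proof -
  let ?D = "\<lambda>v. synth (\<lambda>\<xi>. \<i> * of_real (\<xi> \<bullet> v) * g \<xi>) x"
  have r: "rapid (\<lambda>\<xi>. \<i> * of_real (\<xi> \<bullet> v) * g \<xi>)" for v
    by (rule rapid_symb_mult[OF symb_inner g])
  have [measurable]: "g \<in> borel_measurable borel" using g by (rule rapid_measurable)
  have lin: "linear ?D"
  proof (rule linearI)
    show "?D (v + w) = ?D v + ?D w" for v w
      using synth_add[OF r r, of v w x] by (simp add: inner_add_right distrib_left distrib_right)
    show "?D (c *\<^sub>R v) = c *\<^sub>R ?D v" for c v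
      using synth_cmult[of c "\<lambda>\<xi>. \<i> * of_real (\<xi> \<bullet> v) * g \<xi>" x] by (simp add: mult_ac)
  qed
  define K where "K = (LINT \<xi>|lborel. (1 + norm \<xi>) ^ 2 * norm (g \<xi>))"
  have bound: "\<bar>synth g (x + h) - synth g x - ?D h\<bar> \<le> K * (norm h)\<^sup>2" for h
  proof -
    let ?R = "\<lambda>\<xi>. cis (\<xi> \<bullet> x) * ((cis (\<xi> \<bullet> h) - 1 - \<i> * of_real (\<xi> \<bullet> h)) * g \<xi>)"
    have i: "integrable lborel (\<lambda>\<xi>. cis (\<xi> \<bullet> (x + h)) * g \<xi>)" "integrable lborel (\<lambda>\<xi>. cis (\<xi> \<bullet> x) * g \<xi>)"
      "integrable lborel (\<lambda>\<xi>. cis (\<xi> \<bullet> x) * (\<i> * of_real (\<xi> \<bullet> h) * g \<xi>))"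
      by (intro integrable_cis_mult rapid_integrable g r)+
    have "?R = (\<lambda>\<xi>. cis (\<xi> \<bullet> (x + h)) * g \<xi> - cis (\<xi> \<bullet> x) * g \<xi> - cis (\<xi> \<bullet> x) * (\<i> * of_real (\<xi> \<bullet> h) * g \<xi>))"
      by (simp add: fun_eq_iff inner_add_right cis_mult[symmetric] algebra_simps)
    then have eq: "integral\<^sup>L lborel ?R / (2 * pi) ^ DIM('a) =
      inv_fourier g (x + h) - inv_fourier g x - inv_fourier (\<lambda>\<xi>. \<i> * of_real (\<xi> \<bullet> h) * g \<xi>) x"
      using i by (simp add: inv_fourier_def diff_divide_distrib)
    have "\<bar>synth g (x + h) - synth g x - ?D h\<bar> \<le> norm (integral\<^sup>L lborel ?R / (2 * pi) ^ DIM('a))"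
      unfolding synth_def minus_complex.simps(1)[symmetric] eq by (rule abs_Re_le_cmod)
    also have "\<dots> = norm (integral\<^sup>L lborel ?R) / (2 * pi) ^ DIM('a)"
      by (simp add: norm_divide norm_mult norm_power)
    also have "\<dots> \<le> norm (integral\<^sup>L lborel ?R)"
    proof -
      have "1 \<le> (2 * pi) ^ DIM('a)" using pi_gt3 by (intro one_le_power) simp
      then show ?thesis using divide_left_mono[of 1 "(2 * pi) ^ DIM('a)" "norm (integral\<^sup>L lborel ?R)"] by simp
    qed
    also have "\<dots> \<le> (LINT \<xi>|lborel. (norm h)\<^sup>2 * ((1 + norm \<xi>) ^ 2 * norm (g \<xi>)))"
    proof (rule Bochner_Integration.integral_norm_bound_integral)
      have b: "norm (?R \<xi>) \<le> (norm h)\<^sup>2 * ((1 + norm \<xi>) ^ 2 * norm (g \<xi>))" for \<xi>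
      proof -
        have "norm (?R \<xi>) \<le> (\<xi> \<bullet> h)\<^sup>2 / 2 * norm (g \<xi>)"
          unfolding norm_mult norm_cis mult_1 by (intro mult_right_mono norm_cis_minus_linear norm_ge_zero)
        also have "(\<xi> \<bullet> h)\<^sup>2 / 2 \<le> (norm h)\<^sup>2 * (1 + norm \<xi>) ^ 2"
        proof -
          have "(\<xi> \<bullet> h)\<^sup>2 / 2 \<le> \<bar>\<xi> \<bullet> h\<bar>\<^sup>2" by simp
          also have "\<dots> \<le> (norm \<xi> * norm h)\<^sup>2" by (intro power_mono Cauchy_Schwarz_ineq2) simp
          also have "\<dots> = (norm h)\<^sup>2 * (norm \<xi>)\<^sup>2" by (simp add: power_mult_distrib)
          also have "\<dots> \<le> (norm h)\<^sup>2 * (1 + norm \<xi>)\<^sup>2" by (intro mult_left_mono power_mono) auto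
          finally show ?thesis .
        qed
        finally show ?thesis by (simp add: mult_right_mono mult.assoc)
      qed
      show w: "integrable lborel (\<lambda>\<xi>. (norm h)\<^sup>2 * ((1 + norm \<xi>) ^ 2 * norm (g \<xi>)))"
        using rapid_integrable_weight[OF g] by (rule integrable_mult_right)
      show "integrable lborel ?R"
        by (rule Bochner_Integration.integrable_bound[OF w]) (use b in \<open>auto intro!: AE_I2\<close>)
      show "norm (?R \<xi>) \<le> (norm h)\<^sup>2 * ((1 + norm \<xi>) ^ 2 * norm (g \<xi>))" for \<xi> by (rule b)
    qed
    also have "\<dots> = K * (norm h)\<^sup>2" by (simp add: K_def)
    finally show ?thesis .
  qed
  show ?thesis
    unfolding has_derivative_at
  proof (intro conjI)
    show "bounded_linear ?D" using lin by (rule linear_conv_bounded_linear[THEN iffD1])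
    have K0: "K \<ge> 0" unfolding K_def by simp
    show "(\<lambda>h. norm (synth g (x + h) - synth g x - ?D h) / norm h) \<midarrow>0\<rightarrow> 0"
    proof (rule Lim_null_comparison)
      show "\<forall>\<^sub>F h in at 0. norm (norm (synth g (x + h) - synth g x - ?D h) / norm h) \<le> K * norm h"
        using bound by (auto simp: eventually_at_filter divide_le_eq power2_eq_square mult_ac intro!: always_eventually)
      show "((\<lambda>h. K * norm h) \<longlongrightarrow> 0) (at 0)" by (auto intro!: tendsto_eq_intros)
    qed
  qed
qed

text \<open>The power of 2 pi is that of the inverse transform; with it \<open>synth\<close> turns
  \<open>conv\<close> into the pointwise product without further constants.\<close>

definition conv :: "('a::euclidean_space \<Rightarrow> complex) \<Rightarrow> ('a \<Rightarrow> complex) \<Rightarrow> 'a \<Rightarrow> complex" where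
  "conv g1 g2 \<xi> = (LINT \<eta>|lborel. g1 (\<xi> - \<eta>) * g2 \<eta>) / (2 * pi) ^ DIM('a)"

lemma integrable_conv_pair:
  fixes g1 g2 :: "'a::euclidean_space \<Rightarrow> complex"
  assumes g1: "integrable lborel g1" and g2: "integrable lborel g2"
  shows "integrable (lborel \<Otimes>\<^sub>M lborel) (\<lambda>(\<xi>, \<eta>). g1 (\<xi> - \<eta>) * g2 \<eta>)"
proof -
  have [measurable]: "g1 \<in> borel_measurable borel" "g2 \<in> borel_measurable borel" using g1 g2 by auto
  have s: "integrable lborel (\<lambda>\<xi>. g1 (\<xi> - \<eta>))" "(LINT \<xi>|lborel. norm (g1 (\<xi> - \<eta>))) = (LINT \<xi>|lborel. norm (g1 \<xi>))" for \<eta>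
    using integrable_lborel_shift[OF g1, of "- \<eta>"] integral_lborel_shift[of "\<lambda>\<xi>. norm (g1 \<xi>)" "- \<eta>"] g1 by auto
  have "integrable (lborel \<Otimes>\<^sub>M lborel) (\<lambda>(\<eta>, \<xi>). g1 (\<xi> - \<eta>) * g2 \<eta>)"
  proof (rule lborel_pair.Fubini_integrable)
    show "(\<lambda>(\<eta>, \<xi>). g1 (\<xi> - \<eta>) * g2 \<eta>) \<in> borel_measurable (lborel \<Otimes>\<^sub>M lborel)" by measurable
    show "integrable lborel (\<lambda>\<eta>. LINT \<xi>|lborel. norm (case (\<eta>, \<xi>) of (\<eta>, \<xi>) \<Rightarrow> g1 (\<xi> - \<eta>) * g2 \<eta>))"
      using g2 by (simp add: norm_mult s)
    show "AE \<eta> in lborel. integrable lborel (\<lambda>\<xi>. case (\<eta>, \<xi>) of (\<eta>, \<xi>) \<Rightarrow> g1 (\<xi> - \<eta>) * g2 \<eta>)"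
      using s by simp
  qed
  from lborel_pair.integrable_product_swap[OF this] show ?thesis by (simp add: case_prod_beta)
qed

lemma rapid_conv:
  fixes g1 g2 :: "'a::euclidean_space \<Rightarrow> complex"
  assumes g1: "rapid g1" and g2: "rapid g2"
  shows "rapid (conv g1 g2)"
proof (rule rapidI)
  have [measurable]: "g1 \<in> borel_measurable borel" "g2 \<in> borel_measurable borel"
    using rapid_measurable g1 g2 by auto
  obtain C1 where C1: "C1 \<ge> 0" "\<And>\<xi>. norm (g1 \<xi>) \<le> C1" using rapid_bounded[OF g1] by metis
  have i: "integrable lborel (\<lambda>\<eta>. g1 (\<xi> - \<eta>) * g2 \<eta>)" for \<xi>
  proof (rule Bochner_Integration.integrable_bound)
    show "integrable lborel (\<lambda>\<eta>. C1 * norm (g2 \<eta>))" using rapid_integrable[OF g2] by simp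
    show "AE \<eta> in lborel. norm (g1 (\<xi> - \<eta>) * g2 \<eta>) \<le> norm (C1 * norm (g2 \<eta>))"
      using C1 by (intro AE_I2) (auto simp: norm_mult intro!: mult_right_mono)
  qed measurable
  have "continuous_on UNIV (\<lambda>\<xi>. LINT \<eta>|lborel. g1 (\<xi> - \<eta>) * g2 \<eta>)"
  proof (rule continuous_on_lebesgue_integral)
    show "continuous_on UNIV (\<lambda>\<xi>. g1 (\<xi> - \<eta>) * g2 \<eta>)" for \<eta>
      by (intro continuous_intros continuous_on_compose2[OF rapid_continuous[OF g1]]) auto
    show "integrable lborel (\<lambda>\<eta>. C1 * norm (g2 \<eta>))" using rapid_integrable[OF g2] by simp
    show "norm (g1 (\<xi> - \<eta>) * g2 \<eta>) \<le> C1 * norm (g2 \<eta>)" for \<xi> \<eta>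
      using C1 by (simp add: norm_mult mult_right_mono)
  qed measurable
  then show "continuous_on UNIV (conv g1 g2)"
    unfolding conv_def[abs_def] by (intro continuous_intros) auto
  show "conv g1 g2 (- \<xi>) = cnj (conv g1 g2 \<xi>)" for \<xi>
  proof -
    have "(LINT \<eta>|lborel. g1 (- \<xi> - \<eta>) * g2 \<eta>) = (LINT \<eta>|lborel. g1 (- \<xi> - - \<eta>) * g2 (- \<eta>))"
      by (rule integral_lborel_uminus[OF i, symmetric])
    also have "\<dots> = (LINT \<eta>|lborel. cnj (g1 (\<xi> - \<eta>) * g2 \<eta>))"
      using rapid_uminus_arg[OF g1, of "\<xi> - _"] rapid_uminus_arg[OF g2] by simp
    also have "\<dots> = cnj (LINT \<eta>|lborel. g1 (\<xi> - \<eta>) * g2 \<eta>)"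
      by (rule Bochner_Integration.integral_cnj)
    finally show ?thesis by (simp add: conv_def)
  qed
  fix N
  obtain D where D: "D \<ge> 0" "\<And>\<xi>. (1 + norm \<xi>) ^ N * norm (g1 \<xi>) \<le> D" using rapid_decay[OF g1] by metis
  let ?I = "LINT \<eta>|lborel. (1 + norm \<eta>) ^ N * norm (g2 \<eta>)"
  show "\<exists>C. \<forall>\<xi>. (1 + norm \<xi>) ^ N * norm (conv g1 g2 \<xi>) \<le> C"
  proof (intro exI allI)
    fix \<xi> :: 'a
    have "(1 + norm \<xi>) ^ N * norm (LINT \<eta>|lborel. g1 (\<xi> - \<eta>) * g2 \<eta>)
      = norm (LINT \<eta>|lborel. of_real ((1 + norm \<xi>) ^ N) * (g1 (\<xi> - \<eta>) * g2 \<eta>))"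
      by (simp only: integral_mult_right_zero norm_mult norm_of_real) simp
    also have "\<dots> \<le> (LINT \<eta>|lborel. D * ((1 + norm \<eta>) ^ N * norm (g2 \<eta>)))"
    proof (rule Bochner_Integration.integral_norm_bound_integral)
      show "integrable lborel (\<lambda>\<eta>. D * ((1 + norm \<eta>) ^ N * norm (g2 \<eta>)))"
        using rapid_integrable_weight[OF g2] by (rule integrable_mult_right)
      show "integrable lborel (\<lambda>\<eta>. of_real ((1 + norm \<xi>) ^ N) * (g1 (\<xi> - \<eta>) * g2 \<eta>))"
        using i by (rule integrable_mult_right)
      fix \<eta>
      \<comment> \<open>The polynomial weight is submultiplicative, so it can be distributed over
        the two factors of the convolution: a uniform bound is used for \<open>g1\<close>, an
        integral for \<open>g2\<close>.\<close>
      have "1 + norm \<xi> \<le> (1 + norm (\<xi> - \<eta>)) * (1 + norm \<eta>)"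
        using norm_triangle_ineq[of "\<xi> - \<eta>" \<eta>] mult_nonneg_nonneg[OF norm_ge_zero norm_ge_zero, of "\<xi> - \<eta>" \<eta>]
        by (simp add: distrib_left distrib_right del: mult_nonneg_nonneg zero_le_mult_iff)
      then have "(1 + norm \<xi>) ^ N \<le> ((1 + norm (\<xi> - \<eta>)) * (1 + norm \<eta>)) ^ N"
        by (intro power_mono) auto
      then have "(1 + norm \<xi>) ^ N * (norm (g1 (\<xi> - \<eta>)) * norm (g2 \<eta>))
        \<le> ((1 + norm (\<xi> - \<eta>)) * (1 + norm \<eta>)) ^ N * (norm (g1 (\<xi> - \<eta>)) * norm (g2 \<eta>))"
        by (intro mult_right_mono) auto
      also have "\<dots> = ((1 + norm (\<xi> - \<eta>)) ^ N * norm (g1 (\<xi> - \<eta>))) * ((1 + norm \<eta>) ^ N * norm (g2 \<eta>))"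
        by (simp add: power_mult_distrib)
      also have "\<dots> \<le> D * ((1 + norm \<eta>) ^ N * norm (g2 \<eta>))"
        using D by (intro mult_right_mono) auto
      finally show "norm (of_real ((1 + norm \<xi>) ^ N) * (g1 (\<xi> - \<eta>) * g2 \<eta>)) \<le> D * ((1 + norm \<eta>) ^ N * norm (g2 \<eta>))"
        by (simp add: norm_mult del: of_real_power)
    qed
    also have "\<dots> = D * ?I" by simp
    finally have "(1 + norm \<xi>) ^ N * norm (LINT \<eta>|lborel. g1 (\<xi> - \<eta>) * g2 \<eta>) \<le> D * ?I" .
    then show "(1 + norm \<xi>) ^ N * norm (conv g1 g2 \<xi>) \<le> D * ?I / (2 * pi) ^ DIM('a)"
      by (simp add: conv_def norm_divide norm_mult norm_power divide_right_mono)
  qed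
qed

theorem synth_conv:
  fixes g1 g2 :: "'a::euclidean_space \<Rightarrow> complex"
  assumes g1: "rapid g1" and g2: "rapid g2"
  shows "synth (conv g1 g2) x = synth g1 x * synth g2 x"
proof -
  let ?c = "complex_of_real ((2 * pi) ^ DIM('a))"
  have [measurable]: "g1 \<in> borel_measurable borel" "g2 \<in> borel_measurable borel"
    using rapid_measurable g1 g2 by auto
  let ?h = "\<lambda>g \<xi>. cis (\<xi> \<bullet> x) * g \<xi>"
  have h: "integrable lborel (?h g1)" "integrable lborel (?h g2)"
    by (intro integrable_cis_mult rapid_integrable g1 g2)+
  note i = integrable_conv_pair[OF h]
  have e: "?h g1 (\<xi> - \<eta>) * ?h g2 \<eta> = cis (\<xi> \<bullet> x) * (g1 (\<xi> - \<eta>) * g2 \<eta>)" for \<xi> \<eta>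
  proof -
    have "cis ((\<xi> - \<eta>) \<bullet> x) * cis (\<eta> \<bullet> x) = cis (\<xi> \<bullet> x)" by (simp add: cis_mult inner_diff_left)
    then show ?thesis by (metis (no_types) mult.assoc mult.commute)
  qed
  have "inv_fourier (conv g1 g2) x = (LINT \<xi>|lborel. (LINT \<eta>|lborel. cis (\<xi> \<bullet> x) * (g1 (\<xi> - \<eta>) * g2 \<eta>))) / ?c / ?c"
    unfolding inv_fourier_def conv_def by (simp add: integral_mult_right_zero)
  also have "(LINT \<xi>|lborel. (LINT \<eta>|lborel. cis (\<xi> \<bullet> x) * (g1 (\<xi> - \<eta>) * g2 \<eta>)))
     = (LINT \<eta>|lborel. (LINT \<xi>|lborel. ?h g1 (\<xi> - \<eta>) * ?h g2 \<eta>))"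
    unfolding e[symmetric] by (rule lborel_pair.Fubini_integral[symmetric]) (rule i)
  also have "\<dots> = integral\<^sup>L lborel (?h g1) * integral\<^sup>L lborel (?h g2)"
  proof -
    have "(LINT \<xi>|lborel. ?h g1 (\<xi> - \<eta>)) = integral\<^sup>L lborel (?h g1)" for \<eta>
      using integral_lborel_shift[OF h(1), of "- \<eta>"] by simp
    then show ?thesis by (simp only: integral_mult_left_zero integral_mult_right_zero)
  qed
  finally have "inv_fourier (conv g1 g2) x = inv_fourier g1 x * inv_fourier g2 x"
    by (simp add: inv_fourier_def)
  then have "complex_of_real (synth (conv g1 g2) x) = complex_of_real (synth g1 x * synth g2 x)"
    using g1 g2 rapid_conv[OF g1 g2] by (simp add: of_real_synth)
  then show ?thesis using of_real_eq_iff by blast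
qed

section \<open>Multilinear forms on the frequency side\<close>

lemma has_bochner_integral_mult_exp:
  fixes s :: real
  assumes "s > 0"
  shows "has_bochner_integral lborel (\<lambda>z. indicator {0..} z * (z * exp (- (s * z)))) (1 / s\<^sup>2)"
proof -
  have "has_bochner_integral lborel (\<lambda>x::real. indicator {0..} x * (x ^ 1 * exp (- x))) (real (fact 1))"
  proof (rule has_bochner_integral_nn_integral)
    have "(\<integral>\<^sup>+x. ennreal (indicator {0..} x * (x ^ 1 * exp (- x))) \<partial>lborel)
      = (\<integral>\<^sup>+x. ennreal (x ^ 1 * exp (- x)) * indicator {0 ..} x \<partial>lborel)"
      by (intro nn_integral_cong) (simp split: split_indicator)
    then show "(\<integral>\<^sup>+x. ennreal (indicator {0..} x * (x ^ 1 * exp (- x))) \<partial>lborel) = ennreal (real (fact 1))"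
      using nn_intergal_power_times_exp_Ici[of 1] by simp
  qed (auto split: split_indicator)
  then have "has_bochner_integral lborel (\<lambda>x::real. indicator {0..} (0 + s * x) * ((0 + s * x) ^ 1 * exp (- (0 + s * x))))
     (real (fact 1) /\<^sub>R \<bar>s\<bar>)"
    using assms by (subst lborel_has_bochner_integral_real_affine_iff[symmetric]) auto
  from has_bochner_integral_mult_right[OF this, of "1 / s"]
  show ?thesis
    using assms
    by (elim has_bochner_integral_cong[THEN iffD1, rotated -1])
       (auto simp: indicator_def zero_le_mult_iff power2_eq_square field_simps)
qed

text \<open>The hypothesis that \<open>F\<close> vanishes where \<open>S\<close> does covers the junk value \<open>F / 0 = 0\<close>.\<close>

lemma laplace_weight:
  fixes S :: "'w \<Rightarrow> real" and F :: "'w \<Rightarrow> complex"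
  assumes "sigma_finite_measure M" and [measurable]: "S \<in> borel_measurable M" "F \<in> borel_measurable M"
    and S: "\<And>\<omega>. S \<omega> \<ge> 0" "\<And>\<omega>. S \<omega> = 0 \<Longrightarrow> F \<omega> = 0"
    and i: "integrable M (\<lambda>\<omega>. F \<omega> / of_real ((S \<omega>)\<^sup>2))"
  shows set_integrable_laplace_weight:
      "set_integrable lborel {0..} (\<lambda>z. of_real z * (LINT \<omega>|M. of_real (exp (- (z * S \<omega>))) * F \<omega>))"
    and set_integral_laplace_weight:
      "(LINT z:{0..}|lborel. of_real z * (LINT \<omega>|M. of_real (exp (- (z * S \<omega>))) * F \<omega>))
        = (LINT \<omega>|M. F \<omega> / of_real ((S \<omega>)\<^sup>2))"
proof -
  interpret sigma_finite_measure M by fact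
  interpret P: pair_sigma_finite M "lborel :: real measure" ..
  let ?k = "\<lambda>\<omega> z. indicator {0..} z * (z * exp (- (S \<omega> * z)))"
  let ?G = "\<lambda>(\<omega>, z). of_real (?k \<omega> z) * F \<omega>"
  have k: "integrable lborel (\<lambda>z. ?k \<omega> z)" "(LINT z|lborel. ?k \<omega> z) = 1 / (S \<omega>)\<^sup>2" if "F \<omega> \<noteq> 0" for \<omega>
  proof -
    have "S \<omega> > 0" using S[of \<omega>] that by (cases "S \<omega> = 0") auto
    from has_bochner_integral_mult_exp[OF this]
    show "integrable lborel (\<lambda>z. ?k \<omega> z)" "(LINT z|lborel. ?k \<omega> z) = 1 / (S \<omega>)\<^sup>2"
      by (auto simp: has_bochner_integral_iff)
  qed
  have k0: "?k \<omega> z \<ge> 0" for \<omega> z by (simp add: indicator_def)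
  have inner: "integrable lborel (\<lambda>z. of_real (?k \<omega> z) * F \<omega>)" for \<omega>
  proof (cases "F \<omega> = 0")
    case False
    then show ?thesis using k[of \<omega>] by (intro integrable_mult_left integrable_of_real)
  qed simp
  have inner_norm: "(LINT z|lborel. norm (of_real (?k \<omega> z) * F \<omega>)) = norm (F \<omega> / of_real ((S \<omega>)\<^sup>2))" for \<omega>
  proof (cases "F \<omega> = 0")
    case False
    have "(LINT z|lborel. norm (of_real (?k \<omega> z) * F \<omega>)) = (LINT z|lborel. ?k \<omega> z * norm (F \<omega>))"
      by (intro Bochner_Integration.integral_cong refl) (simp only: norm_mult norm_of_real abs_of_nonneg[OF k0])
    also have "\<dots> = 1 / (S \<omega>)\<^sup>2 * norm (F \<omega>)"
      unfolding integral_mult_left_zero k(2)[OF False] ..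
    finally show ?thesis by (simp add: norm_divide norm_power)
  qed simp
  have inner_eq: "(LINT z|lborel. of_real (?k \<omega> z) * F \<omega>) = F \<omega> / of_real ((S \<omega>)\<^sup>2)" for \<omega>
  proof (cases "F \<omega> = 0")
    case False
    have "(LINT z|lborel. of_real (?k \<omega> z) * F \<omega>) = of_real (1 / (S \<omega>)\<^sup>2) * F \<omega>"
      unfolding integral_mult_left_zero integral_complex_of_real k(2)[OF False] ..
    then show ?thesis by simp
  qed simp
  have G: "integrable (M \<Otimes>\<^sub>M lborel) ?G"
  proof (rule P.Fubini_integrable)
    show "?G \<in> borel_measurable (M \<Otimes>\<^sub>M lborel)" by measurable
    show "integrable M (\<lambda>\<omega>. LINT z|lborel. norm (?G (\<omega>, z)))"
      unfolding prod.case inner_norm using i by (rule integrable_norm)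
    show "AE \<omega> in M. integrable lborel (\<lambda>z. ?G (\<omega>, z))"
      unfolding prod.case using inner by simp
  qed
  have e: "(LINT \<omega>|M. of_real (?k \<omega> z) * F \<omega>) =
    indicator {0..} z *\<^sub>R (of_real z * (LINT \<omega>|M. of_real (exp (- (z * S \<omega>))) * F \<omega>))" for z
  proof -
    have "(LINT \<omega>|M. of_real (?k \<omega> z) * F \<omega>) =
      (LINT \<omega>|M. of_real (indicator {0..} z) * (of_real z * (of_real (exp (- (z * S \<omega>))) * F \<omega>)))"
      by (intro Bochner_Integration.integral_cong refl) (simp only: of_real_mult mult_ac)
    then show ?thesis by (simp only: integral_mult_right_zero scaleR_conv_of_real)
  qed
  show "set_integrable lborel {0..} (\<lambda>z. of_real z * (LINT \<omega>|M. of_real (exp (- (z * S \<omega>))) * F \<omega>))"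
    unfolding set_integrable_def e[symmetric] using P.integrable_snd[OF G] by simp
  show "(LINT z:{0..}|lborel. of_real z * (LINT \<omega>|M. of_real (exp (- (z * S \<omega>))) * F \<omega>))
        = (LINT \<omega>|M. F \<omega> / of_real ((S \<omega>)\<^sup>2))"
    unfolding set_lebesgue_integral_def e[symmetric] P.Fubini_integral[OF G] inner_eq ..
qed

text \<open>Here \<open>q z\<close> is the value of a form on Poisson extensions at height
  \<open>z\<close>, \<open>S\<close> the sum of the frequency lengths and \<open>c\<close> a power
  of 2 pi. Integration against \<open>z\<close> then acts on the frequency side as division by
  \<open>S\<^sup>2\<close>.\<close>

lemma real_laplace_weight:
  fixes S :: "'w \<Rightarrow> real" and F :: "'w \<Rightarrow> complex" and q :: "real \<Rightarrow> real"
  assumes "sigma_finite_measure M" "S \<in> borel_measurable M" "F \<in> borel_measurable M"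
    and "\<And>\<omega>. S \<omega> \<ge> 0" "\<And>\<omega>. S \<omega> = 0 \<Longrightarrow> F \<omega> = 0"
    and "integrable M (\<lambda>\<omega>. F \<omega> / of_real ((S \<omega>)\<^sup>2))"
    and q: "\<And>z. z \<ge> 0 \<Longrightarrow> of_real (q z) = (LINT \<omega>|M. of_real (exp (- (z * S \<omega>))) * F \<omega>) / c"
  shows set_integrable_real_laplace_weight: "set_integrable lborel {0..} (\<lambda>z. z * q z)"
    and set_integral_real_laplace_weight:
      "of_real (LINT z:{0..}|lborel. z * q z) = (LINT \<omega>|M. F \<omega> / of_real ((S \<omega>)\<^sup>2)) / c"
proof -
  let ?L = "\<lambda>z. of_real z * (LINT \<omega>|M. of_real (exp (- (z * S \<omega>))) * F \<omega>)"
  note L = laplace_weight[OF assms(1-6)]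
  have e: "indicator {0..} z *\<^sub>R (?L z / c) = complex_of_real (indicator {0..} z *\<^sub>R (z * q z))" for z
    using q[of z] by (simp add: indicator_def)
  have "set_integrable lborel {0..} (\<lambda>z. ?L z / c)"
    using L(1) by (rule set_integrable_divide)
  then show "set_integrable lborel {0..} (\<lambda>z. z * q z)"
    unfolding set_integrable_def e using complex_of_real_integrable_eq by blast
  have "of_real (LINT z:{0..}|lborel. z * q z) = (LINT z:{0..}|lborel. ?L z / c)"
    unfolding set_lebesgue_integral_def e by (rule integral_complex_of_real[symmetric])
  also have "\<dots> = (LINT z:{0..}|lborel. ?L z) / c"
    by (simp add: set_lebesgue_integral_def)
  also have "(LINT z:{0..}|lborel. ?L z) = (LINT \<omega>|M. F \<omega> / of_real ((S \<omega>)\<^sup>2))"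
    by (rule L(2))
  finally show "of_real (LINT z:{0..}|lborel. z * q z) = (LINT \<omega>|M. F \<omega> / of_real ((S \<omega>)\<^sup>2)) / c" .
qed

lemma integrable_bounded_mult:
  fixes f g :: "'w \<Rightarrow> complex"
  assumes "integrable M f" and [measurable]: "g \<in> borel_measurable M" and g: "\<And>x. norm (g x) \<le> C"
  shows "integrable M (\<lambda>x. f x * g x)"
proof (rule Bochner_Integration.integrable_bound)
  have [measurable]: "f \<in> borel_measurable M" using assms by auto
  show "(\<lambda>x. f x * g x) \<in> borel_measurable M" by measurable
  show "integrable M (\<lambda>x. C * norm (f x))" using assms(1) by simp
  have "0 \<le> C" using g norm_ge_zero order_trans by blast
  then show "AE x in M. norm (f x * g x) \<le> norm (C * norm (f x))"
    using g by (intro AE_I2) (simp add: norm_mult mult.commute[of "norm (f _)"] mult_right_mono)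
qed

section \<open>Trilinear and quadrilinear forms as frequency integrals\<close>

definition tri_form :: "('a::euclidean_space \<Rightarrow> complex) \<Rightarrow> ('a \<Rightarrow> complex) \<Rightarrow> ('a \<Rightarrow> complex) \<Rightarrow> real" where
  "tri_form a b c = (LINT x|lborel. synth a x * synth b x * synth c x)"

definition quad_form :: "('a::euclidean_space \<Rightarrow> complex) \<Rightarrow> ('a \<Rightarrow> complex) \<Rightarrow> ('a \<Rightarrow> complex) \<Rightarrow> ('a \<Rightarrow> complex) \<Rightarrow> real" where
  "quad_form a b c d = (LINT x|lborel. synth a x * synth b x * synth c x * synth d x)"

lemma integrable_synth3:
  assumes "rapid a" "rapid b" "rapid c"
  shows "integrable lborel (\<lambda>x. synth a x * synth b x * synth c x)"
  using integrable_synth_mult[OF rapid_conv[OF assms(1,2)] assms(3)] assms by (simp add: synth_conv)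

lemma integrable_synth4:
  assumes "rapid a" "rapid b" "rapid c" "rapid d"
  shows "integrable lborel (\<lambda>x. synth a x * synth b x * synth c x * synth d x)"
  using integrable_synth_mult[OF rapid_conv[OF assms(1,2)] rapid_conv[OF assms(3,4)]] assms
  by (simp add: synth_conv mult.assoc)

text \<open>Two of the factors are merged into a convolution, which Plancherel pairs with the third.
  As \<open>cnj (c \<xi>)\<close> is \<open>c (- \<xi>)\<close>, the three frequencies sum to
  zero.\<close>

lemma tri_frequency:
  fixes a b c :: "'a::euclidean_space \<Rightarrow> complex"
  assumes a: "rapid a" and b: "rapid b" and c: "rapid c"
  shows integrable_tri_frequency: "integrable (lborel \<Otimes>\<^sub>M lborel) (\<lambda>(\<xi>, \<eta>). a (\<xi> - \<eta>) * b \<eta> * cnj (c \<xi>))"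
    and tri_eq_frequency: "of_real (tri_form a b c)
      = (LINT (\<xi>, \<eta>)|(lborel \<Otimes>\<^sub>M lborel). a (\<xi> - \<eta>) * b \<eta> * cnj (c \<xi>)) / ((2 * pi) ^ DIM('a))\<^sup>2"
proof -
  have [measurable]: "a \<in> borel_measurable borel" "b \<in> borel_measurable borel" "c \<in> borel_measurable borel"
    using rapid_measurable a b c by auto
  obtain C where C: "\<And>\<xi>. norm (c \<xi>) \<le> C" using rapid_bounded[OF c] by metis
  have "integrable (lborel \<Otimes>\<^sub>M lborel) (\<lambda>p. (\<lambda>(\<xi>, \<eta>). a (\<xi> - \<eta>) * b \<eta>) p * cnj (c (fst p)))"
    by (rule integrable_bounded_mult[OF integrable_conv_pair[OF rapid_integrable[OF a] rapid_integrable[OF b]], where C=C])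
       (auto simp: C)
  then show i: "integrable (lborel \<Otimes>\<^sub>M lborel) (\<lambda>(\<xi>, \<eta>). a (\<xi> - \<eta>) * b \<eta> * cnj (c \<xi>))"
    by (simp add: case_prod_unfold)
  have "of_real (tri_form a b c) = complex_of_real (LINT x|lborel. synth (conv a b) x * synth c x)"
    by (simp add: tri_form_def synth_conv[OF a b])
  also have "\<dots> = (LINT \<xi>|lborel. conv a b \<xi> * cnj (c \<xi>)) / (2 * pi) ^ DIM('a)"
    by (rule integral_synth_mult[OF rapid_conv[OF a b] c])
  also have "\<dots> = (LINT \<xi>|lborel. (LINT \<eta>|lborel. a (\<xi> - \<eta>) * b \<eta> * cnj (c \<xi>))) / ((2 * pi) ^ DIM('a))\<^sup>2"
    by (simp add: conv_def power2_eq_square)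
  also have "(LINT \<xi>|lborel. (LINT \<eta>|lborel. a (\<xi> - \<eta>) * b \<eta> * cnj (c \<xi>)))
     = (LINT (\<xi>, \<eta>)|(lborel \<Otimes>\<^sub>M lborel). a (\<xi> - \<eta>) * b \<eta> * cnj (c \<xi>))"
    using lborel_pair.integral_fst[OF i] .
  finally show "of_real (tri_form a b c)
      = (LINT (\<xi>, \<eta>)|(lborel \<Otimes>\<^sub>M lborel). a (\<xi> - \<eta>) * b \<eta> * cnj (c \<xi>)) / ((2 * pi) ^ DIM('a))\<^sup>2" .
qed

text \<open>The four factors are grouped into two convolutions that Plancherel pairs; three powers
  of 2 pi arise, one from the pairing and one from each convolution.\<close>

lemma quad_frequency:
  fixes a b c d :: "'a::euclidean_space \<Rightarrow> complex"
  assumes a: "rapid a" and b: "rapid b" and c: "rapid c" and d: "rapid d"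
  shows integrable_quad_frequency: "integrable ((lborel \<Otimes>\<^sub>M lborel) \<Otimes>\<^sub>M lborel)
        (\<lambda>((\<xi>, \<eta>), \<zeta>). a (\<xi> - \<eta>) * b \<eta> * (cnj (c (\<xi> - \<zeta>)) * cnj (d \<zeta>)))"
    and quad_eq_frequency: "of_real (quad_form a b c d)
      = (LINT ((\<xi>, \<eta>), \<zeta>)|((lborel \<Otimes>\<^sub>M lborel) \<Otimes>\<^sub>M lborel). a (\<xi> - \<eta>) * b \<eta> * (cnj (c (\<xi> - \<zeta>)) * cnj (d \<zeta>)))
         / ((2 * pi) ^ DIM('a)) ^ 3"
proof -
  have [measurable]: "a \<in> borel_measurable borel" "b \<in> borel_measurable borel" "c \<in> borel_measurable borel"
     "d \<in> borel_measurable borel"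
    using rapid_measurable a b c d by auto
  interpret P2: sigma_finite_measure "lborel \<Otimes>\<^sub>M lborel :: ('a \<times> 'a) measure"
    by (rule lborel_pair.P.sigma_finite_measure_axioms lborel_pair.sigma_finite_measure_axioms)
  interpret P3: pair_sigma_finite "lborel \<Otimes>\<^sub>M lborel :: ('a \<times> 'a) measure" "lborel :: 'a measure" ..
  obtain C where C: "C \<ge> 0" "\<And>\<xi>. norm (c \<xi>) \<le> C" using rapid_bounded[OF c] by metis
  let ?c = "complex_of_real ((2 * pi) ^ DIM('a))"
  note iab = integrable_conv_pair[OF rapid_integrable[OF a] rapid_integrable[OF b]]
  let ?G = "\<lambda>(p, \<zeta>). (case p of (\<xi>, \<eta>) \<Rightarrow> a (\<xi> - \<eta>) * b \<eta> * (cnj (c (\<xi> - \<zeta>)) * cnj (d \<zeta>)))"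
  have id: "integrable lborel (\<lambda>\<zeta>. cnj (d \<zeta>) * cnj (c (\<xi> - \<zeta>)))" for \<xi>
    using rapid_integrable[OF d] by (intro integrable_bounded_mult[where C=C]) (auto simp: C)
  have i3: "integrable ((lborel \<Otimes>\<^sub>M lborel) \<Otimes>\<^sub>M lborel) ?G"
  proof (rule P3.Fubini_integrable)
    show m: "?G \<in> borel_measurable ((lborel \<Otimes>\<^sub>M lborel) \<Otimes>\<^sub>M lborel)" by measurable
    show "AE p in lborel \<Otimes>\<^sub>M lborel. integrable lborel (\<lambda>\<zeta>. ?G (p, \<zeta>))"
      using id by (auto simp: mult.commute[of "cnj (c _)"])
    show "integrable (lborel \<Otimes>\<^sub>M lborel) (\<lambda>p. LINT \<zeta>|lborel. norm (?G (p, \<zeta>)))"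
    proof (rule Bochner_Integration.integrable_bound)
      let ?D = "LINT \<zeta>|lborel. C * norm (d \<zeta>)"
      show "integrable (lborel \<Otimes>\<^sub>M lborel) (\<lambda>p. norm (case p of (\<xi>, \<eta>) \<Rightarrow> a (\<xi> - \<eta>) * b \<eta>) * ?D)"
        using iab by (intro integrable_mult_left integrable_norm)
      show "AE p in lborel \<Otimes>\<^sub>M lborel. norm (LINT \<zeta>|lborel. norm (?G (p, \<zeta>)))
         \<le> norm (norm (case p of (\<xi>, \<eta>) \<Rightarrow> a (\<xi> - \<eta>) * b \<eta>) * ?D)"
      proof (intro AE_I2)
        fix p :: "'a \<times> 'a"
        obtain \<xi> \<eta> where p: "p = (\<xi>, \<eta>)" by force
        have "(LINT \<zeta>|lborel. norm (cnj (d \<zeta>) * cnj (c (\<xi> - \<zeta>)))) \<le> ?D"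
          using id[of \<xi>, THEN integrable_norm] rapid_integrable[OF d]
          by (intro integral_mono) (auto simp: norm_mult mult.commute[of "norm (d _)"] C intro!: mult_right_mono)
        then have "norm (a (\<xi> - \<eta>) * b \<eta>) * (LINT \<zeta>|lborel. norm (cnj (d \<zeta>) * cnj (c (\<xi> - \<zeta>))))
          \<le> norm (a (\<xi> - \<eta>) * b \<eta>) * ?D" by (intro mult_left_mono) auto
        moreover have "0 \<le> ?D" using C by simp
        ultimately show "norm (LINT \<zeta>|lborel. norm (?G (p, \<zeta>)))
         \<le> norm (norm (case p of (\<xi>, \<eta>) \<Rightarrow> a (\<xi> - \<eta>) * b \<eta>) * ?D)"
          unfolding p prod.case norm_mult[of "a (\<xi> - \<eta>) * b \<eta>"] integral_mult_right_zero
          by (simp add: norm_mult mult.commute[of "norm (c _)"])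
      qed
    qed measurable
  qed
  then show "integrable ((lborel \<Otimes>\<^sub>M lborel) \<Otimes>\<^sub>M lborel)
        (\<lambda>((\<xi>, \<eta>), \<zeta>). a (\<xi> - \<eta>) * b \<eta> * (cnj (c (\<xi> - \<zeta>)) * cnj (d \<zeta>)))"
    by (simp add: case_prod_unfold)
  have i2: "integrable (lborel \<Otimes>\<^sub>M lborel) (\<lambda>(\<xi>, \<eta>). LINT \<zeta>|lborel. a (\<xi> - \<eta>) * b \<eta> * (cnj (c (\<xi> - \<zeta>)) * cnj (d \<zeta>)))"
    using P3.integrable_fst'[OF i3] by (simp add: case_prod_unfold)
  have "of_real (quad_form a b c d) = complex_of_real (LINT x|lborel. synth (conv a b) x * synth (conv c d) x)"
    by (simp add: quad_form_def synth_conv[OF a b] synth_conv[OF c d] mult.assoc)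
  also have "\<dots> = (LINT \<xi>|lborel. conv a b \<xi> * cnj (conv c d \<xi>)) / ?c"
    using integral_synth_mult[OF rapid_conv[OF a b] rapid_conv[OF c d]] by simp
  also have "\<dots> = (LINT \<xi>|lborel. (LINT \<eta>|lborel. (LINT \<zeta>|lborel. a (\<xi> - \<eta>) * b \<eta> * (cnj (c (\<xi> - \<zeta>)) * cnj (d \<zeta>))))) / ?c ^ 3"
  proof -
    have "conv a b \<xi> * cnj (conv c d \<xi>) = (LINT \<eta>|lborel. (LINT \<zeta>|lborel. a (\<xi> - \<eta>) * b \<eta> * (cnj (c (\<xi> - \<zeta>)) * cnj (d \<zeta>)))) / ?c ^ 2" for \<xi>
    proof -
      have "cnj (LINT \<zeta>|lborel. c (\<xi> - \<zeta>) * d \<zeta>) = (LINT \<zeta>|lborel. cnj (c (\<xi> - \<zeta>)) * cnj (d \<zeta>))"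
        by (simp flip: Bochner_Integration.integral_cnj)
      then show ?thesis
        by (simp add: conv_def power2_eq_square)
    qed
    then show ?thesis by (simp add: power2_eq_square power3_eq_cube)
  qed
  also have "(LINT \<xi>|lborel. (LINT \<eta>|lborel. (LINT \<zeta>|lborel. a (\<xi> - \<eta>) * b \<eta> * (cnj (c (\<xi> - \<zeta>)) * cnj (d \<zeta>)))))
     = (LINT p|(lborel \<Otimes>\<^sub>M lborel). (LINT \<zeta>|lborel. ?G (p, \<zeta>)))"
    using lborel_pair.integral_fst[OF i2] by (simp add: case_prod_unfold)
  also have "\<dots> = integral\<^sup>L ((lborel \<Otimes>\<^sub>M lborel) \<Otimes>\<^sub>M lborel) ?G"
    by (rule P3.integral_fst'[OF i3])
  finally show "of_real (quad_form a b c d)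
      = (LINT ((\<xi>, \<eta>), \<zeta>)|((lborel \<Otimes>\<^sub>M lborel) \<Otimes>\<^sub>M lborel). a (\<xi> - \<eta>) * b \<eta> * (cnj (c (\<xi> - \<zeta>)) * cnj (d \<zeta>)))
         / ((2 * pi) ^ DIM('a)) ^ 3"
    by (simp add: case_prod_unfold)
qed

section \<open>Poisson extensions and the gradient of the half space\<close>

definition poisson_ext :: "real \<Rightarrow> ('a::euclidean_space \<Rightarrow> complex) \<Rightarrow> 'a \<Rightarrow> complex" where
  "poisson_ext z g \<xi> = of_real (exp (- (z * norm \<xi>))) * g \<xi>"

text \<open>On Poisson extensions, \<open>Some e\<close> acts as the derivative in direction \<open>e\<close> and \<open>None\<close> as \<open>- \<partial>\<^sub>z\<close>; harmonicity is
  the case \<open>\<alpha> = \<beta>\<close> of \<open>sum_dir_symbol\<close>.\<close>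

fun dir_symbol :: "'a::euclidean_space option \<Rightarrow> 'a \<Rightarrow> complex" where
  "dir_symbol None \<xi> = of_real (norm \<xi>)"
| "dir_symbol (Some e) \<xi> = \<i> * of_real (\<xi> \<bullet> e)"

definition dirs :: "'a::euclidean_space option set" where
  "dirs = insert None (Some ` Basis)"

definition dir_mult :: "'a::euclidean_space option \<Rightarrow> ('a \<Rightarrow> complex) \<Rightarrow> 'a \<Rightarrow> complex" where
  "dir_mult d g \<xi> = dir_symbol d \<xi> * g \<xi>"

lemma finite_dirs [simp]: "finite dirs"
  by (simp add: dirs_def)

lemma card_dirs: "card (dirs :: 'a::euclidean_space option set) = Suc DIM('a)"
  by (subst dirs_def, subst card_insert_disjoint) (auto simp: card_image)

lemma None_in_dirs [simp]: "None \<in> dirs" by (simp add: dirs_def)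

lemma symb_dir_symbol [simp]: "symb (dir_symbol d)"
  by (cases d) (simp_all add: dir_symbol.simps[abs_def] cong: if_cong)

lemma dir_symbol_uminus: "dir_symbol d (- \<xi>) = cnj (dir_symbol d \<xi>)"
  by (cases d) auto

lemma dir_symbol_diff_swap: "cnj (dir_symbol d (\<xi> - \<eta>)) = dir_symbol d (\<eta> - \<xi>)"
  using dir_symbol_uminus[of d "\<xi> - \<eta>"] by simp

lemma norm_dir_symbol_le: "d \<in> dirs \<Longrightarrow> norm (dir_symbol d \<xi>) \<le> norm \<xi>"
  by (auto simp: dirs_def norm_mult Basis_le_norm)

text \<open>The symbol of the inner product of two half space gradients. The minus sign is the
  square of the imaginary unit in the horizontal directions; the vertical direction contributes the
  product of the norms, whichever sign is chosen for the derivative in \<open>z\<close>.\<close>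

lemma sum_dir_symbol: "(\<Sum>d\<in>dirs. dir_symbol d \<alpha> * dir_symbol d \<beta>) = of_real (norm \<alpha> * norm \<beta> - \<alpha> \<bullet> \<beta>)"
proof -
  have "(\<Sum>d\<in>dirs. dir_symbol d \<alpha> * dir_symbol d \<beta>) = dir_symbol None \<alpha> * dir_symbol None \<beta> + (\<Sum>e\<in>Basis. dir_symbol (Some e) \<alpha> * dir_symbol (Some e) \<beta>)"
    unfolding dirs_def by (subst sum.insert) (auto simp: sum.reindex)
  also have "(\<Sum>e\<in>Basis. dir_symbol (Some e) \<alpha> * dir_symbol (Some e) \<beta>) = (\<Sum>e\<in>Basis. of_real (- ((\<alpha> \<bullet> e) * (\<beta> \<bullet> e))))"
    by (intro sum.cong refl) (simp add: complex_eq_iff)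
  also have "\<dots> = of_real (- (\<alpha> \<bullet> \<beta>))"
    by (subst (2) euclidean_inner) (simp add: sum_negf)
  finally show ?thesis by simp
qed

lemma rapid_dir_mult: "rapid g \<Longrightarrow> rapid (dir_mult d g)"
  unfolding dir_mult_def[abs_def] by (rule rapid_symb_mult[OF symb_dir_symbol])

lemma rapid_poisson_ext: "z \<ge> 0 \<Longrightarrow> rapid g \<Longrightarrow> rapid (poisson_ext z g)"
  unfolding poisson_ext_def[abs_def] by (rule rapid_symb_mult[OF symb_poisson])

lemma poisson_ext_0 [simp]: "poisson_ext 0 g = g"
  by (simp add: poisson_ext_def fun_eq_iff)

lemma measurable_dir_symbol [measurable]: "dir_symbol d \<in> borel_measurable borel"
  by (rule symb_measurable) simp

text \<open>The frequencies of the trilinear form are \<open>\<xi> - \<eta>, \<eta>, - \<xi>\<close>, those of the quadrilinear form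
  \<open>\<xi> - \<eta>, \<eta>, \<zeta> - \<xi>, - \<zeta>\<close>.\<close>

definition sum3 :: "'a::euclidean_space \<times> 'a \<Rightarrow> real" where
  "sum3 = (\<lambda>p. norm (fst p - snd p) + norm (snd p) + norm (fst p))"

definition sum4 :: "('a::euclidean_space \<times> 'a) \<times> 'a \<Rightarrow> real" where
  "sum4 = (\<lambda>p. norm (fst (fst p) - snd (fst p)) + norm (snd (fst p)) + norm (fst (fst p) - snd p) + norm (snd p))"

lemma sum3_nonneg: "sum3 \<omega> \<ge> 0" by (auto simp: sum3_def)
lemma sum4_nonneg: "sum4 \<omega> \<ge> 0" by (auto simp: sum4_def)

lemma measurable_sum3 [measurable]: "sum3 \<in> borel_measurable (lborel \<Otimes>\<^sub>M lborel)"
  unfolding sum3_def by measurable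

lemma measurable_sum4 [measurable]: "sum4 \<in> borel_measurable ((lborel \<Otimes>\<^sub>M lborel) \<Otimes>\<^sub>M lborel)"
  unfolding sum4_def by measurable

text \<open>The sum of lengths vanishes only at the origin of the product space; off this null set
  \<open>(sum3 \<omega>)\<^sup>2\<close> may be cancelled against the Laplace weight.\<close>

lemma AE_sum3: "AE \<omega> in lborel \<Otimes>\<^sub>M lborel. sum3 (\<omega> :: 'a::euclidean_space \<times> 'a) \<noteq> 0"
proof -
  have "AE \<omega> in lborel. sum3 (\<omega> :: 'a \<times> 'a) \<noteq> 0"
    using AE_lborel_singleton[of 0]
    by eventually_elim (auto simp: sum3_def zero_prod_def add_nonneg_eq_0_iff)
  then show ?thesis unfolding lborel_prod .
qed

lemma AE_sum4: "AE \<omega> in (lborel \<Otimes>\<^sub>M lborel) \<Otimes>\<^sub>M lborel. sum4 (\<omega> :: ('a::euclidean_space \<times> 'a) \<times> 'a) \<noteq> 0"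
proof -
  have "AE \<omega> in lborel. sum4 (\<omega> :: ('a \<times> 'a) \<times> 'a) \<noteq> 0"
    using AE_lborel_singleton[of 0]
    by eventually_elim (auto simp: sum4_def zero_prod_def add_nonneg_eq_0_iff)
  then show ?thesis unfolding lborel_prod .
qed

lemma sigma_finite_lborel2: "sigma_finite_measure (lborel \<Otimes>\<^sub>M lborel :: ('a::euclidean_space \<times> 'a) measure)"
  by (simp add: lborel_prod sigma_finite_lborel)

lemma sigma_finite_lborel3:
  "sigma_finite_measure ((lborel \<Otimes>\<^sub>M lborel) \<Otimes>\<^sub>M lborel :: (('a::euclidean_space \<times> 'a) \<times> 'a) measure)"
  by (simp add: lborel_prod sigma_finite_lborel)

definition freq4 :: "('a::euclidean_space \<Rightarrow> complex) \<Rightarrow> ('a \<Rightarrow> complex) \<Rightarrow> ('a \<Rightarrow> complex) \<Rightarrow> ('a \<Rightarrow> complex) \<Rightarrow> ('a \<times> 'a) \<times> 'a \<Rightarrow> complex" where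
  "freq4 a b c d = (\<lambda>p. a (fst (fst p) - snd (fst p)) * b (snd (fst p)) *
     (cnj (c (fst (fst p) - snd p)) * cnj (d (snd p))))"

definition freq3 :: "('a::euclidean_space \<Rightarrow> complex) \<Rightarrow> ('a \<Rightarrow> complex) \<Rightarrow> ('a \<Rightarrow> complex) \<Rightarrow> 'a \<times> 'a \<Rightarrow> complex" where
  "freq3 a b c = (\<lambda>p. a (fst p - snd p) * b (snd p) * cnj (c (fst p)))"

lemma freq4_poisson_ext: "freq4 (poisson_ext z a) (poisson_ext z b) (poisson_ext z c) (poisson_ext z d) \<omega> = of_real (exp (- (z * sum4 \<omega>))) * freq4 a b c d \<omega>"
proof -
  obtain \<xi> \<eta> \<zeta> where \<omega>: "\<omega> = ((\<xi>, \<eta>), \<zeta>)" by (metis surj_pair)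
  have "exp (- (z * sum4 \<omega>)) = exp (- (z * norm (\<xi> - \<eta>))) * exp (- (z * norm \<eta>)) * exp (- (z * norm (\<xi> - \<zeta>))) * exp (- (z * norm \<zeta>))"
    unfolding \<omega> by (simp add: sum4_def exp_add[symmetric] algebra_simps)
  then show ?thesis unfolding \<omega> by (simp add: freq4_def poisson_ext_def mult_ac del: of_real_exp)
qed

lemma freq3_poisson_ext: "freq3 (poisson_ext z a) (poisson_ext z b) (poisson_ext z c) \<omega> = of_real (exp (- (z * sum3 \<omega>))) * freq3 a b c \<omega>"
proof -
  obtain \<xi> \<eta> where \<omega>: "\<omega> = (\<xi>, \<eta>)" by (metis surj_pair)
  have "exp (- (z * sum3 \<omega>)) = exp (- (z * norm (\<xi> - \<eta>))) * exp (- (z * norm \<eta>)) * exp (- (z * norm \<xi>))"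
    unfolding \<omega> by (simp add: sum3_def exp_add[symmetric] algebra_simps)
  then show ?thesis unfolding \<omega> by (simp add: freq3_def poisson_ext_def mult_ac del: of_real_exp)
qed

lemma freq3_integral:
  fixes a b c :: "'a::euclidean_space \<Rightarrow> complex"
  assumes "rapid a" "rapid b" "rapid c"
  shows integrable_freq3: "integrable (lborel \<Otimes>\<^sub>M lborel) (freq3 a b c)"
    and integral_freq3: "of_real (tri_form a b c) = integral\<^sup>L (lborel \<Otimes>\<^sub>M lborel) (freq3 a b c) / ((2 * pi) ^ DIM('a))\<^sup>2"
  using tri_frequency[OF assms] by (simp_all add: freq3_def case_prod_unfold)

lemma freq4_integral:
  fixes a b c d :: "'a::euclidean_space \<Rightarrow> complex"
  assumes "rapid a" "rapid b" "rapid c" "rapid d"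
  shows integrable_freq4: "integrable ((lborel \<Otimes>\<^sub>M lborel) \<Otimes>\<^sub>M lborel) (freq4 a b c d)"
    and integral_freq4: "of_real (quad_form a b c d)
      = integral\<^sup>L ((lborel \<Otimes>\<^sub>M lborel) \<Otimes>\<^sub>M lborel) (freq4 a b c d) / ((2 * pi) ^ DIM('a)) ^ 3"
  using quad_frequency[OF assms] by (simp_all add: freq4_def case_prod_unfold)

lemma bounded_ratio_integrable:
  fixes F \<Phi> :: "'w \<Rightarrow> complex" and S :: "'w \<Rightarrow> real"
  assumes [measurable]: "F \<in> borel_measurable M" "S \<in> borel_measurable M" and i: "integrable M \<Phi>"
    and b: "\<And>\<omega>. norm (F \<omega>) \<le> (S \<omega>)\<^sup>2 * norm (\<Phi> \<omega>)"
  shows "integrable M (\<lambda>\<omega>. F \<omega> / of_real ((S \<omega>)\<^sup>2))"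
proof (rule Bochner_Integration.integrable_bound[OF i])
  have "norm (F \<omega> / of_real ((S \<omega>)\<^sup>2)) \<le> norm (\<Phi> \<omega>)" for \<omega>
    using b[of \<omega>] by (cases "S \<omega> = 0") (auto simp: norm_divide norm_power divide_le_eq mult.commute)
  then show "AE \<omega> in M. norm (F \<omega> / of_real ((S \<omega>)\<^sup>2)) \<le> norm (\<Phi> \<omega>)" by simp
qed measurable

text \<open>The primed symbols carry two derivatives more than the unprimed ones. Each costs at most
  \<open>sum3\<close>, so after division by its square the integrand is dominated by the
  undifferentiated one.\<close>

lemma tri_laplace:
  fixes a b c a' b' c' :: "'a::euclidean_space \<Rightarrow> complex"
  assumes r: "rapid a" "rapid b" "rapid c" "rapid a'" "rapid b'" "rapid c'"
    and bd: "\<And>\<omega>. norm (freq3 a' b' c' \<omega>) \<le> (sum3 \<omega>)\<^sup>2 * norm (freq3 a b c \<omega>)"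
  shows tri_laplace_integrable: "set_integrable lborel {0..} (\<lambda>z. z * tri_form (poisson_ext z a') (poisson_ext z b') (poisson_ext z c'))"
    and tri_laplace_freq_integrable: "integrable (lborel \<Otimes>\<^sub>M lborel) (\<lambda>\<omega>. freq3 a' b' c' \<omega> / of_real ((sum3 \<omega>)\<^sup>2))"
    and tri_laplace_integral: "of_real (LINT z:{0..}|lborel. z * tri_form (poisson_ext z a') (poisson_ext z b') (poisson_ext z c'))
      = (LINT \<omega>|(lborel \<Otimes>\<^sub>M lborel). freq3 a' b' c' \<omega> / of_real ((sum3 \<omega>)\<^sup>2)) / ((2 * pi) ^ DIM('a))\<^sup>2"
proof -
  have [measurable]: "freq3 a' b' c' \<in> borel_measurable (lborel \<Otimes>\<^sub>M lborel)"
    using integrable_freq3[OF r(4-6)] by auto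
  show i: "integrable (lborel \<Otimes>\<^sub>M lborel) (\<lambda>\<omega>. freq3 a' b' c' \<omega> / of_real ((sum3 \<omega>)\<^sup>2))"
    by (rule bounded_ratio_integrable[OF _ _ integrable_freq3[OF r(1-3)] bd]) measurable
  have z: "freq3 a' b' c' \<omega> = 0" if "sum3 \<omega> = 0" for \<omega>
    using bd[of \<omega>] that by simp
  have q: "of_real (tri_form (poisson_ext z a') (poisson_ext z b') (poisson_ext z c')) =
     (LINT \<omega>|(lborel \<Otimes>\<^sub>M lborel). of_real (exp (- (z * sum3 \<omega>))) * freq3 a' b' c' \<omega>) / ((2 * pi) ^ DIM('a))\<^sup>2"
    if "z \<ge> 0" for z
    using integral_freq3[of "poisson_ext z a'" "poisson_ext z b'" "poisson_ext z c'"] r that by (simp add: rapid_poisson_ext freq3_poisson_ext cong: Bochner_Integration.integral_cong)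
  note L = real_laplace_weight[OF sigma_finite_lborel2 _ _ sum3_nonneg z i q]
  show "set_integrable lborel {0..} (\<lambda>z. z * tri_form (poisson_ext z a') (poisson_ext z b') (poisson_ext z c'))"
    by (rule L(1)) auto
  show "of_real (LINT z:{0..}|lborel. z * tri_form (poisson_ext z a') (poisson_ext z b') (poisson_ext z c'))
      = (LINT \<omega>|(lborel \<Otimes>\<^sub>M lborel). freq3 a' b' c' \<omega> / of_real ((sum3 \<omega>)\<^sup>2)) / ((2 * pi) ^ DIM('a))\<^sup>2"
    by (rule L(2)) auto
qed

lemma quad_laplace_integrable:
  fixes a b c d a' b' c' d' :: "'a::euclidean_space \<Rightarrow> complex"
  assumes r: "rapid a" "rapid b" "rapid c" "rapid d" "rapid a'" "rapid b'" "rapid c'" "rapid d'"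
    and bd: "\<And>\<omega>. norm (freq4 a' b' c' d' \<omega>) \<le> (sum4 \<omega>)\<^sup>2 * norm (freq4 a b c d \<omega>)"
  shows "set_integrable lborel {0..} (\<lambda>z. z * quad_form (poisson_ext z a') (poisson_ext z b') (poisson_ext z c') (poisson_ext z d'))"
proof -
  have [measurable]: "freq4 a' b' c' d' \<in> borel_measurable ((lborel \<Otimes>\<^sub>M lborel) \<Otimes>\<^sub>M lborel)"
    using integrable_freq4[OF r(5-8)] by auto
  have i: "integrable ((lborel \<Otimes>\<^sub>M lborel) \<Otimes>\<^sub>M lborel) (\<lambda>\<omega>. freq4 a' b' c' d' \<omega> / of_real ((sum4 \<omega>)\<^sup>2))"
    by (rule bounded_ratio_integrable[OF _ _ integrable_freq4[OF r(1-4)] bd]) measurable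
  have z: "freq4 a' b' c' d' \<omega> = 0" if "sum4 \<omega> = 0" for \<omega>
    using bd[of \<omega>] that by simp
  have q: "of_real (quad_form (poisson_ext z a') (poisson_ext z b') (poisson_ext z c') (poisson_ext z d')) =
     (LINT \<omega>|((lborel \<Otimes>\<^sub>M lborel) \<Otimes>\<^sub>M lborel). of_real (exp (- (z * sum4 \<omega>))) * freq4 a' b' c' d' \<omega>) / ((2 * pi) ^ DIM('a)) ^ 3"
    if "z \<ge> 0" for z
    using integral_freq4[of "poisson_ext z a'" "poisson_ext z b'" "poisson_ext z c'" "poisson_ext z d'"] r that
    by (simp add: rapid_poisson_ext freq4_poisson_ext cong: Bochner_Integration.integral_cong)
  show ?thesis
    by (rule real_laplace_weight(1)[OF sigma_finite_lborel3 _ _ sum4_nonneg z i q]) auto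
qed

text \<open>Subtract the squared norm of \<alpha> + \<beta> + \<gamma> + \<delta>, which is zero,
  from the expanded square of the sum of the norms: the diagonal terms cancel and the six pairs
  remain.\<close>

lemma sum_zero_inner_pairs:
  fixes \<alpha> \<beta> \<gamma> \<delta> :: "'a::real_inner"
  assumes "\<alpha> + \<beta> + \<gamma> + \<delta> = 0"
  defines "P \<equiv> \<lambda>x y. norm x * norm y - x \<bullet> (y::'a)"
  shows "2 * (P \<alpha> \<beta> + P \<alpha> \<gamma> + P \<alpha> \<delta> + P \<beta> \<gamma> + P \<beta> \<delta> + P \<gamma> \<delta>) = (norm \<alpha> + norm \<beta> + norm \<gamma> + norm \<delta>)\<^sup>2"
proof -
  have "(\<alpha> + \<beta> + \<gamma> + \<delta>) \<bullet> (\<alpha> + \<beta> + \<gamma> + \<delta>) = 0" using assms by simp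
  then have "(norm \<alpha>)\<^sup>2 + (norm \<beta>)\<^sup>2 + (norm \<gamma>)\<^sup>2 + (norm \<delta>)\<^sup>2
     + 2 * (\<alpha> \<bullet> \<beta> + \<alpha> \<bullet> \<gamma> + \<alpha> \<bullet> \<delta> + \<beta> \<bullet> \<gamma> + \<beta> \<bullet> \<delta> + \<gamma> \<bullet> \<delta>) = 0"
    unfolding power2_norm_eq_inner by (simp add: inner_add_left inner_add_right inner_commute algebra_simps)
  then show ?thesis unfolding P_def by (simp add: power2_eq_square algebra_simps)
qed

text \<open>This is \<open>\<integral> z \<integral> \<Delta>(H\<^sup>2 B\<^sup>2) dx dz = \<integral> h\<^sup>2 b\<^sup>2 dx\<close> for the Poisson extensions \<open>H, B\<close> of \<open>h, b\<close>, the
  Laplacian being that of the half space.\<close>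

lemma quad_form_identity:
  fixes h b :: "'a::euclidean_space \<Rightarrow> complex"
  assumes h: "rapid h" and b: "rapid b"
  defines "\<Theta> \<equiv> \<lambda>z. \<Sum>d\<in>dirs. 2 * quad_form (poisson_ext z (dir_mult d h)) (poisson_ext z (dir_mult d h)) (poisson_ext z b) (poisson_ext z b)
      + 2 * quad_form (poisson_ext z h) (poisson_ext z h) (poisson_ext z (dir_mult d b)) (poisson_ext z (dir_mult d b))
      + 8 * quad_form (poisson_ext z (dir_mult d h)) (poisson_ext z h) (poisson_ext z (dir_mult d b)) (poisson_ext z b)"
  shows "set_integrable lborel {0..} (\<lambda>z. z * \<Theta> z)"
    and "(LINT z:{0..}|lborel. z * \<Theta> z) = quad_form h h b b"
proof -
  let ?M = "(lborel \<Otimes>\<^sub>M lborel) \<Otimes>\<^sub>M lborel :: (('a \<times> 'a) \<times> 'a) measure"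
  let ?\<Phi> = "freq4 h h b b"
  let ?K = "complex_of_real (((2 * pi) ^ DIM('a)) ^ 3)"
  let ?F = "\<lambda>\<omega>. of_real ((sum4 \<omega>)\<^sup>2) * ?\<Phi> \<omega>"
  have i: "integrable ?M ?\<Phi>" by (rule integrable_freq4) fact+
  have m [measurable]: "?\<Phi> \<in> borel_measurable ?M" using i by auto
  have ae: "AE \<omega> in ?M. ?F \<omega> / of_real ((sum4 \<omega>)\<^sup>2) = ?\<Phi> \<omega>"
    using AE_sum4 by eventually_elim auto
  have mF: "?F \<in> borel_measurable ?M" by measurable
  have mr: "(\<lambda>\<omega>. ?F \<omega> / of_real ((sum4 \<omega>)\<^sup>2)) \<in> borel_measurable ?M" by measurable
  have iF: "integrable ?M (\<lambda>\<omega>. ?F \<omega> / of_real ((sum4 \<omega>)\<^sup>2))"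
    using integrable_cong_AE[OF mr m ae] i by simp
  have q: "of_real (\<Theta> z) = (LINT \<omega>|?M. of_real (exp (- (z * sum4 \<omega>))) * ?F \<omega>) / ?K" if z: "z \<ge> 0" for z
  proof -
    let ?e = "\<lambda>g. poisson_ext z g"
    let ?D = "\<lambda>d g. poisson_ext z (dir_mult d g)"
    have r: "rapid (?e h)" "rapid (?e b)" "rapid (?D d h)" "rapid (?D d b)" for d
      using z h b by (auto intro: rapid_poisson_ext rapid_dir_mult)
    \<comment> \<open>For a product of four harmonic factors the Laplacian is twice the sum, over
      the six pairs of factors, of the product with both factors of the pair differentiated in the
      same direction. Four of the pairs mix \<open>h\<close> with \<open>b\<close> and give equal
      values, whence the coefficient 8.\<close>
    let ?t = "\<lambda>d \<omega>. 2 * (freq4 (?D d h) (?D d h) (?e b) (?e b) \<omega> + freq4 (?e h) (?e h) (?D d b) (?D d b) \<omega>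
      + freq4 (?D d h) (?e h) (?D d b) (?e b) \<omega> + freq4 (?D d h) (?e h) (?e b) (?D d b) \<omega>
      + freq4 (?e h) (?D d h) (?D d b) (?e b) \<omega> + freq4 (?e h) (?D d h) (?e b) (?D d b) \<omega>)"
    note ii = integrable_freq4[OF r(3) r(3) r(2) r(2)] integrable_freq4[OF r(1) r(1) r(4) r(4)]
      integrable_freq4[OF r(3) r(1) r(4) r(2)] integrable_freq4[OF r(3) r(1) r(2) r(4)]
      integrable_freq4[OF r(1) r(3) r(4) r(2)] integrable_freq4[OF r(1) r(3) r(2) r(4)]
    note jj = integral_freq4[OF r(3) r(3) r(2) r(2)] integral_freq4[OF r(1) r(1) r(4) r(4)]
      integral_freq4[OF r(3) r(1) r(4) r(2)] integral_freq4[OF r(3) r(1) r(2) r(4)]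
      integral_freq4[OF r(1) r(3) r(4) r(2)] integral_freq4[OF r(1) r(3) r(2) r(4)]
    have sym: "quad_form (?D d h) (?e h) (?D d b) (?e b) = quad_form (?D d h) (?e h) (?e b) (?D d b)"
      "quad_form (?D d h) (?e h) (?D d b) (?e b) = quad_form (?e h) (?D d h) (?D d b) (?e b)"
      "quad_form (?D d h) (?e h) (?D d b) (?e b) = quad_form (?e h) (?D d h) (?e b) (?D d b)" for d
      by (simp_all add: quad_form_def mult_ac)
    have t: "integrable ?M (?t d)" for d
      by (intro integrable_mult_right Bochner_Integration.integrable_add ii)
    have t_int: "integral\<^sup>L ?M (?t d) / ?K =
       of_real (2 * quad_form (?D d h) (?D d h) (?e b) (?e b) + 2 * quad_form (?e h) (?e h) (?D d b) (?D d b)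
        + 8 * quad_form (?D d h) (?e h) (?D d b) (?e b))" for d
    proof -
      have "integral\<^sup>L ?M (?t d) / ?K = 2 * (of_real (quad_form (?D d h) (?D d h) (?e b) (?e b)) + of_real (quad_form (?e h) (?e h) (?D d b) (?D d b))
        + of_real (quad_form (?D d h) (?e h) (?D d b) (?e b)) + of_real (quad_form (?D d h) (?e h) (?e b) (?D d b))
        + of_real (quad_form (?e h) (?D d h) (?D d b) (?e b)) + of_real (quad_form (?e h) (?D d h) (?e b) (?D d b)))"
        unfolding jj using ii[of d] ii[of d d] by (simp add: add_divide_distrib)
      also have "\<dots> = of_real (2 * quad_form (?D d h) (?D d h) (?e b) (?e b) + 2 * quad_form (?e h) (?e h) (?D d b) (?D d b)
        + 8 * quad_form (?D d h) (?e h) (?D d b) (?e b))"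
        unfolding sym[of d, symmetric] by simp
      finally show ?thesis .
    qed
    have "of_real (\<Theta> z) = (\<Sum>d\<in>dirs. integral\<^sup>L ?M (?t d) / ?K)"
      unfolding t_int \<Theta>_def by simp
    also have "\<dots> = (LINT \<omega>|?M. (\<Sum>d\<in>dirs. ?t d \<omega>)) / ?K"
      using t by (subst Bochner_Integration.integral_sum) (auto simp: sum_divide_distrib)
    also have "(LINT \<omega>|?M. (\<Sum>d\<in>dirs. ?t d \<omega>)) = (LINT \<omega>|?M. of_real (exp (- (z * sum4 \<omega>))) * ?F \<omega>)"
    proof (rule Bochner_Integration.integral_cong[OF refl])
      fix \<omega> :: "('a \<times> 'a) \<times> 'a"
      obtain \<xi> \<eta> \<zeta> where \<omega>: "\<omega> = ((\<xi>, \<eta>), \<zeta>)" by (metis surj_pair)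
      let ?\<alpha> = "\<xi> - \<eta>" and ?\<beta> = \<eta> and ?\<gamma> = "\<zeta> - \<xi>" and ?\<delta> = "- \<zeta>"
      let ?P = "\<lambda>x y::'a. norm x * norm y - x \<bullet> y"
      let ?E = "\<lambda>x y. (\<Sum>d\<in>dirs. dir_symbol d x * dir_symbol d (y::'a))"
      have td: "?t d \<omega> = 2 * (dir_symbol d ?\<alpha> * dir_symbol d ?\<beta> + dir_symbol d ?\<gamma> * dir_symbol d ?\<delta> + dir_symbol d ?\<alpha> * dir_symbol d ?\<gamma>
         + dir_symbol d ?\<alpha> * dir_symbol d ?\<delta> + dir_symbol d ?\<beta> * dir_symbol d ?\<gamma> + dir_symbol d ?\<beta> * dir_symbol d ?\<delta>)
         * (of_real (exp (- (z * sum4 \<omega>))) * ?\<Phi> \<omega>)" for d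
        unfolding freq4_poisson_ext unfolding \<omega>
        by (simp add: freq4_def dir_mult_def dir_symbol_diff_swap dir_symbol_uminus algebra_simps)
      have "(\<Sum>d\<in>dirs. ?t d \<omega>) = 2 * (?E ?\<alpha> ?\<beta> + ?E ?\<gamma> ?\<delta> + ?E ?\<alpha> ?\<gamma> + ?E ?\<alpha> ?\<delta> + ?E ?\<beta> ?\<gamma> + ?E ?\<beta> ?\<delta>)
         * (of_real (exp (- (z * sum4 \<omega>))) * ?\<Phi> \<omega>)"
        unfolding td by (simp only: sum.distrib sum_distrib_left sum_distrib_right[symmetric] distrib_left)
      also have "2 * (?E ?\<alpha> ?\<beta> + ?E ?\<gamma> ?\<delta> + ?E ?\<alpha> ?\<gamma> + ?E ?\<alpha> ?\<delta> + ?E ?\<beta> ?\<gamma> + ?E ?\<beta> ?\<delta>)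
         = of_real (2 * (?P ?\<alpha> ?\<beta> + ?P ?\<alpha> ?\<gamma> + ?P ?\<alpha> ?\<delta> + ?P ?\<beta> ?\<gamma> + ?P ?\<beta> ?\<delta> + ?P ?\<gamma> ?\<delta>))"
        unfolding sum_dir_symbol by simp
      also have "\<dots> = of_real ((sum4 \<omega>)\<^sup>2)"
        using sum_zero_inner_pairs[of ?\<alpha> ?\<beta> ?\<gamma> ?\<delta>] unfolding \<omega> by (simp add: sum4_def norm_minus_commute)
      finally show "(\<Sum>d\<in>dirs. ?t d \<omega>) = of_real (exp (- (z * sum4 \<omega>))) * ?F \<omega>"
        by (simp only: mult.left_commute)
    qed
    finally show ?thesis .
  qed
  note L = real_laplace_weight[OF sigma_finite_lborel3 measurable_sum4 mF sum4_nonneg _ iF q]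
  show "set_integrable lborel {0..} (\<lambda>z. z * \<Theta> z)" by (rule L(1)) simp_all
  have "complex_of_real (LINT z:{0..}|lborel. z * \<Theta> z) = (LINT \<omega>|?M. ?F \<omega> / of_real ((sum4 \<omega>)\<^sup>2)) / ?K"
    by (rule L(2)) simp_all
  also have "(LINT \<omega>|?M. ?F \<omega> / of_real ((sum4 \<omega>)\<^sup>2)) = integral\<^sup>L ?M ?\<Phi>"
    by (rule integral_cong_AE[OF mr m ae])
  also have "integral\<^sup>L ?M ?\<Phi> / ?K = of_real (quad_form h h b b)"
    using integral_freq4[OF h h b b] by simp
  finally show "(LINT z:{0..}|lborel. z * \<Theta> z) = quad_form h h b b"
    using of_real_eq_iff by blast
qed

section \<open>The Poisson semigroup is a contraction on bounded functions\<close>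

lemma std_normal_cdf_deriv:
  "(cdf std_normal_distribution has_real_derivative std_normal_density x) (at x)"
proof -
  interpret N: real_distribution std_normal_distribution
    by (rule real_dist_normal_dist)
  have "\<exists>F. \<forall>x::real. - \<infinity> < ereal x \<longrightarrow> ereal x < \<infinity> \<longrightarrow> (F has_vector_derivative std_normal_density x) (at x)"
    by (rule einterval_antiderivative) (auto simp: normal_density_def intro!: continuous_intros)
  then obtain F where F: "(F has_vector_derivative std_normal_density x) (at x)" for x by auto
  have c: "cdf std_normal_distribution b - cdf std_normal_distribution a = F b - F a" if "a < b" for a b
  proof -
    have "cdf std_normal_distribution b - cdf std_normal_distribution a = measure std_normal_distribution {a<..b}"
      by (rule N.cdf_diff_eq[OF that])
    also have "\<dots> = (LINT x|std_normal_distribution. indicator {a<..b} x)" by simp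
    also have "\<dots> = (LINT x|lborel. std_normal_density x *\<^sub>R indicator {a<..b} x)"
    proof (rule integral_density)
      show "AE x in lborel. 0 \<le> std_normal_density x" by (simp add: normal_density_nonneg)
    qed measurable
    also have "\<dots> = (LINT x|lborel. indicator {a..b} x *\<^sub>R std_normal_density x)"
    proof (rule integral_cong_AE)
      show "AE x in lborel. std_normal_density x *\<^sub>R indicator {a<..b} x = indicator {a..b} x *\<^sub>R std_normal_density x"
        using AE_lborel_singleton[of a] by eventually_elim (simp split: split_indicator)
    qed measurable
    also have "\<dots> = F b - F a"
    proof (rule integral_FTC_atLeastAtMost)
      show "continuous_on {a..b} std_normal_density"
        unfolding std_normal_density_def[abs_def] by (intro continuous_intros) auto
    qed (use that in \<open>auto intro: has_vector_derivative_at_within[OF F]\<close>)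
    finally show ?thesis .
  qed
  have "cdf std_normal_distribution y = F y + (cdf std_normal_distribution 0 - F 0)" for y
    using c[of 0 y] c[of y 0] by (cases y "0::real" rule: linorder_cases) auto
  then have e: "cdf std_normal_distribution = (\<lambda>y. F y + (cdf std_normal_distribution 0 - F 0))" by (rule ext)
  show ?thesis
    by (subst e) (use F[of x] in \<open>auto intro!: derivative_eq_intros simp: has_real_derivative_iff_has_vector_derivative[symmetric]\<close>)
qed

text \<open>With \<open>\<Phi>\<close> the normal distribution function, \<open>\<Phi>(\<surd>2 (r - c/r)) + exp (4 c) \<Phi>(\<surd>2 (r + c/r))\<close> is an
  antiderivative of the integrand up to the factor \<open>exp (2 c)\<close>.\<close>

lemma subordination:
  fixes c :: real
  assumes c: "c > 0"
  shows "has_bochner_integral lborel (\<lambda>r. indicator {0<..} r * (2 / sqrt pi * exp (- r\<^sup>2) * exp (- (c\<^sup>2 / r\<^sup>2))))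
    (exp (- (2 * c)))"
proof -
  interpret N: real_distribution std_normal_distribution
    by (rule real_dist_normal_dist)
  let ?C = "cdf std_normal_distribution"
  define F where "F r = ?C (sqrt 2 * (r - c / r)) + exp (4 * c) * ?C (sqrt 2 * (r + c / r))" for r
  define f where "f r = 2 / sqrt pi * exp (- (r - c / r)\<^sup>2)" for r
  have d: "sqrt 2 * std_normal_density (sqrt 2 * y) = exp (- y\<^sup>2) / sqrt pi" for y
    by (simp add: std_normal_density_def power_mult_distrib real_sqrt_mult)
  have F: "DERIV F r :> f r" if "r > 0" for r
  proof -
    have "DERIV F r :> std_normal_density (sqrt 2 * (r - c / r)) * (sqrt 2 * (1 + c / r\<^sup>2))
        + exp (4 * c) * (std_normal_density (sqrt 2 * (r + c / r)) * (sqrt 2 * (1 - c / r\<^sup>2)))"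
      unfolding F_def using that
      by (auto intro!: derivative_eq_intros DERIV_chain'[OF _ std_normal_cdf_deriv] simp: power2_eq_square)
    also have "std_normal_density (sqrt 2 * (r - c / r)) * (sqrt 2 * (1 + c / r\<^sup>2))
        + exp (4 * c) * (std_normal_density (sqrt 2 * (r + c / r)) * (sqrt 2 * (1 - c / r\<^sup>2)))
       = (sqrt 2 * std_normal_density (sqrt 2 * (r - c / r))) * (1 + c / r\<^sup>2)
        + exp (4 * c) * (sqrt 2 * std_normal_density (sqrt 2 * (r + c / r))) * (1 - c / r\<^sup>2)"
      by (simp only: mult_ac)
    also have "\<dots> = exp (- (r - c / r)\<^sup>2) / sqrt pi * (1 + c / r\<^sup>2)
        + exp (4 * c) * (exp (- (r + c / r)\<^sup>2) / sqrt pi) * (1 - c / r\<^sup>2)"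
      unfolding d ..
    also have "exp (4 * c) * (exp (- (r + c / r)\<^sup>2) / sqrt pi) = exp (- (r - c / r)\<^sup>2) / sqrt pi"
    proof -
      have "4 * c + - (r + c / r)\<^sup>2 = - (r - c / r)\<^sup>2"
        using that by (simp add: power2_eq_square field_simps)
      then show ?thesis by (simp add: exp_add[symmetric])
    qed
    also have "exp (- (r - c / r)\<^sup>2) / sqrt pi * (1 + c / r\<^sup>2) + exp (- (r - c / r)\<^sup>2) / sqrt pi * (1 - c / r\<^sup>2) = f r"
      unfolding f_def by (simp add: distrib_left right_diff_distrib)
    finally show ?thesis .
  qed
  have top: "filterlim (\<lambda>r. sqrt 2 * (r - c / r)) at_top at_top"
      "filterlim (\<lambda>r. sqrt 2 * (r + c / r)) at_top at_top"
      "filterlim (\<lambda>r. sqrt 2 * (r + c / r)) at_top (at_right 0)"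
    and bot: "filterlim (\<lambda>r. sqrt 2 * (r - c / r)) at_bot (at_right 0)"
    using c by real_asymp+
  \<comment> \<open>The two arguments tend to opposite infinities as \<open>r\<close> decreases to 0
    but both to plus infinity as \<open>r\<close> grows. The terms \<open>exp (4 * c)\<close>
    therefore cancel, and the total increase of \<open>F\<close> is 1.\<close>
  have lim0: "(F \<longlongrightarrow> 0 + exp (4 * c) * 1) (at_right 0)"
    unfolding F_def
    by (intro tendsto_intros filterlim_compose[OF N.cdf_lim_at_top_prob top(3)]
        filterlim_compose[OF N.cdf_lim_at_bot bot])
  have limI: "(F \<longlongrightarrow> 1 + exp (4 * c) * 1) at_top"
    unfolding F_def
    by (intro tendsto_intros filterlim_compose[OF N.cdf_lim_at_top_prob top(1)]
        filterlim_compose[OF N.cdf_lim_at_top_prob top(2)])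
  note FTC = interval_integral_FTC_nonneg[of 0 \<infinity> F f "0 + exp (4 * c) * 1" "1 + exp (4 * c) * 1"]
  have 1: "set_integrable lborel (einterval 0 \<infinity>) f" and 2: "(LBINT x=0..\<infinity>. f x) = (1 + exp (4 * c) * 1) - (0 + exp (4 * c) * 1)"
  proof -
    have f0: "AE x in lborel. 0 < ereal x \<longrightarrow> ereal x < \<infinity> \<longrightarrow> 0 \<le> f x" by (simp add: f_def)
    have fc: "isCont f x" if "0 < ereal x" for x
      unfolding f_def[abs_def] using that by (intro continuous_intros) auto
    have l0: "((F \<circ> real_of_ereal) \<longlongrightarrow> 0 + exp (4 * c) * 1) (at_right 0)"
      using lim0 by (simp add: zero_ereal_def ereal_tendsto_simps)
    have l1: "((F \<circ> real_of_ereal) \<longlongrightarrow> 1 + exp (4 * c) * 1) (at_left \<infinity>)"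
      using limI by (simp add: ereal_tendsto_simps)
    show "set_integrable lborel (einterval 0 \<infinity>) f" "(LBINT x=0..\<infinity>. f x) = (1 + exp (4 * c) * 1) - (0 + exp (4 * c) * 1)"
      by (rule FTC; (use F fc f0 l0 l1 in simp)?; fail)+
  qed
  have e: "einterval 0 \<infinity> = {0::real<..}" by (auto simp: einterval_def)
  have f: "indicator {0<..} r *\<^sub>R f r = exp (2 * c) * (indicator {0<..} r * (2 / sqrt pi * exp (- r\<^sup>2) * exp (- (c\<^sup>2 / r\<^sup>2))))" for r
  proof (cases "r > 0")
    case True
    then have "- (r - c / r)\<^sup>2 = 2 * c + - r\<^sup>2 + - (c\<^sup>2 / r\<^sup>2)"
      by (simp add: power2_eq_square field_simps)
    then have "exp (- (r - c / r)\<^sup>2) = exp (2 * c) * exp (- r\<^sup>2) * exp (- (c\<^sup>2 / r\<^sup>2))"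
      by (simp only: exp_add)
    then show ?thesis unfolding f_def by simp
  qed simp
  let ?g = "\<lambda>r. indicator {0<..} r * (2 / sqrt pi * exp (- r\<^sup>2) * exp (- (c\<^sup>2 / r\<^sup>2)))"
  have "integrable lborel (\<lambda>r. exp (2 * c) * ?g r)" "(LINT r|lborel. exp (2 * c) * ?g r) = 1"
    using 1 2 unfolding f[symmetric] by (simp_all add: set_integrable_def e interval_lebesgue_integral_def set_lebesgue_integral_def)
  then have "has_bochner_integral lborel (\<lambda>r. exp (- (2 * c)) * (exp (2 * c) * ?g r)) (exp (- (2 * c)) * 1)"
    by (intro has_bochner_integral_mult_right) (simp only: has_bochner_integral_iff)
  moreover have "exp (- (2 * c)) * (exp (2 * c) * ?g r) = ?g r" for r
    by (simp only: mult.assoc[symmetric] exp_add[symmetric]) simp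
  ultimately show ?thesis by (simp only: mult_1_right)
qed

lemma has_bochner_integral_half_gaussian:
  "has_bochner_integral lborel (\<lambda>r::real. indicator {0<..} r * (2 / sqrt pi * exp (- r\<^sup>2))) 1"
proof -
  have "has_bochner_integral lborel (\<lambda>x::real. (2 / sqrt pi) * (indicator {0..} x *\<^sub>R exp (- x\<^sup>2))) (2 / sqrt pi * (sqrt pi / 2))"
    using gaussian_moment_0 by (rule has_bochner_integral_mult_right)
  moreover have "AE r in lborel. (2 / sqrt pi) * (indicator {0..} r *\<^sub>R exp (- r\<^sup>2)) = indicator {0<..} r * (2 / sqrt pi * exp (- r\<^sup>2))"
    using AE_lborel_singleton[of "0::real"] by eventually_elim (simp split: split_indicator)
  ultimately show ?thesis
    by (subst (asm) has_bochner_integral_cong_AE) auto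
qed

text \<open>Subordination with \<open>c = z * norm \<xi> / 2\<close> writes the Poisson factor as an
  average of Gaussians of parameter \<open>(z / (2 * r))\<^sup>2\<close> over the probability
  density \<open>?w\<close>. Every Gaussian mean is bounded by \<open>C\<close>, hence so is the
  average.\<close>

theorem norm_inv_fourier_poisson_le:
  fixes f :: "'a::euclidean_space \<Rightarrow> complex"
  assumes f: "integrable lborel f" and bd: "\<And>x. norm (f x) \<le> C" and ff: "integrable lborel (fourier f)"
    and z: "z > 0"
  shows "norm (inv_fourier (poisson_ext z (fourier f)) x) \<le> C"
proof -
  have [measurable]: "fourier f \<in> borel_measurable borel" using ff by auto
  let ?w = "\<lambda>r::real. indicator {0<..} r * (2 / sqrt pi * exp (- r\<^sup>2))"
  let ?t = "\<lambda>r. (z / (2 * r))\<^sup>2"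
  let ?e = "\<lambda>r \<xi>::'a. exp (- ?t r * (norm \<xi>)\<^sup>2)"
  let ?h = "\<lambda>\<xi>. cis (\<xi> \<bullet> x) * fourier f \<xi>"
  have w: "integrable lborel ?w" "integral\<^sup>L lborel ?w = 1"
    using has_bochner_integral_half_gaussian by (auto simp: has_bochner_integral_iff)
  have w0: "?w r \<ge> 0" for r by (simp add: indicator_def)
  have h: "integrable lborel ?h" by (rule integrable_cis_mult[OF ff])
  let ?G = "\<lambda>(r, \<xi>). of_real (?w r * ?e r \<xi>) * ?h \<xi>"
  have i: "integrable (lborel \<Otimes>\<^sub>M lborel) ?G"
  proof (rule Bochner_Integration.integrable_bound)
    show "integrable (lborel \<Otimes>\<^sub>M lborel) (\<lambda>(r, \<xi>). complex_of_real (?w r) * ?h \<xi>)"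
      by (rule lborel_pair.integrable_mult_pair[OF integrable_of_real[OF w(1)] h])
    show "?G \<in> borel_measurable (lborel \<Otimes>\<^sub>M lborel)" by measurable
    have "norm (of_real (?w r * ?e r \<xi>) * ?h \<xi>) \<le> norm (complex_of_real (?w r) * ?h \<xi>)" for r \<xi>
    proof -
      have "\<bar>?w r * ?e r \<xi>\<bar> \<le> \<bar>?w r\<bar>"
        unfolding abs_mult by (rule mult_left_le) auto
      then show ?thesis unfolding norm_mult norm_of_real by (rule mult_right_mono) simp
    qed
    then show "AE p in lborel \<Otimes>\<^sub>M lborel. norm (?G p) \<le> norm (case p of (r, \<xi>) \<Rightarrow> complex_of_real (?w r) * ?h \<xi>)"
      by (auto simp: case_prod_unfold)
  qed
  \<comment> \<open>At \<open>\<xi> = 0\<close> the subordination parameter would be 0, which the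
    formula excludes; one point does not affect the integral.\<close>
  have sub: "(LINT r|lborel. of_real (?w r * ?e r \<xi>) * ?h \<xi>) = cis (\<xi> \<bullet> x) * poisson_ext z (fourier f) \<xi>" if "\<xi> \<noteq> 0" for \<xi>
  proof -
    have c: "z * norm \<xi> / 2 > 0" using z that by simp
    have e: "indicator {0<..} r * (2 / sqrt pi * exp (- r\<^sup>2) * exp (- ((z * norm \<xi> / 2)\<^sup>2 / r\<^sup>2))) = ?w r * ?e r \<xi>" for r
      by (simp add: power_mult_distrib power_divide)
    have "(LINT r|lborel. ?w r * ?e r \<xi>) = exp (- (z * norm \<xi>))"
      using subordination[OF c] unfolding e by (simp add: has_bochner_integral_iff)
    then show ?thesis
      unfolding integral_mult_left_zero integral_complex_of_real poisson_ext_def by (simp only: mult_ac)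
  qed
  have "(LINT \<xi>|lborel. cis (\<xi> \<bullet> x) * poisson_ext z (fourier f) \<xi>) = (LINT \<xi>|lborel. (LINT r|lborel. of_real (?w r * ?e r \<xi>) * ?h \<xi>))"
  proof (rule integral_cong_AE)
    show "AE \<xi> in lborel. cis (\<xi> \<bullet> x) * poisson_ext z (fourier f) \<xi> = (LINT r|lborel. of_real (?w r * ?e r \<xi>) * ?h \<xi>)"
      using AE_lborel_singleton[of "0::'a"] by eventually_elim (rule sub[symmetric])
    show "(\<lambda>\<xi>. cis (\<xi> \<bullet> x) * poisson_ext z (fourier f) \<xi>) \<in> borel_measurable lborel"
      unfolding poisson_ext_def by measurable
  qed measurable
  also have "\<dots> = (LINT r|lborel. (LINT \<xi>|lborel. of_real (?w r * ?e r \<xi>) * ?h \<xi>))"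
    by (rule lborel_pair.Fubini_integral[OF i])
  finally have eq: "(LINT \<xi>|lborel. cis (\<xi> \<bullet> x) * poisson_ext z (fourier f) \<xi>) = (LINT r|lborel. (LINT \<xi>|lborel. of_real (?w r * ?e r \<xi>) * ?h \<xi>))" .
  have in_r: "integrable lborel (\<lambda>r. LINT \<xi>|lborel. of_real (?w r * ?e r \<xi>) * ?h \<xi>)"
    using lborel_pair.integrable_fst[OF i] .
  let ?c = "(2 * pi) ^ DIM('a)"
  have b: "norm (LINT \<xi>|lborel. of_real (?w r * ?e r \<xi>) * ?h \<xi>) \<le> ?w r * (C * ?c)" for r
  proof (cases "r > 0")
    case True
    then have t: "?t r > 0" using z by simp
    have "(LINT \<xi>|lborel. of_real (?w r * ?e r \<xi>) * ?h \<xi>)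
        = (LINT \<xi>|lborel. of_real (?w r) * (cis (\<xi> \<bullet> x) * (of_real (?e r \<xi>) * fourier f \<xi>)))"
      by (intro Bochner_Integration.integral_cong refl) (simp only: of_real_mult mult_ac)
    also have "\<dots> = of_real (?w r) * (of_real ?c * inv_fourier (\<lambda>\<xi>. of_real (?e r \<xi>) * fourier f \<xi>) x)"
      unfolding integral_mult_right_zero by (simp add: inv_fourier_def)
    finally have "norm (LINT \<xi>|lborel. of_real (?w r * ?e r \<xi>) * ?h \<xi>)
        = ?w r * (?c * norm (inv_fourier (\<lambda>\<xi>. of_real (?e r \<xi>) * fourier f \<xi>) x))"
      by (simp only: norm_mult norm_of_real abs_of_nonneg[OF w0]) simp
    also have "\<dots> \<le> ?w r * (?c * C)"
      using norm_inv_fourier_gauss_le[OF f t bd, of x] w0 by (intro mult_left_mono) auto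
    finally show ?thesis by (simp only: mult.commute[of C])
  qed simp
  have "norm (LINT \<xi>|lborel. cis (\<xi> \<bullet> x) * poisson_ext z (fourier f) \<xi>) \<le> (LINT r|lborel. ?w r * (C * ?c))"
    unfolding eq by (rule Bochner_Integration.integral_norm_bound_integral[OF in_r integrable_mult_left[OF w(1)] b])
  also have "\<dots> = C * ?c" unfolding integral_mult_left_zero w(2) by simp
  finally show ?thesis
    by (simp add: inv_fourier_def norm_divide norm_mult norm_power divide_le_eq)
qed

text \<open>Integrability of \<open>synth b\<close> identifies \<open>b\<close> as the transform of
  \<open>synth b\<close>, so that the contraction applies with \<open>synth b\<close> as boundary
  data.\<close>

lemma synth_poisson_ext_bounded:
  fixes b :: "'a::euclidean_space \<Rightarrow> complex"
  assumes b: "rapid b" and i: "integrable lborel (synth b)" and bd: "\<And>x. \<bar>synth b x\<bar> \<le> M" and z: "z \<ge> 0"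
  shows "\<bar>synth (poisson_ext z b) x\<bar> \<le> M"
proof (cases "z = 0")
  case False
  let ?f = "\<lambda>x. complex_of_real (synth b x)"
  have fb: "fourier ?f = b" using fourier_synth[OF b i] by auto
  have "\<bar>synth (poisson_ext z b) x\<bar> \<le> norm (inv_fourier (poisson_ext z (fourier ?f)) x)"
    unfolding fb synth_def[of "poisson_ext z b"] by (rule abs_Re_le_cmod)
  also have "\<dots> \<le> M"
    by (rule norm_inv_fourier_poisson_le) (use i bd z False b in \<open>auto simp: fb rapid_integrable\<close>)
  finally show ?thesis .
qed (simp add: bd)

section \<open>Square function and Carleson embedding\<close>

lemma integrable_synth_sq: "rapid a \<Longrightarrow> integrable lborel (\<lambda>x. (synth a x)\<^sup>2)"
  using integrable_synth_mult[of a a] by (simp add: power2_eq_square)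

lemma integral_synth_sq:
  fixes g :: "'a::euclidean_space \<Rightarrow> complex"
  assumes "rapid g"
  shows "(LINT x|lborel. (synth g x)\<^sup>2) = (LINT \<xi>|lborel. (norm (g \<xi>))\<^sup>2) / (2 * pi) ^ DIM('a)"
proof -
  have "complex_of_real (LINT x|lborel. (synth g x)\<^sup>2) = (LINT \<xi>|lborel. complex_of_real ((norm (g \<xi>))\<^sup>2)) / (2 * pi) ^ DIM('a)"
    using integral_synth_mult[OF assms assms] by (simp only: power2_eq_square[of "synth _ _"] complex_norm_square[symmetric] of_real_power)
  also have "\<dots> = complex_of_real ((LINT \<xi>|lborel. (norm (g \<xi>))\<^sup>2) / (2 * pi) ^ DIM('a))"
    by (simp only: integral_complex_of_real of_real_divide)
  finally show ?thesis using of_real_eq_iff by blast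
qed

lemma integrable_norm_sq_rapid:
  assumes "rapid g" shows "integrable lborel (\<lambda>\<xi>. complex_of_real ((norm (g \<xi>))\<^sup>2))"
proof -
  obtain C where C: "\<And>\<xi>. norm (g \<xi>) \<le> C" using rapid_bounded[OF assms] by metis
  have "integrable lborel (\<lambda>\<xi>. g \<xi> * cnj (g \<xi>))"
    using rapid_measurable[OF assms]
    by (intro integrable_bounded_mult[OF rapid_integrable[OF assms], where C=C]) (auto simp: C)
  then show ?thesis by (simp only: complex_norm_square)
qed

definition energy :: "('a::euclidean_space \<Rightarrow> complex) \<Rightarrow> real" where
  "energy g = (LINT x|lborel. (synth g x)\<^sup>2)"

lemma energy_nonneg: "energy g \<ge> 0" by (simp add: energy_def)

text \<open>The square of the Poisson factor decays with rate \<open>2 * norm \<xi>\<close>, so the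
  weight \<open>z\<close> divides by the square of this number. The symbols of all directions add up
  to half of that square, which leaves the factor 1/2.\<close>

lemma square_function:
  fixes h :: "'a::euclidean_space \<Rightarrow> complex"
  assumes h: "rapid h"
  shows "d \<in> dirs \<Longrightarrow> set_integrable lborel {0..} (\<lambda>z. z * energy (poisson_ext z (dir_mult d h)))"
    and "set_integrable lborel {0..} (\<lambda>z. z * (\<Sum>d\<in>dirs. energy (poisson_ext z (dir_mult d h))))"
    and "(LINT z:{0..}|lborel. z * (\<Sum>d\<in>dirs. energy (poisson_ext z (dir_mult d h)))) = energy h / 2"
proof -
  let ?c = "complex_of_real ((2 * pi) ^ DIM('a))"
  let ?S = "\<lambda>\<xi>::'a. 2 * norm \<xi>"
  let ?H = "\<lambda>\<xi>. complex_of_real ((norm (h \<xi>))\<^sup>2)"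
  have [measurable]: "h \<in> borel_measurable borel" using h by (rule rapid_measurable)
  have iH: "integrable lborel ?H" by (rule integrable_norm_sq_rapid[OF h])
  let ?F = "\<lambda>d \<xi>. of_real ((norm (dir_symbol d \<xi>))\<^sup>2) * ?H \<xi>"
  have bF: "norm (?F d \<xi>) \<le> (?S \<xi>)\<^sup>2 * norm (?H \<xi>)" if "d \<in> dirs" for d \<xi>
  proof -
    have "norm (dir_symbol d \<xi>) \<le> ?S \<xi>" using norm_dir_symbol_le[OF that, of \<xi>] norm_ge_zero[of \<xi>] by linarith
    then have "(norm (dir_symbol d \<xi>))\<^sup>2 \<le> (?S \<xi>)\<^sup>2" by (intro power_mono) auto
    then show ?thesis unfolding norm_mult by (intro mult_right_mono) (auto simp del: of_real_power)
  qed
  have ptw: "norm (poisson_ext z (dir_mult d h) \<xi>) ^ 2 = exp (- (z * ?S \<xi>)) * ((norm (dir_symbol d \<xi>))\<^sup>2 * (norm (h \<xi>))\<^sup>2)" for z d \<xi>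
  proof -
    have "exp (- (z * ?S \<xi>)) = (exp (- (z * norm \<xi>)))\<^sup>2"
      by (simp add: exp_add[symmetric] power2_eq_square)
    then show ?thesis by (simp add: poisson_ext_def dir_mult_def norm_mult power_mult_distrib)
  qed
  have q: "of_real (energy (poisson_ext z (dir_mult d h))) = (LINT \<xi>|lborel. of_real (exp (- (z * ?S \<xi>))) * ?F d \<xi>) / ?c"
    if "z \<ge> 0" for d z
  proof -
    have "complex_of_real (energy (poisson_ext z (dir_mult d h))) = of_real ((LINT \<xi>|lborel. exp (- (z * ?S \<xi>)) * ((norm (dir_symbol d \<xi>))\<^sup>2 * (norm (h \<xi>))\<^sup>2)) / (2 * pi) ^ DIM('a))"
      unfolding energy_def by (subst integral_synth_sq) (auto simp: ptw intro: rapid_poisson_ext rapid_dir_mult h that)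
    also have "\<dots> = (LINT \<xi>|lborel. complex_of_real (exp (- (z * ?S \<xi>)) * ((norm (dir_symbol d \<xi>))\<^sup>2 * (norm (h \<xi>))\<^sup>2))) / ?c"
      by (simp only: integral_complex_of_real of_real_divide)
    finally show ?thesis by (simp only: of_real_mult)
  qed
  have m: "?F d \<in> borel_measurable lborel" for d by measurable
  show 1: "set_integrable lborel {0..} (\<lambda>z. z * energy (poisson_ext z (dir_mult d h)))" if d: "d \<in> dirs" for d
  proof (rule real_laplace_weight(1)[OF sigma_finite_lborel _ m _ _ _ q])
    show "integrable lborel (\<lambda>\<xi>. ?F d \<xi> / of_real ((?S \<xi>)\<^sup>2))"
      by (rule bounded_ratio_integrable[OF m _ iH bF[OF d]]) measurable
    show "?F d \<xi> = 0" if "?S \<xi> = 0" for \<xi> using bF[OF d, of \<xi>] that by simp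
  qed auto
  have sq: "(\<Sum>d\<in>dirs. (norm (dir_symbol d \<xi>))\<^sup>2) = (?S \<xi>)\<^sup>2 / 2" for \<xi>
  proof -
    have "complex_of_real (\<Sum>d\<in>dirs. (norm (dir_symbol d \<xi>))\<^sup>2) = (\<Sum>d\<in>dirs. dir_symbol d \<xi> * dir_symbol d (- \<xi>))"
      unfolding of_real_sum dir_symbol_uminus complex_norm_square[symmetric] of_real_power ..
    also have "\<dots> = of_real ((?S \<xi>)\<^sup>2 / 2)"
      unfolding sum_dir_symbol by (simp add: power2_eq_square power2_norm_eq_inner[symmetric])
    finally show ?thesis using of_real_eq_iff by blast
  qed
  have ssum: "(\<lambda>z. z * (\<Sum>d\<in>dirs. energy (poisson_ext z (dir_mult d h)))) = (\<lambda>z. \<Sum>d\<in>dirs. z * energy (poisson_ext z (dir_mult d h)))"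
    by (simp add: sum_distrib_left)
  let ?G = "\<lambda>\<xi>. of_real ((?S \<xi>)\<^sup>2 / 2) * ?H \<xi>"
  have mG: "?G \<in> borel_measurable lborel" by measurable
  have mr: "(\<lambda>\<xi>. ?G \<xi> / of_real ((?S \<xi>)\<^sup>2)) \<in> borel_measurable lborel" by measurable
  have mh: "(\<lambda>\<xi>. ?H \<xi> / 2) \<in> borel_measurable lborel" by measurable
  have ae: "AE \<xi> in lborel. ?G \<xi> / of_real ((?S \<xi>)\<^sup>2) = ?H \<xi> / 2"
    using AE_lborel_singleton[of "0::'a"] by eventually_elim simp
  have iG: "integrable lborel (\<lambda>\<xi>. ?G \<xi> / of_real ((?S \<xi>)\<^sup>2))"
    using integrable_cong_AE[OF mr mh ae] iH by simp
  have qG: "of_real (\<Sum>d\<in>dirs. energy (poisson_ext z (dir_mult d h))) = (LINT \<xi>|lborel. of_real (exp (- (z * ?S \<xi>))) * ?G \<xi>) / ?c"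
    if z: "z \<ge> 0" for z
  proof -
    have ie: "integrable lborel (\<lambda>\<xi>. of_real (exp (- (z * ?S \<xi>))) * ?F d \<xi>)" for d
      using integrable_norm_sq_rapid[OF rapid_poisson_ext[OF z rapid_dir_mult[OF h]], of d] by (simp only: ptw of_real_mult)
    have "of_real (\<Sum>d\<in>dirs. energy (poisson_ext z (dir_mult d h))) = (LINT \<xi>|lborel. (\<Sum>d\<in>dirs. of_real (exp (- (z * ?S \<xi>))) * ?F d \<xi>)) / ?c"
      unfolding of_real_sum q[OF z] using ie by (subst Bochner_Integration.integral_sum) (auto simp: sum_divide_distrib)
    also have "(\<lambda>\<xi>. \<Sum>d\<in>dirs. of_real (exp (- (z * ?S \<xi>))) * ?F d \<xi>) = (\<lambda>\<xi>. of_real (exp (- (z * ?S \<xi>))) * ?G \<xi>)"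
      by (rule ext) (simp only: sum_distrib_left[symmetric] sum_distrib_right[symmetric] of_real_sum[symmetric] sq)
    finally show ?thesis .
  qed
  have z0: "\<And>\<xi>. ?S \<xi> = 0 \<Longrightarrow> ?G \<xi> = 0" by simp
  have S0: "\<And>\<xi>. ?S \<xi> \<ge> 0" by simp
  have mS: "?S \<in> borel_measurable lborel" by measurable
  note L = real_laplace_weight[OF sigma_finite_lborel mS mG S0 z0 iG qG]
  show "set_integrable lborel {0..} (\<lambda>z. z * (\<Sum>d\<in>dirs. energy (poisson_ext z (dir_mult d h))))"
    by (rule L(1))
  have "complex_of_real (LINT z:{0..}|lborel. z * (\<Sum>d\<in>dirs. energy (poisson_ext z (dir_mult d h)))) = (LINT \<xi>|lborel. ?G \<xi> / of_real ((?S \<xi>)\<^sup>2)) / ?c"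
    by (rule L(2))
  also have "(LINT \<xi>|lborel. ?G \<xi> / of_real ((?S \<xi>)\<^sup>2)) = (LINT \<xi>|lborel. ?H \<xi> / 2)"
    by (rule integral_cong_AE[OF mr mh ae])
  also have "\<dots> / ?c = of_real (energy h / 2)"
    unfolding energy_def integral_synth_sq[OF h] integral_divide_zero integral_complex_of_real
    by (simp only: of_real_divide of_real_mult of_real_numeral divide_divide_eq_left mult.commute)
  finally show "(LINT z:{0..}|lborel. z * (\<Sum>d\<in>dirs. energy (poisson_ext z (dir_mult d h)))) = energy h / 2"
    using of_real_eq_iff by blast
qed

lemma set_integrable_finite_sum:
  fixes f :: "'i \<Rightarrow> real \<Rightarrow> real"
  assumes "\<And>i. i \<in> I \<Longrightarrow> set_integrable lborel A (f i)"
  shows "set_integrable lborel A (\<lambda>z. \<Sum>i\<in>I. f i z)"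
  using assms unfolding set_integrable_def scaleR_sum_right by (intro Bochner_Integration.integrable_sum)

lemma set_integral_mono_Ici:
  fixes f g :: "real \<Rightarrow> real"
  assumes "set_integrable lborel {0..} f" "set_integrable lborel {0..} g" "\<And>z. z \<ge> 0 \<Longrightarrow> f z \<le> g z"
  shows "(LINT z:{0..}|lborel. f z) \<le> (LINT z:{0..}|lborel. g z)"
  using assms by (intro set_integral_mono) auto

text \<open>\<open>\<Theta>\<close> is the Laplacian of the product of the squared extensions, and
  \<open>16 * M\<^sup>2 * A\<close> that of \<open>8 * M\<^sup>2\<close> times the squared extension
  of \<open>h\<close>, both integrated over \<open>x\<close>. The constant 9 is 1, from the boundary
  term of \<open>\<Theta>\<close>, plus 16/2, from the square function.\<close>

theorem carleson_embedding:
  fixes h b :: "'a::euclidean_space \<Rightarrow> complex"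
  assumes h: "rapid h" and b: "rapid b" and M: "\<And>z x. z \<ge> 0 \<Longrightarrow> \<bar>synth (poisson_ext z b) x\<bar> \<le> M"
  defines "X \<equiv> \<lambda>d z. quad_form (poisson_ext z h) (poisson_ext z h) (poisson_ext z (dir_mult d b)) (poisson_ext z (dir_mult d b))"
  shows "d \<in> dirs \<Longrightarrow> set_integrable lborel {0..} (\<lambda>z. z * X d z)"
    and "(LINT z:{0..}|lborel. z * (\<Sum>d\<in>dirs. X d z)) \<le> 9 * M\<^sup>2 * energy h"
proof -
  define \<Theta> where "\<Theta> = (\<lambda>z. \<Sum>d\<in>dirs. 2 * quad_form (poisson_ext z (dir_mult d h)) (poisson_ext z (dir_mult d h)) (poisson_ext z b) (poisson_ext z b)
      + 2 * quad_form (poisson_ext z h) (poisson_ext z h) (poisson_ext z (dir_mult d b)) (poisson_ext z (dir_mult d b))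
      + 8 * quad_form (poisson_ext z (dir_mult d h)) (poisson_ext z h) (poisson_ext z (dir_mult d b)) (poisson_ext z b))"
  define A where "A = (\<lambda>z. \<Sum>d\<in>dirs. energy (poisson_ext z (dir_mult d h)))"
  show iX: "set_integrable lborel {0..} (\<lambda>z. z * X d z)" if d: "d \<in> dirs" for d
    unfolding X_def
  proof (rule quad_laplace_integrable[OF h h b b h h rapid_dir_mult[OF b] rapid_dir_mult[OF b]])
    fix \<omega> :: "('a \<times> 'a) \<times> 'a"
    let ?u = "fst (fst \<omega>) - snd \<omega>" and ?v = "snd \<omega>"
    have "norm (dir_symbol d ?u) * norm (dir_symbol d ?v) \<le> sum4 \<omega> * sum4 \<omega>"
    proof (intro mult_mono)
      show "norm (dir_symbol d ?u) \<le> sum4 \<omega>"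
        by (rule order_trans[OF norm_dir_symbol_le[OF d]]) (simp add: sum4_def)
      show "norm (dir_symbol d ?v) \<le> sum4 \<omega>"
        by (rule order_trans[OF norm_dir_symbol_le[OF d]]) (simp add: sum4_def)
    qed (auto simp: sum4_nonneg)
    then have "(norm (dir_symbol d ?u) * norm (dir_symbol d ?v)) * norm (freq4 h h b b \<omega>) \<le> (sum4 \<omega> * sum4 \<omega>) * norm (freq4 h h b b \<omega>)"
      by (rule mult_right_mono) simp
    then show "norm (freq4 h h (dir_mult d b) (dir_mult d b) \<omega>) \<le> (sum4 \<omega>)\<^sup>2 * norm (freq4 h h b b \<omega>)"
      by (simp add: freq4_def dir_mult_def norm_mult power2_eq_square mult_ac)
  qed
  have iS: "set_integrable lborel {0..} (\<lambda>z. z * (\<Sum>d\<in>dirs. X d z))"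
    unfolding sum_distrib_left using iX by (intro set_integrable_finite_sum) auto
  have M0: "M \<ge> 0" using M[of 0 0] by simp
  have pw: "(\<Sum>d\<in>dirs. X d z) \<le> \<Theta> z + 16 * M\<^sup>2 * A z" if z: "z \<ge> 0" for z
  proof -
    have r: "rapid (poisson_ext z h)" "rapid (poisson_ext z b)" "rapid (poisson_ext z (dir_mult d h))" "rapid (poisson_ext z (dir_mult d b))" for d
      using z h b by (auto intro: rapid_poisson_ext rapid_dir_mult)
    have "X d z \<le> 2 * quad_form (poisson_ext z (dir_mult d h)) (poisson_ext z (dir_mult d h)) (poisson_ext z b) (poisson_ext z b) + 2 * X d z
        + 8 * quad_form (poisson_ext z (dir_mult d h)) (poisson_ext z h) (poisson_ext z (dir_mult d b)) (poisson_ext z b) + 16 * M\<^sup>2 * energy (poisson_ext z (dir_mult d h))" for d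
    proof -
      let ?H = "synth (poisson_ext z h)" and ?B = "synth (poisson_ext z b)" and ?Hd = "synth (poisson_ext z (dir_mult d h))" and ?Bd = "synth (poisson_ext z (dir_mult d b))"
      have i: "integrable lborel (\<lambda>x. ?H x * ?H x * ?Bd x * ?Bd x)" "integrable lborel (\<lambda>x. ?Hd x * ?Hd x * ?B x * ?B x)"
        "integrable lborel (\<lambda>x. ?Hd x * ?H x * ?Bd x * ?B x)" "integrable lborel (\<lambda>x. (?Hd x)\<^sup>2)"
        by (intro integrable_synth4 integrable_synth_sq r)+
      have p: "?H x * ?H x * ?Bd x * ?Bd x \<le> 2 * (?Hd x * ?Hd x * ?B x * ?B x) + 2 * (?H x * ?H x * ?Bd x * ?Bd x)
         + 8 * (?Hd x * ?H x * ?Bd x * ?B x) + 16 * M\<^sup>2 * (?Hd x)\<^sup>2" for x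
      proof -
        let ?p = "?H x * ?Bd x" and ?q = "?Hd x * ?B x"
        \<comment> \<open>The mixed term of the Laplacian has no sign. Completing the square absorbs
          it into one of the two available copies of \<open>p\<^sup>2\<close> and into
          \<open>16 * q\<^sup>2\<close>; the bound on the extension of \<open>b\<close> turns the
          latter into \<open>16 * M\<^sup>2\<close> times a squared derivative of \<open>h\<close>,
          and one copy of \<open>p\<^sup>2\<close> survives.\<close>
        have sq: "0 \<le> p\<^sup>2 + 8 * (p * q) + 16 * q\<^sup>2" for p q :: real
          using zero_le_power2[of "p + 4 * q"] by (simp add: power2_eq_square algebra_simps)
        have "?q\<^sup>2 \<le> M\<^sup>2 * (?Hd x)\<^sup>2"
        proof -
          have "(?B x)\<^sup>2 \<le> M\<^sup>2" using power_mono[OF M[OF z, of x] abs_ge_zero, of 2] by simp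
          then have "(?B x)\<^sup>2 * (?Hd x)\<^sup>2 \<le> M\<^sup>2 * (?Hd x)\<^sup>2" by (rule mult_right_mono) simp
          then show ?thesis by (simp only: power_mult_distrib mult.commute)
        qed
        moreover have "0 \<le> ?q\<^sup>2" by simp
        ultimately have "?p\<^sup>2 \<le> 2 * ?q\<^sup>2 + 2 * ?p\<^sup>2 + 8 * (?p * ?q) + 16 * (M\<^sup>2 * (?Hd x)\<^sup>2)"
          using sq[of ?p ?q] by linarith
        then show ?thesis by (simp add: power2_eq_square mult_ac)
      qed
      have "(LINT x|lborel. ?H x * ?H x * ?Bd x * ?Bd x) \<le> (LINT x|lborel. 2 * (?Hd x * ?Hd x * ?B x * ?B x) + 2 * (?H x * ?H x * ?Bd x * ?Bd x)
         + 8 * (?Hd x * ?H x * ?Bd x * ?B x) + 16 * M\<^sup>2 * (?Hd x)\<^sup>2)"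
        by (intro integral_mono i integrable_mult_right Bochner_Integration.integrable_add p)
      also have "\<dots> = 2 * (LINT x|lborel. ?Hd x * ?Hd x * ?B x * ?B x) + 2 * (LINT x|lborel. ?H x * ?H x * ?Bd x * ?Bd x)
         + 8 * (LINT x|lborel. ?Hd x * ?H x * ?Bd x * ?B x) + 16 * M\<^sup>2 * (LINT x|lborel. (?Hd x)\<^sup>2)"
        using i by (simp add: integrable_mult_right del: mult.assoc)
      finally show ?thesis unfolding X_def quad_form_def energy_def .
    qed
    then have "(\<Sum>d\<in>dirs. X d z) \<le> (\<Sum>d\<in>dirs. 2 * quad_form (poisson_ext z (dir_mult d h)) (poisson_ext z (dir_mult d h)) (poisson_ext z b) (poisson_ext z b) + 2 * X d z
        + 8 * quad_form (poisson_ext z (dir_mult d h)) (poisson_ext z h) (poisson_ext z (dir_mult d b)) (poisson_ext z b) + 16 * M\<^sup>2 * energy (poisson_ext z (dir_mult d h)))"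
      by (intro sum_mono)
    also have "\<dots> = \<Theta> z + 16 * M\<^sup>2 * A z"
      unfolding \<Theta>_def A_def X_def by (simp add: sum.distrib sum_distrib_left)
    finally show ?thesis .
  qed
  have iT: "set_integrable lborel {0..} (\<lambda>z. z * \<Theta> z)" and T: "(LINT z:{0..}|lborel. z * \<Theta> z) = quad_form h h b b"
    unfolding \<Theta>_def by (rule quad_form_identity[OF h b])+
  have iA: "set_integrable lborel {0..} (\<lambda>z. z * A z)" and A: "(LINT z:{0..}|lborel. z * A z) = energy h / 2"
    unfolding A_def by (rule square_function[OF h])+
  have iA': "set_integrable lborel {0..} (\<lambda>z. 16 * M\<^sup>2 * (z * A z))"
    using iA by (rule set_integrable_mult_right)
  have "(LINT z:{0..}|lborel. z * (\<Sum>d\<in>dirs. X d z)) \<le> (LINT z:{0..}|lborel. z * \<Theta> z + 16 * M\<^sup>2 * (z * A z))"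
  proof (rule set_integral_mono_Ici[OF iS set_integral_add(1)[OF iT iA']])
    fix z :: real assume "z \<ge> 0"
    then show "z * (\<Sum>d\<in>dirs. X d z) \<le> z * \<Theta> z + 16 * M\<^sup>2 * (z * A z)"
      using mult_left_mono[OF pw] by (fastforce simp: algebra_simps)
  qed
  also have "\<dots> = quad_form h h b b + 16 * M\<^sup>2 * (energy h / 2)"
    by (simp only: set_integral_add(2)[OF iT iA'] T set_integral_mult_right A)
  also have "quad_form h h b b \<le> M\<^sup>2 * energy h"
  proof -
    have "quad_form h h b b \<le> (LINT x|lborel. M\<^sup>2 * (synth h x)\<^sup>2)"
      unfolding quad_form_def
    proof (intro integral_mono integrable_synth4 h b integrable_mult_right integrable_synth_sq)
      fix x
      have "(synth b x)\<^sup>2 \<le> M\<^sup>2" using power_mono[OF M[of 0 x] abs_ge_zero, of 2] by simp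
      then show "synth h x * synth h x * synth b x * synth b x \<le> M\<^sup>2 * (synth h x)\<^sup>2"
        using mult_right_mono[of "(synth b x)\<^sup>2" "M\<^sup>2" "(synth h x)\<^sup>2"] by (simp add: power2_eq_square mult_ac)
    qed
    then show ?thesis by (simp add: energy_def)
  qed
  finally show "(LINT z:{0..}|lborel. z * (\<Sum>d\<in>dirs. X d z)) \<le> 9 * M\<^sup>2 * energy h" by (simp add: mult_ac)
qed

section \<open>The product commutator\<close>

lemma weighted_am_gm:
  fixes \<mu> p c :: real
  assumes "\<mu> > 0" shows "2 * \<bar>p * c\<bar> \<le> \<mu> * p\<^sup>2 + c\<^sup>2 / \<mu>"
proof -
  have "\<mu> * (2 * \<bar>p * c\<bar>) = 2 * (\<mu> * \<bar>p\<bar>) * \<bar>c\<bar>" by (simp add: abs_mult)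
  also have "\<dots> \<le> (\<mu> * \<bar>p\<bar>)\<^sup>2 + \<bar>c\<bar>\<^sup>2" by (rule sum_squares_bound)
  also have "\<dots> = \<mu> * (\<mu> * p\<^sup>2 + c\<^sup>2 / \<mu>)"
    using assms by (simp add: power_mult_distrib distrib_left power2_eq_square)
  finally show ?thesis using assms by simp
qed

text \<open>Cauchy-Schwarz in its additive form: the parameter \<open>\<mu>\<close> stays free so
  that one of the two resulting energies can later be made small enough to be absorbed.\<close>

lemma abs_tri_form_le:
  assumes a: "rapid a" and b: "rapid b" and c: "rapid c" and \<mu>: "\<mu> > 0"
  shows "\<bar>tri_form a b c\<bar> \<le> (\<mu> * quad_form a a b b + energy c / \<mu>) / 2"
proof -
  let ?A = "synth a" and ?B = "synth b" and ?C = "synth c"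
  have i: "integrable lborel (\<lambda>x. ?A x * ?A x * ?B x * ?B x)" "integrable lborel (\<lambda>x. (?C x)\<^sup>2)"
    by (intro integrable_synth4 integrable_synth_sq a b c)+
  have "\<bar>tri_form a b c\<bar> \<le> (LINT x|lborel. (\<mu> * (?A x * ?A x * ?B x * ?B x) + (?C x)\<^sup>2 / \<mu>) / 2)"
    unfolding tri_form_def real_norm_def[symmetric]
  proof (rule Bochner_Integration.integral_norm_bound_integral)
    show "integrable lborel (\<lambda>x. ?A x * ?B x * ?C x)" by (rule integrable_synth3) fact+
    show "integrable lborel (\<lambda>x. (\<mu> * (?A x * ?A x * ?B x * ?B x) + (?C x)\<^sup>2 / \<mu>) / 2)"
      using i by auto
    fix x
    let ?p = "?A x * ?B x"
    have "2 * \<bar>?p * ?C x\<bar> \<le> \<mu> * ?p\<^sup>2 + (?C x)\<^sup>2 / \<mu>" by (rule weighted_am_gm[OF \<mu>])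
    then show "norm (?p * ?C x) \<le> (\<mu> * (?A x * ?A x * ?B x * ?B x) + (?C x)\<^sup>2 / \<mu>) / 2"
      by (simp add: power2_eq_square mult_ac)
  qed
  also have "\<dots> = (\<mu> * quad_form a a b b + energy c / \<mu>) / 2"
    using i unfolding quad_form_def energy_def by simp
  finally show ?thesis .
qed

lemma quad_form_square_nonneg: "quad_form a a b b \<ge> 0"
proof -
  have "synth a x * synth a x * synth b x * synth b x = (synth a x * synth b x)\<^sup>2" for x
    by (simp add: power2_eq_square)
  then show ?thesis unfolding quad_form_def by simp
qed

text \<open>The bounded factor \<open>g\<close> enters only through the Carleson integral, for which
  \<open>a\<close> must be undifferentiated; the derivative on \<open>c\<close> is paid for by the
  square function. These two bounds supply the 9 and the 1/2.\<close>

lemma weighted_form_bound: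
  fixes a g c :: "'a::euclidean_space \<Rightarrow> complex"
  assumes a: "rapid a" and g: "rapid g" and c: "rapid c"
    and M: "\<And>z x. z \<ge> 0 \<Longrightarrow> \<bar>synth (poisson_ext z g) x\<bar> \<le> M" and \<mu>: "\<mu> > 0"
    and d: "d \<in> dirs" "d' \<in> dirs"
    and i: "set_integrable lborel {0..} (\<lambda>z. z * tri_form (poisson_ext z a) (poisson_ext z (dir_mult d g)) (poisson_ext z (dir_mult d' c)))"
  shows "\<bar>LINT z:{0..}|lborel. z * tri_form (poisson_ext z a) (poisson_ext z (dir_mult d g)) (poisson_ext z (dir_mult d' c))\<bar>
    \<le> (\<mu> * (9 * M\<^sup>2 * energy a) + (energy c / 2) / \<mu>) / 2"
proof -
  let ?X = "\<lambda>d z. quad_form (poisson_ext z a) (poisson_ext z a) (poisson_ext z (dir_mult d g)) (poisson_ext z (dir_mult d g))"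
  let ?E = "\<lambda>d z. energy (poisson_ext z (dir_mult d c))"
  note X = carleson_embedding[OF a g M]
  note E = square_function[OF c]
  have iX: "set_integrable lborel {0..} (\<lambda>z. z * ?X d z)" using X(1) d by auto
  have iXs: "set_integrable lborel {0..} (\<lambda>z. z * (\<Sum>d\<in>dirs. ?X d z))"
    unfolding sum_distrib_left using X(1) by (intro set_integrable_finite_sum) auto
  have Xb: "(LINT z:{0..}|lborel. z * ?X d z) \<le> 9 * M\<^sup>2 * energy a"
  proof -
    have "(LINT z:{0..}|lborel. z * ?X d z) \<le> (LINT z:{0..}|lborel. z * (\<Sum>d\<in>dirs. ?X d z))"
      by (rule set_integral_mono_Ici[OF iX iXs])
         (intro mult_left_mono member_le_sum d finite_dirs quad_form_square_nonneg)
    then show ?thesis using X(2) by linarith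
  qed
  have iE: "set_integrable lborel {0..} (\<lambda>z. z * ?E d' z)" using E(1) d by auto
  have Eb: "(LINT z:{0..}|lborel. z * ?E d' z) \<le> energy c / 2"
  proof -
    have "(LINT z:{0..}|lborel. z * ?E d' z) \<le> (LINT z:{0..}|lborel. z * (\<Sum>d\<in>dirs. ?E d z))"
      by (rule set_integral_mono_Ici[OF iE E(2)])
         (intro mult_left_mono member_le_sum d finite_dirs energy_nonneg)
    then show ?thesis using E(3) by linarith
  qed
  let ?R = "\<lambda>z. \<mu> / 2 * (z * ?X d z) + 1 / (2 * \<mu>) * (z * ?E d' z)"
  have i1: "set_integrable lborel {0..} (\<lambda>z. \<mu> / 2 * (z * ?X d z))"
    using iX by (rule set_integrable_mult_right)
  have i2: "set_integrable lborel {0..} (\<lambda>z. 1 / (2 * \<mu>) * (z * ?E d' z))"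
    using iE by (rule set_integrable_mult_right)
  have iR: "set_integrable lborel {0..} ?R" by (rule set_integral_add(1)[OF i1 i2])
  let ?K = "\<lambda>z. z * tri_form (poisson_ext z a) (poisson_ext z (dir_mult d g)) (poisson_ext z (dir_mult d' c))"
  have pw: "\<bar>?K z\<bar> \<le> ?R z" if z: "z \<ge> 0" for z
  proof -
    have "\<bar>?K z\<bar> = z * \<bar>tri_form (poisson_ext z a) (poisson_ext z (dir_mult d g)) (poisson_ext z (dir_mult d' c))\<bar>" using z by (simp add: abs_mult)
    also have "\<dots> \<le> z * ((\<mu> * ?X d z + ?E d' z / \<mu>) / 2)"
      using z a g c \<mu> by (intro mult_left_mono abs_tri_form_le) (auto intro: rapid_poisson_ext rapid_dir_mult)
    also have "\<dots> = ?R z" using \<mu> by (simp add: field_simps)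
    finally show ?thesis .
  qed
  have "(LINT z:{0..}|lborel. ?K z) \<le> (LINT z:{0..}|lborel. ?R z)"
    using pw by (intro set_integral_mono_Ici i iR) (auto simp: abs_le_iff)
  moreover have "(LINT z:{0..}|lborel. - ?K z) \<le> (LINT z:{0..}|lborel. ?R z)"
    using pw i iR by (intro set_integral_mono_Ici) (auto simp: abs_le_iff set_integrable_def)
  moreover have "(LINT z:{0..}|lborel. - ?K z) = - (LINT z:{0..}|lborel. ?K z)"
    by (simp add: set_lebesgue_integral_def)
  ultimately have "\<bar>LINT z:{0..}|lborel. ?K z\<bar> \<le> (LINT z:{0..}|lborel. ?R z)" by linarith
  also have "\<dots> = \<mu> / 2 * (LINT z:{0..}|lborel. z * ?X d z) + 1 / (2 * \<mu>) * (LINT z:{0..}|lborel. z * ?E d' z)"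
    by (simp only: set_integral_add(2)[OF i1 i2] set_integral_mult_right)
  also have "\<dots> \<le> \<mu> / 2 * (9 * M\<^sup>2 * energy a) + 1 / (2 * \<mu>) * (energy c / 2)"
    using \<mu> Xb Eb by (intro add_mono mult_left_mono) auto
  also have "\<dots> = (\<mu> * (9 * M\<^sup>2 * energy a) + (energy c / 2) / \<mu>) / 2"
    using \<mu> by (simp add: field_simps)
  finally show ?thesis .
qed

text \<open>By Plancherel, since no direction has a symbol larger than |\<xi>|: a first derivative
  of \<open>f\<close> costs at most the norm of \<Lambda>f.\<close>

lemma energy_dir_mult_le:
  assumes d: "d \<in> dirs" and f: "rapid f"
  shows "energy (dir_mult d f) \<le> energy (dir_mult None f)"
proof -
  have i: "integrable lborel (\<lambda>\<xi>. (norm (dir_mult d f \<xi>))\<^sup>2)" for d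
    using integrable_norm_sq_rapid[OF rapid_dir_mult[OF f], of d] complex_of_real_integrable_eq by blast
  have "(LINT \<xi>|lborel. (norm (dir_mult d f \<xi>))\<^sup>2) \<le> (LINT \<xi>|lborel. (norm (dir_mult None f \<xi>))\<^sup>2)"
    using norm_dir_symbol_le[OF d] by (intro integral_mono i power_mono) (auto simp: dir_mult_def norm_mult intro!: mult_right_mono)
  then show ?thesis
    unfolding energy_def integral_synth_sq[OF rapid_dir_mult[OF f]] by (intro divide_right_mono) auto
qed

text \<open>The first identity is what keeps \<open>g\<close>, at frequency \<beta>, from being
  differentiated twice: on the left every term is of first order in \<beta>, while on the right
  \<open>norm \<beta> * P \<alpha> \<beta>\<close> is of second order. The second identity is a
  difference of squares, as the squared norm of \<gamma> is that of \<alpha> + \<beta>.\<close>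

lemma sum_zero_symbol_identities:
  fixes \<alpha> \<beta> \<gamma> :: "'a::real_inner"
  assumes "\<alpha> + \<beta> + \<gamma> = 0"
  defines "P \<equiv> \<lambda>x y. norm x * norm y - x \<bullet> (y::'a)" and "S \<equiv> norm \<alpha> + norm \<beta> + norm \<gamma>"
  shows "P \<alpha> \<beta> * norm \<gamma> + 2 * (norm \<alpha> * P \<alpha> \<beta>) + norm \<alpha> * P \<beta> \<gamma> - norm \<beta> * P \<alpha> \<gamma> = P \<alpha> \<beta> * S"
    and "(norm \<gamma> - norm \<alpha> - norm \<beta>) * S = - 2 * P \<alpha> \<beta>"
proof -
  have g: "\<gamma> = - (\<alpha> + \<beta>)" using assms(1) by (simp only: eq_neg_iff_add_eq_0 add_ac)
  have n: "norm \<gamma> * norm \<gamma> = norm \<alpha> * norm \<alpha> + 2 * (\<alpha> \<bullet> \<beta>) + norm \<beta> * norm \<beta>"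
    unfolding g norm_minus_cancel power2_eq_square[symmetric] power2_norm_eq_inner
    by (simp add: inner_add_left inner_add_right inner_commute)
  have bg: "\<beta> \<bullet> \<gamma> = - (\<alpha> \<bullet> \<beta>) - norm \<beta> * norm \<beta>" and ag: "\<alpha> \<bullet> \<gamma> = - (\<alpha> \<bullet> \<beta>) - norm \<alpha> * norm \<alpha>"
    unfolding g power2_eq_square[symmetric] power2_norm_eq_inner by (simp_all add: inner_diff_right inner_commute)
  show "P \<alpha> \<beta> * norm \<gamma> + 2 * (norm \<alpha> * P \<alpha> \<beta>) + norm \<alpha> * P \<beta> \<gamma> - norm \<beta> * P \<alpha> \<gamma> = P \<alpha> \<beta> * S"
    unfolding P_def S_def bg ag by (simp add: algebra_simps)
  show "(norm \<gamma> - norm \<alpha> - norm \<beta>) * S = - 2 * P \<alpha> \<beta>"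
    using n unfolding P_def S_def by (simp add: algebra_simps)
qed

text \<open>\<open>T1\<close> to \<open>T4\<close> realise the four terms on the left of the first
  symbol identity, summed over the directions. Their combination has symbol
  \<open>P \<alpha> \<beta> * S\<close>; the weight \<open>z\<close> divides it by
  \<open>S\<^sup>2\<close>, and by the second identity the factor -2 makes it the symbol of the
  commutator.\<close>

lemma commutator_form_identity:
  fixes f g h :: "'a::euclidean_space \<Rightarrow> complex"
  assumes f: "rapid f" and g: "rapid g" and h: "rapid h"
  defines "T1 \<equiv> \<lambda>d z. z * tri_form (poisson_ext z (dir_mult d f)) (poisson_ext z (dir_mult d g)) (poisson_ext z (dir_mult None h))"
    and "T2 \<equiv> \<lambda>d z. z * tri_form (poisson_ext z (dir_mult d (dir_mult None f))) (poisson_ext z (dir_mult d g)) (poisson_ext z h)"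
    and "T3 \<equiv> \<lambda>d z. z * tri_form (poisson_ext z (dir_mult None f)) (poisson_ext z (dir_mult d g)) (poisson_ext z (dir_mult d h))"
    and "T4 \<equiv> \<lambda>d z. z * tri_form (poisson_ext z (dir_mult d f)) (poisson_ext z (dir_mult None g)) (poisson_ext z (dir_mult d h))"
  shows "d \<in> dirs \<Longrightarrow> set_integrable lborel {0..} (T1 d)" "d \<in> dirs \<Longrightarrow> set_integrable lborel {0..} (T2 d)"
    "d \<in> dirs \<Longrightarrow> set_integrable lborel {0..} (T3 d)" "d \<in> dirs \<Longrightarrow> set_integrable lborel {0..} (T4 d)"
    and "tri_form f g (dir_mult None h) - tri_form f (dir_mult None g) h - tri_form (dir_mult None f) g h
      = - 2 * (\<Sum>d\<in>dirs. (LINT z:{0..}|lborel. T1 d z) + 2 * (LINT z:{0..}|lborel. T2 d z)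
           + (LINT z:{0..}|lborel. T3 d z) - (LINT z:{0..}|lborel. T4 d z))"
proof -
  let ?M = "lborel \<Otimes>\<^sub>M lborel :: ('a \<times> 'a) measure"
  let ?K = "complex_of_real (((2 * pi) ^ DIM('a))\<^sup>2)"
  note r = f g h rapid_dir_mult[OF f] rapid_dir_mult[OF g] rapid_dir_mult[OF h] rapid_dir_mult[OF rapid_dir_mult[OF f]]
  have le: "norm (dir_symbol d (fst \<omega> - snd \<omega>)) \<le> sum3 \<omega>" "norm (dir_symbol d (snd \<omega>)) \<le> sum3 \<omega>" "norm (dir_symbol d (fst \<omega>)) \<le> sum3 \<omega>"
    if "d \<in> dirs" for d and \<omega> :: "'a \<times> 'a"
    by (rule order_trans[OF norm_dir_symbol_le[OF that]]; simp add: sum3_def)+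
  have bnd: "norm (a * b) * norm p \<le> (sum3 \<omega>)\<^sup>2 * norm p"
    if "norm a \<le> sum3 \<omega>" "norm b \<le> sum3 \<omega>" for a b p :: complex and \<omega> :: "'a \<times> 'a"
    using mult_mono[OF that] by (intro mult_right_mono) (auto simp: norm_mult power2_eq_square sum3_nonneg)
  \<comment> \<open>One derivative of \<open>f\<close> stays inside \<open>v\<close>, so that only
    the other two of the three are charged to the square of \<open>sum3\<close>.\<close>
  have b1: "norm (freq3 v (dir_mult d g) (dir_mult d' h) \<omega>) \<le> (sum3 \<omega>)\<^sup>2 * norm (freq3 v g h \<omega>)"
    if d: "d \<in> dirs" "d' \<in> dirs" for v d d' and \<omega> :: "'a \<times> 'a"
    using bnd[OF le(2)[OF d(1), of \<omega>] le(3)[OF d(2), of \<omega>], of "freq3 v g h \<omega>"]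
    by (simp add: freq3_def dir_mult_def norm_mult mult_ac)
  have b2: "norm (freq3 (dir_mult d v) (dir_mult d' g) h \<omega>) \<le> (sum3 \<omega>)\<^sup>2 * norm (freq3 v g h \<omega>)"
    if d: "d \<in> dirs" "d' \<in> dirs" for v d d' and \<omega> :: "'a \<times> 'a"
    using bnd[OF le(1)[OF d(1), of \<omega>] le(2)[OF d(2), of \<omega>], of "freq3 v g h \<omega>"]
    by (simp add: freq3_def dir_mult_def norm_mult mult_ac)
  note L1 = tri_laplace[OF r(4) r(2) r(3) r(4) r(5) r(6) b1]
    and L2 = tri_laplace[OF r(4) r(2) r(3) r(7) r(5) r(3) b2]
  show i: "d \<in> dirs \<Longrightarrow> set_integrable lborel {0..} (T1 d)" "d \<in> dirs \<Longrightarrow> set_integrable lborel {0..} (T2 d)"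
    "d \<in> dirs \<Longrightarrow> set_integrable lborel {0..} (T3 d)" "d \<in> dirs \<Longrightarrow> set_integrable lborel {0..} (T4 d)"
    unfolding T1_def T2_def T3_def T4_def by (auto intro!: L1(1) L2(1))
  let ?F1 = "\<lambda>d \<omega>. freq3 (dir_mult d f) (dir_mult d g) (dir_mult None h) \<omega> / of_real ((sum3 \<omega>)\<^sup>2)"
    and ?F2 = "\<lambda>d \<omega>. freq3 (dir_mult d (dir_mult None f)) (dir_mult d g) h \<omega> / of_real ((sum3 \<omega>)\<^sup>2)"
    and ?F3 = "\<lambda>d \<omega>. freq3 (dir_mult None f) (dir_mult d g) (dir_mult d h) \<omega> / of_real ((sum3 \<omega>)\<^sup>2)"
    and ?F4 = "\<lambda>d \<omega>. freq3 (dir_mult d f) (dir_mult None g) (dir_mult d h) \<omega> / of_real ((sum3 \<omega>)\<^sup>2)"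
  have iF: "integrable ?M (?F1 d)" "integrable ?M (?F2 d)" "integrable ?M (?F3 d)" "integrable ?M (?F4 d)"
    if "d \<in> dirs" for d by (intro L1(2) L2(2) that None_in_dirs)+
  have eF: "of_real (LINT z:{0..}|lborel. T1 d z) = integral\<^sup>L ?M (?F1 d) / ?K"
     "of_real (LINT z:{0..}|lborel. T2 d z) = integral\<^sup>L ?M (?F2 d) / ?K"
     "of_real (LINT z:{0..}|lborel. T3 d z) = integral\<^sup>L ?M (?F3 d) / ?K"
     "of_real (LINT z:{0..}|lborel. T4 d z) = integral\<^sup>L ?M (?F4 d) / ?K"
    if "d \<in> dirs" for d
    unfolding T1_def T2_def T3_def T4_def using that
      L1(3)[of d None d] L2(3)[of d d None] L1(3)[of d d None] L1(3)[of None d d] by simp_all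
  let ?J = "\<lambda>\<omega>. \<Sum>d\<in>dirs. ?F1 d \<omega> + 2 * ?F2 d \<omega> + ?F3 d \<omega> - ?F4 d \<omega>"
  have it: "integrable ?M (\<lambda>\<omega>. ?F1 d \<omega> + 2 * ?F2 d \<omega> + ?F3 d \<omega> - ?F4 d \<omega>)" if "d \<in> dirs" for d
    by (intro Bochner_Integration.integrable_diff Bochner_Integration.integrable_add integrable_mult_right iF that)
  have iJ: "integrable ?M ?J" by (intro Bochner_Integration.integrable_sum it)
  have lin: "(LINT \<omega>|?M. p \<omega> + 2 * q \<omega> + r \<omega> - s \<omega>) = integral\<^sup>L ?M p + 2 * integral\<^sup>L ?M q + integral\<^sup>L ?M r - integral\<^sup>L ?M s"
    if "integrable ?M p" "integrable ?M q" "integrable ?M r" "integrable ?M s" for p q r s :: "'a \<times> 'a \<Rightarrow> complex"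
    using that by simp
  have "complex_of_real (\<Sum>d\<in>dirs. (LINT z:{0..}|lborel. T1 d z) + 2 * (LINT z:{0..}|lborel. T2 d z)
           + (LINT z:{0..}|lborel. T3 d z) - (LINT z:{0..}|lborel. T4 d z))
     = (\<Sum>d\<in>dirs. (LINT \<omega>|?M. ?F1 d \<omega> + 2 * ?F2 d \<omega> + ?F3 d \<omega> - ?F4 d \<omega>) / ?K)"
    unfolding of_real_sum
  proof (rule sum.cong[OF refl])
    fix d :: "'a option" assume d: "d \<in> dirs"
    have "(LINT \<omega>|?M. ?F1 d \<omega> + 2 * ?F2 d \<omega> + ?F3 d \<omega> - ?F4 d \<omega>)
      = integral\<^sup>L ?M (?F1 d) + 2 * integral\<^sup>L ?M (?F2 d) + integral\<^sup>L ?M (?F3 d) - integral\<^sup>L ?M (?F4 d)"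
      by (rule lin[OF iF[OF d]])
    then show "of_real ((LINT z:{0..}|lborel. T1 d z) + 2 * (LINT z:{0..}|lborel. T2 d z)
           + (LINT z:{0..}|lborel. T3 d z) - (LINT z:{0..}|lborel. T4 d z))
      = (LINT \<omega>|?M. ?F1 d \<omega> + 2 * ?F2 d \<omega> + ?F3 d \<omega> - ?F4 d \<omega>) / ?K"
      unfolding of_real_add of_real_diff of_real_mult eF[OF d]
      by (simp add: add_divide_distrib diff_divide_distrib)
  qed
  also have "\<dots> = integral\<^sup>L ?M ?J / ?K"
    by (subst Bochner_Integration.integral_sum) (simp_all only: it sum_divide_distrib)
  finally have RHS: "complex_of_real (\<Sum>d\<in>dirs. (LINT z:{0..}|lborel. T1 d z) + 2 * (LINT z:{0..}|lborel. T2 d z)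
           + (LINT z:{0..}|lborel. T3 d z) - (LINT z:{0..}|lborel. T4 d z)) = integral\<^sup>L ?M ?J / ?K" .
  let ?L = "\<lambda>\<omega>. freq3 f g (dir_mult None h) \<omega> - freq3 f (dir_mult None g) h \<omega> - freq3 (dir_mult None f) g h \<omega>"
  note iL = integrable_freq3[OF f g r(6)[of None]] integrable_freq3[OF f r(5)[of None] h] integrable_freq3[OF r(4)[of None] g h]
  have LHS: "complex_of_real (tri_form f g (dir_mult None h) - tri_form f (dir_mult None g) h - tri_form (dir_mult None f) g h) = integral\<^sup>L ?M ?L / ?K"
    unfolding of_real_diff integral_freq3[OF f g r(6)] integral_freq3[OF f r(5) h] integral_freq3[OF r(4) g h]
    using iL by (simp add: diff_divide_distrib)
  have "integral\<^sup>L ?M ?L = (LINT \<omega>|?M. - 2 * ?J \<omega>)"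
  proof (rule integral_cong_AE)
    show "?L \<in> borel_measurable ?M" using iL by auto
    show "(\<lambda>\<omega>. - 2 * ?J \<omega>) \<in> borel_measurable ?M" using iJ by (intro borel_measurable_integrable integrable_mult_right)
    show "AE \<omega> in ?M. ?L \<omega> = - 2 * ?J \<omega>"
      using AE_sum3
    proof eventually_elim
      fix \<omega> :: "'a \<times> 'a" assume S0: "sum3 \<omega> \<noteq> 0"
      obtain \<xi> \<eta> where \<omega>: "\<omega> = (\<xi>, \<eta>)" by (metis surj_pair)
      let ?\<alpha> = "\<xi> - \<eta>" and ?\<beta> = \<eta> and ?\<gamma> = "- \<xi>"
      let ?P = "\<lambda>x y::'a. norm x * norm y - x \<bullet> y"
      let ?\<Phi> = "freq3 f g h \<omega>"
      let ?s = "complex_of_real (sum3 \<omega>)"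
      let ?n = "\<lambda>x::'a. complex_of_real (norm x)"
      let ?N = "\<lambda>d. dir_symbol d ?\<alpha> * dir_symbol d ?\<beta> * ?n ?\<gamma> + 2 * (?n ?\<alpha> * (dir_symbol d ?\<alpha> * dir_symbol d ?\<beta>))
         + ?n ?\<alpha> * (dir_symbol d ?\<beta> * dir_symbol d ?\<gamma>) - ?n ?\<beta> * (dir_symbol d ?\<alpha> * dir_symbol d ?\<gamma>)"
      have "?F1 d \<omega> + 2 * ?F2 d \<omega> + ?F3 d \<omega> - ?F4 d \<omega> = ?N d * (?\<Phi> / ?s\<^sup>2)" for d
        unfolding \<omega> freq3_def dir_mult_def fst_conv snd_conv complex_cnj_mult dir_symbol_uminus[symmetric] dir_symbol.simps
        by (simp add: algebra_simps add_divide_distrib diff_divide_distrib)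
      then have J: "?J \<omega> = (\<Sum>d\<in>dirs. ?N d) * (?\<Phi> / ?s\<^sup>2)" by (simp only: sum_distrib_right)
      have "(\<Sum>d\<in>dirs. ?N d) = (\<Sum>d\<in>dirs. dir_symbol d ?\<alpha> * dir_symbol d ?\<beta>) * ?n ?\<gamma> + 2 * (?n ?\<alpha> * (\<Sum>d\<in>dirs. dir_symbol d ?\<alpha> * dir_symbol d ?\<beta>))
         + ?n ?\<alpha> * (\<Sum>d\<in>dirs. dir_symbol d ?\<beta> * dir_symbol d ?\<gamma>) - ?n ?\<beta> * (\<Sum>d\<in>dirs. dir_symbol d ?\<alpha> * dir_symbol d ?\<gamma>)"
        by (simp only: sum.distrib sum_subtractf sum_distrib_left sum_distrib_right)
      also have "\<dots> = of_real (?P ?\<alpha> ?\<beta> * norm ?\<gamma> + 2 * (norm ?\<alpha> * ?P ?\<alpha> ?\<beta>) + norm ?\<alpha> * ?P ?\<beta> ?\<gamma> - norm ?\<beta> * ?P ?\<alpha> ?\<gamma>)"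
        unfolding sum_dir_symbol by simp
      also have "\<dots> = of_real (?P ?\<alpha> ?\<beta> * sum3 \<omega>)"
        using sum_zero_symbol_identities(1)[of ?\<alpha> ?\<beta> ?\<gamma>] unfolding \<omega> by (simp add: sum3_def)
      finally have N: "(\<Sum>d\<in>dirs. ?N d) = of_real (?P ?\<alpha> ?\<beta> * sum3 \<omega>)" .
      have m: "(norm ?\<gamma> - norm ?\<alpha> - norm ?\<beta>) * sum3 \<omega> = - 2 * ?P ?\<alpha> ?\<beta>"
        using sum_zero_symbol_identities(2)[of ?\<alpha> ?\<beta> ?\<gamma>] unfolding \<omega> by (simp add: sum3_def)
      have "?L \<omega> = of_real (norm ?\<gamma> - norm ?\<alpha> - norm ?\<beta>) * ?\<Phi>"
        unfolding \<omega> freq3_def dir_mult_def by (simp add: algebra_simps)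
      also have "of_real (norm ?\<gamma> - norm ?\<alpha> - norm ?\<beta>) = complex_of_real (- 2 * ?P ?\<alpha> ?\<beta> / sum3 \<omega>)"
        unfolding m[symmetric] using S0 by simp
      also have "\<dots> * ?\<Phi> = - 2 * ?J \<omega>"
      proof -
        have "complex_of_real (- 2 * p / s) * \<Phi> = - 2 * (of_real (p * s) * (\<Phi> / (of_real s)\<^sup>2))"
          if "s \<noteq> 0" for p s \<Phi> using that by (simp add: power2_eq_square)
        from this[OF S0] show ?thesis unfolding J N .
      qed
      finally show "?L \<omega> = - 2 * ?J \<omega>" .
    qed
  qed
  then have "complex_of_real (tri_form f g (dir_mult None h) - tri_form f (dir_mult None g) h - tri_form (dir_mult None f) g h) = - 2 * (integral\<^sup>L ?M ?J / ?K)"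
    unfolding LHS by simp
  then have "complex_of_real (tri_form f g (dir_mult None h) - tri_form f (dir_mult None g) h - tri_form (dir_mult None f) g h) =
     complex_of_real (- 2 * (\<Sum>d\<in>dirs. (LINT z:{0..}|lborel. T1 d z) + 2 * (LINT z:{0..}|lborel. T2 d z)
           + (LINT z:{0..}|lborel. T3 d z) - (LINT z:{0..}|lborel. T4 d z)))"
    unfolding RHS[symmetric] by (simp only: of_real_mult of_real_minus of_real_numeral)
  then show "tri_form f g (dir_mult None h) - tri_form f (dir_mult None g) h - tri_form (dir_mult None f) g h
      = - 2 * (\<Sum>d\<in>dirs. (LINT z:{0..}|lborel. T1 d z) + 2 * (LINT z:{0..}|lborel. T2 d z)
           + (LINT z:{0..}|lborel. T3 d z) - (LINT z:{0..}|lborel. T4 d z))"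
    using of_real_eq_iff by blast
qed


text \<open>Duality with the commutator as its own test function: its energy equals the trilinear
  form at \<open>h = c\<close>, and it reappears on the right with a factor 1/2, which can be
  absorbed because the energy is finite.\<close>

theorem product_commutator_bound:
  fixes f g :: "'a::euclidean_space \<Rightarrow> complex" and M :: real
  assumes f: "rapid f" and g: "rapid g" and ig: "integrable lborel (synth g)"
    and bd: "\<And>x. \<bar>synth g x\<bar> \<le> M" and M: "M > 0"
  defines "c \<equiv> \<lambda>\<xi>. dir_mult None (conv f g) \<xi> - conv f (dir_mult None g) \<xi> - conv (dir_mult None f) g \<xi>"
  shows "rapid c" and "energy c \<le> (100 * (DIM('a) + 1))\<^sup>2 * M\<^sup>2 * energy (dir_mult None f)"
proof -
  have r: "rapid (dir_mult None (conv f g))" "rapid (conv f (dir_mult None g))" "rapid (conv (dir_mult None f) g)"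
    by (intro rapid_dir_mult rapid_conv f g)+
  show c: "rapid c" unfolding c_def by (intro rapid_diff r)
  have Mz: "\<bar>synth (poisson_ext z g) x\<bar> \<le> M" if "z \<ge> 0" for z x
    by (rule synth_poisson_ext_bounded[OF g ig bd that])
  have sc: "synth c x = synth (dir_mult None (conv f g)) x - synth (conv f (dir_mult None g)) x - synth (conv (dir_mult None f) g) x" for x
    unfolding c_def by (simp add: synth_diff rapid_diff r)
  let ?n = "real (DIM('a) + 1)"
  let ?A = "energy (dir_mult None f)" and ?Q = "energy c"
  \<comment> \<open>All terms together contribute \<open>50 * ?n * ?Q / \<kappa>\<close>; this
    choice makes that \<open>?Q / 2\<close>.\<close>
  define \<kappa> where "\<kappa> = 100 * ?n"
  have l: "\<kappa> > 0" by (simp add: \<kappa>_def)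
  \<comment> \<open>A common bound for the four kinds of terms; 5 rounds up the factor 9/2 that
    comes from the Carleson constant.\<close>
  let ?B = "5 * (\<kappa> * M\<^sup>2 * ?A + ?Q / \<kappa>)"
  have A0: "?A \<ge> 0" and Q0: "?Q \<ge> 0" by (rule energy_nonneg)+
  have Q: "?Q = tri_form f g (dir_mult None c) - tri_form f (dir_mult None g) c - tri_form (dir_mult None f) g c"
  proof -
    have i: "integrable lborel (\<lambda>x. synth (dir_mult None (conv f g)) x * synth c x)"
      "integrable lborel (\<lambda>x. synth (conv f (dir_mult None g)) x * synth c x)"
      "integrable lborel (\<lambda>x. synth (conv (dir_mult None f) g) x * synth c x)"
      by (intro integrable_synth_mult r c)+
    have "?Q = (LINT x|lborel. synth (dir_mult None (conv f g)) x * synth c x) - (LINT x|lborel. synth (conv f (dir_mult None g)) x * synth c x)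
       - (LINT x|lborel. synth (conv (dir_mult None f) g) x * synth c x)"
      unfolding energy_def power2_eq_square
      by (subst (1) sc) (simp add: left_diff_distrib i)
    moreover have "(LINT x|lborel. synth (conv f (dir_mult None g)) x * synth c x) = tri_form f (dir_mult None g) c"
      "(LINT x|lborel. synth (conv (dir_mult None f) g) x * synth c x) = tri_form (dir_mult None f) g c"
      by (simp_all add: tri_form_def synth_conv f g rapid_dir_mult)
    moreover have "(LINT x|lborel. synth (dir_mult None (conv f g)) x * synth c x) = tri_form f g (dir_mult None c)"
    proof -
      have "complex_of_real (LINT x|lborel. synth (dir_mult None (conv f g)) x * synth c x)
         = complex_of_real (LINT x|lborel. synth (conv f g) x * synth (dir_mult None c) x)"
        by (subst (1 2) integral_synth_mult) (auto intro!: rapid_dir_mult rapid_conv f g c simp: dir_mult_def mult_ac)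
      then have "(LINT x|lborel. synth (dir_mult None (conv f g)) x * synth c x) = (LINT x|lborel. synth (conv f g) x * synth (dir_mult None c) x)"
        using of_real_eq_iff by blast
      then show ?thesis by (simp add: tri_form_def synth_conv f g)
    qed
    ultimately show ?thesis by simp
  qed
  let ?T1 = "\<lambda>d z. z * tri_form (poisson_ext z (dir_mult d f)) (poisson_ext z (dir_mult d g)) (poisson_ext z (dir_mult None c))"
    and ?T2 = "\<lambda>d z. z * tri_form (poisson_ext z (dir_mult d (dir_mult None f))) (poisson_ext z (dir_mult d g)) (poisson_ext z c)"
    and ?T3 = "\<lambda>d z. z * tri_form (poisson_ext z (dir_mult None f)) (poisson_ext z (dir_mult d g)) (poisson_ext z (dir_mult d c))"
    and ?T4 = "\<lambda>d z. z * tri_form (poisson_ext z (dir_mult d f)) (poisson_ext z (dir_mult None g)) (poisson_ext z (dir_mult d c))"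
  note I = commutator_form_identity[OF f g c]
  have b1: "(\<kappa> * (9 * M\<^sup>2 * energy v) + (?Q / 2) / \<kappa>) / 2 \<le> ?B" if "energy v \<le> ?A" for v :: "'a \<Rightarrow> complex"
  proof -
    have "\<kappa> * M\<^sup>2 * energy v \<le> \<kappa> * M\<^sup>2 * ?A" using that l by (intro mult_left_mono) auto
    moreover have "0 \<le> \<kappa> * M\<^sup>2 * energy v" "0 \<le> ?Q / \<kappa>" using l Q0 energy_nonneg[of v] by auto
    ultimately show ?thesis by (simp add: mult_ac)
  qed
  \<comment> \<open>In the second kind of term the commutator takes the Carleson slot and \<Lambda>f
    the square function slot. The weight must be inverted, and scaled by \<open>M\<^sup>2\<close>,
    to leave the small factor on \<open>?Q\<close>; this is a use of \<open>M > 0\<close>.\<close>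
  have b2: "(1 / (\<kappa> * M\<^sup>2) * (9 * M\<^sup>2 * ?Q) + (?A / 2) / (1 / (\<kappa> * M\<^sup>2))) / 2 \<le> ?B"
  proof -
    have "1 / (\<kappa> * M\<^sup>2) * (9 * M\<^sup>2 * ?Q) = 9 * (?Q / \<kappa>)" using M l by (simp add: field_simps)
    moreover have "(?A / 2) / (1 / (\<kappa> * M\<^sup>2)) = (\<kappa> * M\<^sup>2 * ?A) / 2" by simp
    moreover have "0 \<le> \<kappa> * M\<^sup>2 * ?A" "0 \<le> ?Q / \<kappa>" using l Q0 A0 by auto
    ultimately show ?thesis by (simp add: mult_ac)
  qed
  have W: "\<bar>LINT z:{0..}|lborel. z * tri_form (poisson_ext z a) (poisson_ext z (dir_mult d g)) (poisson_ext z (dir_mult d' v))\<bar>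
      \<le> (\<mu> * (9 * M\<^sup>2 * energy a) + (energy v / 2) / \<mu>) / 2"
    if "rapid a" "rapid v" "\<mu> > 0" "d \<in> dirs" "d' \<in> dirs"
      "set_integrable lborel {0..} (\<lambda>z. z * tri_form (poisson_ext z a) (poisson_ext z (dir_mult d g)) (poisson_ext z (dir_mult d' v)))" for a v \<mu> d d'
    by (rule weighted_form_bound[OF that(1) g that(2) _ that(3-6)]) (rule Mz)
  have T: "\<bar>LINT z:{0..}|lborel. ?T1 d z\<bar> \<le> ?B" "\<bar>LINT z:{0..}|lborel. ?T2 d z\<bar> \<le> ?B"
    "\<bar>LINT z:{0..}|lborel. ?T3 d z\<bar> \<le> ?B" "\<bar>LINT z:{0..}|lborel. ?T4 d z\<bar> \<le> ?B" if d: "d \<in> dirs" for d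
  proof -
    show "\<bar>LINT z:{0..}|lborel. ?T1 d z\<bar> \<le> ?B"
      by (rule order_trans[OF W[OF rapid_dir_mult[OF f] c l d None_in_dirs I(1)[OF d]] b1[OF energy_dir_mult_le[OF d f]]])
    show "\<bar>LINT z:{0..}|lborel. ?T3 d z\<bar> \<le> ?B"
      by (rule order_trans[OF W[OF rapid_dir_mult[OF f] c l d d I(3)[OF d]] b1[OF order_refl]])
    show "\<bar>LINT z:{0..}|lborel. ?T4 d z\<bar> \<le> ?B"
      by (rule order_trans[OF W[OF rapid_dir_mult[OF f] c l None_in_dirs d I(4)[OF d]] b1[OF energy_dir_mult_le[OF d f]]])
    have sw: "tri_form (poisson_ext z (dir_mult d (dir_mult None f))) (poisson_ext z (dir_mult d g)) (poisson_ext z c) = tri_form (poisson_ext z c) (poisson_ext z (dir_mult d g)) (poisson_ext z (dir_mult d (dir_mult None f)))" for z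
      by (simp add: tri_form_def mult_ac)
    have m: "1 / (\<kappa> * M\<^sup>2) > 0" using l M by simp
    show "\<bar>LINT z:{0..}|lborel. ?T2 d z\<bar> \<le> ?B"
      unfolding sw
      by (rule order_trans[OF W[OF c rapid_dir_mult[OF f] m d d I(2)[OF d, unfolded sw]] b2])
  qed
  have "?Q = - 2 * (\<Sum>d\<in>dirs. (LINT z:{0..}|lborel. ?T1 d z) + 2 * (LINT z:{0..}|lborel. ?T2 d z)
           + (LINT z:{0..}|lborel. ?T3 d z) - (LINT z:{0..}|lborel. ?T4 d z))"
    using Q I(5) by simp
  also have "\<dots> \<le> 2 * \<bar>\<Sum>d\<in>dirs. (LINT z:{0..}|lborel. ?T1 d z) + 2 * (LINT z:{0..}|lborel. ?T2 d z)
           + (LINT z:{0..}|lborel. ?T3 d z) - (LINT z:{0..}|lborel. ?T4 d z)\<bar>" by (simp add: abs_if)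
  \<comment> \<open>The 5 is the sum 1 + 2 + 1 + 1 of the absolute values of the
    coefficients.\<close>
  also have "\<dots> \<le> 2 * (\<Sum>d\<in>(dirs :: 'a option set). 5 * ?B)"
  proof (intro mult_left_mono order_trans[OF sum_abs] sum_mono)
    fix d :: "'a option" assume d: "d \<in> dirs"
    show "\<bar>(LINT z:{0..}|lborel. ?T1 d z) + 2 * (LINT z:{0..}|lborel. ?T2 d z)
           + (LINT z:{0..}|lborel. ?T3 d z) - (LINT z:{0..}|lborel. ?T4 d z)\<bar> \<le> 5 * ?B"
      using T[OF d] by (simp only: abs_le_iff) linarith
  qed simp
  also have "\<dots> = 50 * ?n * (\<kappa> * M\<^sup>2 * ?A + ?Q / \<kappa>)"
    using card_dirs[where 'a='a] by (simp add: algebra_simps add_divide_distrib)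
  also have "\<dots> = (100 * ?n)\<^sup>2 / 2 * (M\<^sup>2 * ?A) + ?Q / 2"
  proof -
    have "50 * n * (100 * n * m * A + q / (100 * n)) = (100 * n)\<^sup>2 / 2 * (m * A) + q / 2" if "n > 0" for n m A q :: real
      using that by (simp add: field_simps power2_eq_square)
    from this[of ?n "M\<^sup>2" ?A ?Q] show ?thesis unfolding \<kappa>_def by (simp only: of_nat_0_less_iff zero_less_Suc Suc_eq_plus1[symmetric])
  qed
  finally have "?Q \<le> (100 * ?n)\<^sup>2 * (M\<^sup>2 * ?A)" by (simp add: field_simps)
  then show "?Q \<le> (100 * (DIM('a) + 1))\<^sup>2 * M\<^sup>2 * ?A" by (simp add: mult.assoc)
qed

section \<open>Test functions\<close>

lemma Cinf_Ck: "Cinf_compact_support f \<Longrightarrow> Ck_on_UNIV k f"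
  by (simp add: Cinf_compact_support_def)

lemma Cinf_continuous: "Cinf_compact_support f \<Longrightarrow> continuous_on UNIV f"
  using Cinf_Ck[of f 0] by simp

lemma Cinf_has_derivative:
  "Cinf_compact_support f \<Longrightarrow> (f has_derivative frechet_derivative f (at x)) (at x)"
  using Cinf_Ck[of f 1] frechet_derivative_works by auto

lemma Cinf_deriv:
  fixes f :: "'a::real_normed_vector \<Rightarrow> 'b::real_normed_vector"
  assumes f: "Cinf_compact_support f"
  shows "Cinf_compact_support (\<lambda>x. frechet_derivative f (at x) v)"
proof -
  let ?K = "closure {x. f x \<noteq> 0}"
  have "Ck_on_UNIV k (\<lambda>x. frechet_derivative f (at x) v)" for k
    using Cinf_Ck[OF f, of "Suc k"] by simp
  moreover have "{x. frechet_derivative f (at x) v \<noteq> 0} \<subseteq> ?K"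
  proof (rule ccontr)
    assume "\<not> {x. frechet_derivative f (at x) v \<noteq> 0} \<subseteq> ?K"
    then obtain x where x: "frechet_derivative f (at x) v \<noteq> 0" "x \<in> - ?K" by auto
    have "((\<lambda>_. 0) has_derivative (\<lambda>_. 0)) (at x)" by simp
    then have "(f has_derivative (\<lambda>_. 0)) (at x)"
    proof (rule has_derivative_transform_within_open)
      show "open (- ?K)" by (simp add: open_Compl)
      show "0 = f y" if "y \<in> - ?K" for y using that closure_subset[of "{x. f x \<noteq> 0}"] by auto
    qed fact
    then have "frechet_derivative f (at x) = (\<lambda>_. 0)" using frechet_derivative_at by metis
    then show False using x by simp
  qed
  then have "closure {x. frechet_derivative f (at x) v \<noteq> 0} \<subseteq> ?K"
    by (intro closure_minimal) auto
  then have "compact (closure {x. frechet_derivative f (at x) v \<noteq> 0})"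
    using f closed_Int_compact[OF closed_closure, of ?K "{x. frechet_derivative f (at x) v \<noteq> 0}"]
    by (auto simp: Cinf_compact_support_def Int_absorb2)
  ultimately show ?thesis by (simp add: Cinf_compact_support_def)
qed

lemma Cinf_support_bound:
  fixes f :: "'a::real_normed_vector \<Rightarrow> 'b::real_normed_vector"
  assumes "Cinf_compact_support f"
  obtains R where "R > 0" "\<And>x. norm x > R \<Longrightarrow> f x = 0"
proof -
  have "bounded {x. f x \<noteq> 0}"
    using assms bounded_subset[OF compact_imp_bounded closure_subset] by (auto simp: Cinf_compact_support_def)
  then obtain R where "\<forall>x\<in>{x. f x \<noteq> 0}. norm x \<le> R" "R > 0" using bounded_pos by metis
  then show ?thesis using that[of R] by force
qed

lemma Cinf_bounded:
  fixes f :: "'a::euclidean_space \<Rightarrow> 'b::real_normed_vector"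
  assumes f: "Cinf_compact_support f"
  obtains C where "C \<ge> 0" "\<And>x. norm (f x) \<le> C"
proof -
  obtain R where R: "R > 0" "\<And>x. norm x > R \<Longrightarrow> f x = 0" using Cinf_support_bound[OF f] by metis
  have "compact (f ` cball 0 R)"
    by (intro compact_continuous_image continuous_on_subset[OF Cinf_continuous[OF f]]) auto
  then obtain C where C: "C > 0" "\<forall>y\<in>f ` cball 0 R. norm y \<le> C"
    using compact_imp_bounded bounded_pos by metis
  have "norm (f x) \<le> C" for x
  proof (cases "norm x \<le> R")
    case True then show ?thesis using C by auto
  next
    case False then show ?thesis using R(2)[of x] C(1) by simp
  qed
  then show ?thesis using that[of C] C(1) by auto
qed

lemma integrable_bounded_support:
  fixes f :: "'a::euclidean_space \<Rightarrow> 'b::{banach, second_countable_topology}"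
  assumes "f \<in> borel_measurable borel" "\<And>x. norm (f x) \<le> C" "\<And>x. norm x > R \<Longrightarrow> f x = 0"
  shows "integrable lborel f"
proof (rule Bochner_Integration.integrable_bound)
  show "integrable lborel (\<lambda>x::'a. indicator (cball 0 R) x *\<^sub>R C)"
    using borel_integrable_compact[of "cball (0::'a) R" "\<lambda>_. C"] by simp
  have "C \<ge> 0" using assms(2) norm_ge_zero order_trans by blast
  then show "AE x in lborel. norm (f x) \<le> norm (indicator (cball 0 R) x *\<^sub>R C)"
    using assms(2,3) by (intro AE_I2) (auto simp: indicator_def)
qed (use assms in simp)

lemma Cinf_integrable:
  fixes f :: "'a::euclidean_space \<Rightarrow> real"
  assumes f: "Cinf_compact_support f"
  shows "integrable lborel f"
proof -
  obtain R where R: "\<And>x. norm x > R \<Longrightarrow> f x = 0" using Cinf_support_bound[OF f] by metis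
  obtain C where C: "\<And>x. norm (f x) \<le> C" using Cinf_bounded[OF f] by metis
  show ?thesis
    using Cinf_continuous[OF f] by (intro integrable_bounded_support[OF _ C R] borel_measurable_continuous_onI)
qed

text \<open>The mean value theorem bounds the quotients uniformly in the step, which is what
  dominated convergence requires when the derivative is taken under the transform.\<close>

lemma difference_quotient:
  fixes f :: "'a::euclidean_space \<Rightarrow> real"
  assumes f: "Cinf_compact_support f" and C: "\<And>x. \<bar>frechet_derivative f (at x) v\<bar> \<le> C"
  shows abs_difference_quotient_le: "t > 0 \<Longrightarrow> \<bar>(f (x + t *\<^sub>R v) - f x) / t\<bar> \<le> C"
    and difference_quotient_tendsto:
      "(\<lambda>k. (f (x + inverse (real (Suc k)) *\<^sub>R v) - f x) / inverse (real (Suc k))) \<longlonglongrightarrow> frechet_derivative f (at x) v"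
proof -
  have d: "((\<lambda>s. f (x + s *\<^sub>R v)) has_real_derivative frechet_derivative f (at (x + s *\<^sub>R v)) v) (at s)" for s
  proof -
    have "((\<lambda>s. x + s *\<^sub>R v) has_derivative (\<lambda>s. s *\<^sub>R v)) (at s)"
      by (auto intro!: derivative_eq_intros)
    from diff_chain_at[OF this Cinf_has_derivative[OF f]]
    have "((\<lambda>s. f (x + s *\<^sub>R v)) has_derivative (\<lambda>t. frechet_derivative f (at (x + s *\<^sub>R v)) (t *\<^sub>R v))) (at s)"
      by (simp add: o_def)
    moreover have "linear (frechet_derivative f (at (x + s *\<^sub>R v)))"
      using Cinf_has_derivative[OF f] has_derivative_linear by blast
    ultimately show ?thesis
      unfolding has_field_derivative_def by (simp add: linear_cmul mult.commute[of _ "_::real"])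
        (simp add: mult_commute_abs)
  qed
  show "\<bar>(f (x + t *\<^sub>R v) - f x) / t\<bar> \<le> C" if t: "t > 0" for t
  proof -
    obtain s where "f (x + t *\<^sub>R v) - f (x + 0 *\<^sub>R v) = (t - 0) * frechet_derivative f (at (x + s *\<^sub>R v)) v"
      using MVT2[OF t, of "\<lambda>s. f (x + s *\<^sub>R v)" "\<lambda>s. frechet_derivative f (at (x + s *\<^sub>R v)) v"] d by blast
    then show ?thesis using t C by simp
  qed
  have "(\<lambda>h. (f (x + (0 + h) *\<^sub>R v) - f (x + 0 *\<^sub>R v)) / h) \<midarrow>0\<rightarrow> frechet_derivative f (at (x + 0 *\<^sub>R v)) v"
    using d[of 0] unfolding DERIV_def .
  then have l: "(\<lambda>h. (f (x + h *\<^sub>R v) - f x) / h) \<midarrow>0\<rightarrow> frechet_derivative f (at x) v" by simp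
  show "(\<lambda>k. (f (x + inverse (real (Suc k)) *\<^sub>R v) - f x) / inverse (real (Suc k))) \<longlonglongrightarrow> frechet_derivative f (at x) v"
    by (rule filterlim_compose[OF l]) (auto simp: filterlim_at simp del: of_nat_Suc intro!: LIMSEQ_inverse_real_of_nat)
qed

lemma fourier_shift:
  fixes f :: "'a::euclidean_space \<Rightarrow> complex"
  assumes f: "integrable lborel f"
  shows "fourier (\<lambda>x. f (x + w)) \<xi> = cis (\<xi> \<bullet> w) * fourier f \<xi>"
proof -
  have [measurable]: "f \<in> borel_measurable borel" using f by auto
  have i: "integrable lborel (\<lambda>x. cis (- (\<xi> \<bullet> x)) * f x)"
    by (rule Bochner_Integration.integrable_bound[OF f]) (auto simp: norm_mult)
  have "fourier f \<xi> = (LINT x|lborel. cis (- (\<xi> \<bullet> (x + w))) * f (x + w))"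
    unfolding fourier_def using integral_lborel_shift[OF i, of w] by simp
  also have "\<dots> = (LINT x|lborel. cis (- (\<xi> \<bullet> w)) * (cis (- (\<xi> \<bullet> x)) * f (x + w)))"
  proof (rule Bochner_Integration.integral_cong[OF refl])
    fix x
    have "cis (- (\<xi> \<bullet> (x + w))) = cis (- (\<xi> \<bullet> w)) * cis (- (\<xi> \<bullet> x))"
      unfolding cis_mult by (rule arg_cong[where f=cis]) (simp add: inner_add_right)
    then show "cis (- (\<xi> \<bullet> (x + w))) * f (x + w) = cis (- (\<xi> \<bullet> w)) * (cis (- (\<xi> \<bullet> x)) * f (x + w))"
      by (simp only: mult.assoc)
  qed
  also have "\<dots> = cis (- (\<xi> \<bullet> w)) * fourier (\<lambda>x. f (x + w)) \<xi>"
    by (simp only: integral_mult_right_zero fourier_def)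
  finally have "cis (\<xi> \<bullet> w) * fourier f \<xi> = (cis (\<xi> \<bullet> w) * cis (- (\<xi> \<bullet> w))) * fourier (\<lambda>x. f (x + w)) \<xi>"
    by (simp only: mult.assoc)
  then show ?thesis by (simp add: cis_mult)
qed

text \<open>Difference quotients take the place of integration by parts: a translation multiplies
  the transform by a character, and both sides converge as the step tends to 0.\<close>

lemma fourier_deriv:
  fixes f :: "'a::euclidean_space \<Rightarrow> real"
  assumes f: "Cinf_compact_support f"
  shows "fourier (\<lambda>x. of_real (frechet_derivative f (at x) v)) \<xi> = \<i> * of_real (\<xi> \<bullet> v) * fourier (\<lambda>x. of_real (f x)) \<xi>"
proof -
  let ?f = "\<lambda>x. complex_of_real (f x)"
  let ?t = "\<lambda>k. inverse (real (Suc k))"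
  have t: "?t k > 0" "?t k \<le> 1" for k by (auto simp: inverse_le_1_iff)
  obtain C where C0: "C \<ge> 0" and C: "\<And>x. norm (frechet_derivative f (at x) v) \<le> C"
    using Cinf_bounded[OF Cinf_deriv[OF f]] by metis
  obtain R where R: "\<And>x. norm x > R \<Longrightarrow> f x = 0" using Cinf_support_bound[OF f] by metis
  have i: "integrable lborel ?f" using Cinf_integrable[OF f] by simp
  have [measurable]: "f \<in> borel_measurable borel" using Cinf_continuous[OF f] by (rule borel_measurable_continuous_onI)
  have [measurable]: "(\<lambda>x. frechet_derivative f (at x) v) \<in> borel_measurable borel"
    using Cinf_continuous[OF Cinf_deriv[OF f]] by (rule borel_measurable_continuous_onI)
  let ?q = "\<lambda>k x. complex_of_real ((f (x + ?t k *\<^sub>R v) - f x) / ?t k)"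
  have "(\<lambda>k. LINT x|lborel. cis (- (\<xi> \<bullet> x)) * ?q k x) \<longlonglongrightarrow> (LINT x|lborel. cis (- (\<xi> \<bullet> x)) * of_real (frechet_derivative f (at x) v))"
  proof (rule integral_dominated_convergence[where w="\<lambda>x. indicator (cball 0 (R + norm v)) x *\<^sub>R C"])
    show "integrable lborel (\<lambda>x::'a. indicator (cball 0 (R + norm v)) x *\<^sub>R C)"
      using borel_integrable_compact[of "cball (0::'a) (R + norm v)" "\<lambda>_. C"] by simp
    show "AE x in lborel. (\<lambda>k. cis (- (\<xi> \<bullet> x)) * ?q k x) \<longlonglongrightarrow> cis (- (\<xi> \<bullet> x)) * of_real (frechet_derivative f (at x) v)"
      using difference_quotient_tendsto[OF f] C by (intro AE_I2 tendsto_mult tendsto_const tendsto_of_real) auto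
    \<comment> \<open>The steps are at most 1, so the translated supports all lie in the ball
      enlarged by \<open>norm v\<close>.\<close>
    show "AE x in lborel. norm (cis (- (\<xi> \<bullet> x)) * ?q k x) \<le> indicator (cball 0 (R + norm v)) x *\<^sub>R C" for k
    proof (rule AE_I2)
      fix x :: 'a
      show "norm (cis (- (\<xi> \<bullet> x)) * ?q k x) \<le> indicator (cball 0 (R + norm v)) x *\<^sub>R C"
      proof (cases "norm x \<le> R + norm v")
        case True
        then show ?thesis
          using abs_difference_quotient_le[OF f _ t(1)[of k], of v C x] C by (simp add: norm_mult del: of_real_divide of_real_diff of_nat_Suc)
      next
        case False
        have "norm (?t k *\<^sub>R v) \<le> norm v" using t[of k] by (simp add: mult_left_le_one_le del: of_nat_Suc)
        then have "norm (x + ?t k *\<^sub>R v) > R" "norm x > R"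
          using False norm_diff_ineq[of x "?t k *\<^sub>R v"] norm_ge_zero[of v] by linarith+
        then show ?thesis using False R by simp
      qed
    qed
  qed measurable
  moreover have "(LINT x|lborel. cis (- (\<xi> \<bullet> x)) * ?q k x) = (cis (?t k * (\<xi> \<bullet> v)) - 1) / of_real (?t k) * fourier ?f \<xi>" for k
  proof -
    have ish: "integrable lborel (\<lambda>x. cis (- (\<xi> \<bullet> x)) * ?f (x + w))" for w
      by (rule Bochner_Integration.integrable_bound[OF integrable_lborel_shift[OF i, of w]]) (auto simp: norm_mult)
    have "(LINT x|lborel. cis (- (\<xi> \<bullet> x)) * ?q k x) = (LINT x|lborel. (cis (- (\<xi> \<bullet> x)) * ?f (x + ?t k *\<^sub>R v) - cis (- (\<xi> \<bullet> x)) * ?f (x + 0)) / of_real (?t k))"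
      by (intro Bochner_Integration.integral_cong refl) (simp add: right_diff_distrib diff_divide_distrib)
    also have "\<dots> = (fourier (\<lambda>x. ?f (x + ?t k *\<^sub>R v)) \<xi> - fourier (\<lambda>x. ?f (x + 0)) \<xi>) / of_real (?t k)"
      unfolding fourier_def integral_divide_zero by (subst Bochner_Integration.integral_diff) (rule ish refl)+
    also have "\<dots> = (cis (\<xi> \<bullet> (?t k *\<^sub>R v)) - 1) / of_real (?t k) * fourier ?f \<xi>"
      unfolding fourier_shift[OF i] by (simp add: left_diff_distrib diff_divide_distrib)
    finally show ?thesis by simp
  qed
  moreover have "(\<lambda>k. (cis (?t k * (\<xi> \<bullet> v)) - 1) / of_real (?t k) * fourier ?f \<xi>) \<longlonglongrightarrow> \<i> * of_real (\<xi> \<bullet> v) * fourier ?f \<xi>"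
  proof (intro tendsto_mult tendsto_const)
    let ?a = "\<xi> \<bullet> v"
    show "(\<lambda>k. (cis (?t k * ?a) - 1) / of_real (?t k)) \<longlonglongrightarrow> \<i> * of_real ?a"
    proof (rule LIM_zero_cancel, rule Lim_null_comparison)
      show "\<forall>\<^sub>F k in sequentially. norm ((cis (?t k * ?a) - 1) / of_real (?t k) - \<i> * of_real ?a) \<le> ?t k * (?a\<^sup>2 / 2)"
      proof (rule always_eventually, rule allI)
        fix k
        have "(cis (?t k * ?a) - 1) / of_real (?t k) - \<i> * of_real ?a = (cis (?t k * ?a) - 1 - \<i> * of_real (?t k * ?a)) / of_real (?t k)"
          using t(1)[of k] by (simp add: diff_divide_distrib del: of_nat_Suc)
        then have "norm ((cis (?t k * ?a) - 1) / of_real (?t k) - \<i> * of_real ?a) \<le> ((?t k * ?a)\<^sup>2 / 2) / ?t k"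
          using norm_cis_minus_linear[of "?t k * ?a"] t(1)[of k] by (simp only: norm_divide norm_of_real abs_of_pos divide_right_mono less_imp_le)
        also have "((?t k * ?a)\<^sup>2 / 2) / ?t k = ?t k * (?a\<^sup>2 / 2)"
          using t(1)[of k] by (simp add: power2_eq_square del: of_nat_Suc)
        finally show "norm ((cis (?t k * ?a) - 1) / of_real (?t k) - \<i> * of_real ?a) \<le> ?t k * (?a\<^sup>2 / 2)" .
      qed
      have "(\<lambda>k. ?t k * (?a\<^sup>2 / 2)) \<longlonglongrightarrow> 0 * (?a\<^sup>2 / 2)"
        by (intro tendsto_intros LIMSEQ_inverse_real_of_nat)
      then show "(\<lambda>k. ?t k * (?a\<^sup>2 / 2)) \<longlonglongrightarrow> 0" by simp
    qed
  qed
  ultimately have "(LINT x|lborel. cis (- (\<xi> \<bullet> x)) * of_real (frechet_derivative f (at x) v)) = \<i> * of_real (\<xi> \<bullet> v) * fourier ?f \<xi>"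
    using LIMSEQ_unique by (simp only:) blast
  then show ?thesis by (simp add: fourier_def)
qed

text \<open>A further power of \<open>norm \<xi>\<close> is bounded by the coordinates of \<xi>, and
  each coordinate becomes a derivative of \<open>f\<close>. The derivatives are again test
  functions, so the induction runs over all of them at once.\<close>

theorem rapid_fourier_Cinf:
  fixes f :: "'a::euclidean_space \<Rightarrow> real"
  assumes f: "Cinf_compact_support f"
  shows "rapid (fourier (\<lambda>x. of_real (f x)))"
proof (rule rapidI)
  let ?F = "\<lambda>f::'a \<Rightarrow> real. fourier (\<lambda>x. complex_of_real (f x))"
  have i: "integrable lborel (\<lambda>x. complex_of_real (f x))" using Cinf_integrable[OF f] by simp
  show "continuous_on UNIV (?F f)" by (rule continuous_on_fourier[OF i])
  show "?F f (- \<xi>) = cnj (?F f \<xi>)" for \<xi>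
    unfolding cnj_fourier by (simp add: fourier_def)
  show "\<exists>C. \<forall>\<xi>. (1 + norm \<xi>) ^ N * norm (?F f \<xi>) \<le> C" for N
    using f
  proof (induction N arbitrary: f)
    case 0
    have "integrable lborel (\<lambda>x. complex_of_real (f x))" using Cinf_integrable[OF 0] by simp
    then show ?case using norm_fourier_le by (intro exI allI) simp
  next
    case (Suc N)
    let ?D = "\<lambda>b x. frechet_derivative f (at x) b"
    obtain C where C: "\<And>\<xi>. (1 + norm \<xi>) ^ N * norm (?F f \<xi>) \<le> C" using Suc.IH[OF Suc.prems] by blast
    have "\<forall>b. \<exists>C. \<forall>\<xi>. (1 + norm \<xi>) ^ N * norm (?F (?D b) \<xi>) \<le> C"
      using Suc.IH[OF Cinf_deriv[OF Suc.prems]] by blast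
    then obtain D where D: "\<And>b \<xi>. (1 + norm \<xi>) ^ N * norm (?F (?D b) \<xi>) \<le> D b" by metis
    show ?case
    proof (intro exI allI)
      fix \<xi> :: 'a
      have "norm \<xi> * norm (?F f \<xi>) \<le> (\<Sum>b\<in>Basis. \<bar>\<xi> \<bullet> b\<bar>) * norm (?F f \<xi>)"
        by (intro mult_right_mono norm_le_l1) simp
      also have "\<dots> = (\<Sum>b\<in>Basis. norm (?F (?D b) \<xi>))"
        unfolding fourier_deriv[OF Suc.prems] sum_distrib_right by (simp add: norm_mult)
      finally have "(1 + norm \<xi>) * norm (?F f \<xi>) \<le> norm (?F f \<xi>) + (\<Sum>b\<in>Basis. norm (?F (?D b) \<xi>))"
        by (simp add: distrib_right)
      then have "(1 + norm \<xi>) ^ N * ((1 + norm \<xi>) * norm (?F f \<xi>)) \<le> (1 + norm \<xi>) ^ N * (norm (?F f \<xi>) + (\<Sum>b\<in>Basis. norm (?F (?D b) \<xi>)))"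
        by (rule mult_left_mono) simp
      also have "\<dots> = (1 + norm \<xi>) ^ N * norm (?F f \<xi>) + (\<Sum>b\<in>Basis. (1 + norm \<xi>) ^ N * norm (?F (?D b) \<xi>))"
        by (simp add: distrib_left sum_distrib_left)
      also have "\<dots> \<le> C + (\<Sum>b\<in>Basis. D b)" using C D by (intro add_mono sum_mono)
      finally show "(1 + norm \<xi>) ^ Suc N * norm (?F f \<xi>) \<le> C + (\<Sum>b\<in>Basis. D b)" by (simp add: mult_ac)
    qed
  qed
qed

lemma synth_fourier_Cinf:
  fixes f :: "'a::euclidean_space \<Rightarrow> real"
  assumes f: "Cinf_compact_support f"
  shows "synth (fourier (\<lambda>x. of_real (f x))) x = f x"
proof -
  obtain C where C: "\<And>x. norm (f x) \<le> C" using Cinf_bounded[OF f] by metis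
  have "inv_fourier (fourier (\<lambda>x. complex_of_real (f x))) x = complex_of_real (f x)"
    by (rule fourier_inversion[where C=C])
       (use Cinf_integrable[OF f] Cinf_continuous[OF f] C rapid_integrable[OF rapid_fourier_Cinf[OF f]]
         in \<open>auto intro!: continuous_intros\<close>)
  then show ?thesis by (simp add: synth_def)
qed

lemma Cinf_component:
  fixes u :: "'a::real_normed_vector \<Rightarrow> real ^ 'm"
  assumes u: "Cinf_compact_support u"
  shows "Cinf_compact_support (\<lambda>x. u x $ k)"
    and "frechet_derivative (\<lambda>x. u x $ k) (at x) v = frechet_derivative u (at x) v $ k"
proof -
  have d: "frechet_derivative (\<lambda>x. w x $ k) (at x) = (\<lambda>v. frechet_derivative w (at x) v $ k)"
      "(\<lambda>x. w x $ k) differentiable (at x)" if "w differentiable (at x)" for w :: "'a \<Rightarrow> real ^ 'm" and x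
  proof -
    have "((\<lambda>x. w x $ k) has_derivative (\<lambda>v. frechet_derivative w (at x) v $ k)) (at x)"
      using that by (intro bounded_linear.has_derivative[OF bounded_linear_vec_nth]) (simp add: frechet_derivative_works)
    then show "frechet_derivative (\<lambda>x. w x $ k) (at x) = (\<lambda>v. frechet_derivative w (at x) v $ k)"
      "(\<lambda>x. w x $ k) differentiable (at x)"
      by (auto simp: frechet_derivative_at[symmetric] differentiable_def)
  qed
  have ck: "Ck_on_UNIV n w \<Longrightarrow> Ck_on_UNIV n (\<lambda>x. w x $ k)" for n and w :: "'a \<Rightarrow> real ^ 'm"
  proof (induction n arbitrary: w)
    case (Suc n)
    then show ?case by (simp add: d)
  qed (auto intro: continuous_intros)
  have "{x. u x $ k \<noteq> 0} \<subseteq> {x. u x \<noteq> 0}" by auto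
  then have "closure {x. u x $ k \<noteq> 0} \<subseteq> closure {x. u x \<noteq> 0}" by (rule closure_mono)
  then have "compact (closure {x. u x $ k \<noteq> 0})"
    using u closed_Int_compact[OF closed_closure, of "closure {x. u x \<noteq> 0}" "{x. u x $ k \<noteq> 0}"]
    by (auto simp: Cinf_compact_support_def Int_absorb2)
  then show "Cinf_compact_support (\<lambda>x. u x $ k)"
    using u ck by (simp add: Cinf_compact_support_def)
  show "frechet_derivative (\<lambda>x. u x $ k) (at x) v = frechet_derivative u (at x) v $ k"
    using d(1)[of u x] Cinf_Ck[OF u, of 1] by simp
qed

section \<open>The commutator estimate\<close>

lemma has_derivative_vec_lambda:
  fixes f :: "'a::real_normed_vector \<Rightarrow> 'm::finite \<Rightarrow> real"
  assumes "\<And>k. ((\<lambda>x. f x k) has_derivative (\<lambda>v. f' v k)) (at x)"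
  shows "((\<lambda>x. \<chi> k. f x k) has_derivative (\<lambda>v. \<chi> k. f' v k)) (at x)"
  using assms by (subst has_derivative_componentwise_within) (auto simp: Basis_vec_def inner_axis)

lemma norm_sq_vec: "(norm (x :: real ^ 'm))\<^sup>2 = (\<Sum>k\<in>UNIV. (x $ k)\<^sup>2)"
  unfolding power2_norm_eq_inner inner_vec_def by (simp add: power2_eq_square)

text \<open>For continuous \<open>f\<close> the set where the essential bound is exceeded is open
  and null, hence empty. Boundedness keeps the essential supremum finite; otherwise
  \<open>real_of_ereal\<close> would return 0.\<close>

lemma norm_le_Linf_norm:
  fixes f :: "'a::euclidean_space \<Rightarrow> 'b::euclidean_space"
  assumes cont: "continuous_on UNIV f" and bd: "\<And>x. norm (f x) \<le> C"
  shows "norm (f x) \<le> Linf_norm f"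
proof -
  have [measurable]: "f \<in> borel_measurable borel" using cont by (rule borel_measurable_continuous_onI)
  let ?g = "\<lambda>x. ereal (norm (f x))"
  have m: "?g \<in> borel_measurable lborel" by measurable
  have ae: "AE x in lborel. ?g x \<le> esssup lborel ?g" by (rule esssup_AE)
  have le: "esssup lborel ?g \<le> ereal C" using bd by (intro esssup_I m) auto
  have ge: "0 \<le> esssup lborel ?g"
  proof -
    have "\<exists>x. ?g x \<le> esssup lborel ?g"
    proof (rule ccontr)
      assume "\<not> ?thesis"
      then have "AE x::'a in lborel. False" using ae by auto
      then show False by (auto simp: AE_iff_null null_sets_def)
    qed
    then obtain x where "?g x \<le> esssup lborel ?g" by blast
    then show ?thesis using order_trans[of 0 "?g x"] by simp
  qed
  have eq: "esssup lborel ?g = ereal (Linf_norm f)"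
    using le ge unfolding Linf_norm_def by (cases "esssup lborel ?g") auto
  let ?S = "{x. norm (f x) > Linf_norm f}"
  have "open ?S"
    using cont by (intro open_Collect_less continuous_intros)
  moreover have "negligible ?S"
  proof -
    have "AE x in lborel. \<not> x \<in> ?S" using ae unfolding eq by (simp add: not_less)
    then have "?S \<in> null_sets lborel" by (subst (asm) AE_iff_null_sets[symmetric]) auto
    then show ?thesis by (simp add: negligible_iff_null_sets null_sets_completionI)
  qed
  ultimately have "?S = {}" using open_not_negligible by blast
  then show ?thesis by (auto simp: not_less)
qed

lemma frac_laplacian_half:
  "frac_laplacian (1/2) f x = synth (dir_mult None (fourier (\<lambda>y. of_real (f y)))) x"
  by (simp add: frac_laplacian_def synth_def dir_mult_def[abs_def])

lemma synth_directional:
  fixes g :: "real ^ 'n \<Rightarrow> complex"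
  assumes g: "rapid g"
  shows "synth (\<lambda>\<xi>. \<i> * of_real (\<xi> \<bullet> v) * g \<xi>) x = (\<Sum>j\<in>UNIV. v $ j * synth (dir_mult (Some (axis j 1)) g) x)"
proof -
  have "\<i> * of_real (\<xi> \<bullet> v) * g \<xi> = (\<Sum>j\<in>UNIV. of_real (v $ j) * dir_mult (Some (axis j 1)) g \<xi>)" for \<xi>
  proof -
    have "\<xi> \<bullet> v = (\<Sum>j\<in>UNIV. \<xi> $ j * v $ j)" by (simp add: inner_vec_def)
    then show ?thesis by (simp add: dir_mult_def inner_axis sum_distrib_left sum_distrib_right mult_ac)
  qed
  then have "synth (\<lambda>\<xi>. \<i> * of_real (\<xi> \<bullet> v) * g \<xi>) x = synth (\<lambda>\<xi>. \<Sum>j\<in>UNIV. of_real (v $ j) * dir_mult (Some (axis j 1)) g \<xi>) x"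
    by simp
  also have "\<dots> = (\<Sum>j\<in>UNIV. v $ j * synth (dir_mult (Some (axis j 1)) g) x)"
    by (subst synth_sum) (auto intro: rapid_cmult rapid_dir_mult g simp: synth_cmult)
  finally show ?thesis .
qed

lemma sum_axis: "(\<Sum>i\<in>UNIV. axis j 1 $ i * f i) = (f j :: real)"
  by (simp add: axis_def mult_delta_left)

text \<open>The product commutator bound asks for a strictly positive \<open>M\<close>; letting
  \<open>M\<close> decrease to the actual norm covers a vanishing gradient as well.\<close>

lemma le_square_of_forall_gt:
  fixes G :: real
  assumes "\<And>M. M > G \<Longrightarrow> X \<le> c * M\<^sup>2"
  shows "X \<le> c * G\<^sup>2"
proof (rule tendsto_lowerbound)
  show "((\<lambda>M. c * M\<^sup>2) \<longlongrightarrow> c * G\<^sup>2) (at_right G)" by (intro tendsto_intros)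
  show "\<forall>\<^sub>F M in at_right G. X \<le> c * M\<^sup>2"
    using eventually_at_right_less[of G] by eventually_elim (rule assms)
qed simp

text \<open>Component \<open>k\<close> is the sum over \<open>j\<close> of \<open>\<Lambda>(u_j
  \<partial>_j u_k) - u_j \<Lambda>\<partial>_j u_k\<close>. The product commutator bound applies
  with \<open>f = u_j\<close> and \<open>g = \<partial>_j u_k\<close>, and the remaining
  \<open>(\<Lambda>u_j) \<partial>_j u_k\<close> is bounded pointwise.\<close>

theorem commutator_estimate:
  fixes u :: "real ^ 'n \<Rightarrow> real ^ 'n"
  assumes u: "Cinf_compact_support u"
  defines "G \<equiv> Linf_norm (\<lambda>x. jacobian u (at x))"
  defines "N \<equiv> real CARD('n)"
  shows "in_L2 (commutator (1/2) u)" and "G \<ge> 0"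
    and "L2_norm (commutator (1/2) u) \<le> 200 * (N + 1)\<^sup>2 * G * L2_norm (frac_laplacian_vec (1/2) u)"
proof -
  define U where "U k = fourier (\<lambda>x. complex_of_real (u x $ k))" for k
  define D where "D k j = dir_mult (Some (axis j 1)) (U k)" for k j
  note uk = Cinf_component(1)[OF u]
  have U: "rapid (U k)" for k unfolding U_def by (rule rapid_fourier_Cinf[OF uk])
  have D: "rapid (D k j)" for k j unfolding D_def by (rule rapid_dir_mult[OF U])
  have sU: "synth (U k) x = u x $ k" for k x unfolding U_def by (rule synth_fourier_Cinf[OF uk])
  have du: "frechet_derivative u (at x) v $ k = (\<Sum>j\<in>UNIV. v $ j * synth (D k j) x)" for x v k
  proof -
    have "frechet_derivative u (at x) v $ k = frechet_derivative (\<lambda>x. u x $ k) (at x) v"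
      by (rule Cinf_component(2)[OF u, symmetric])
    also have "(\<lambda>x. u x $ k) = synth (U k)" using sU by auto
    also have "frechet_derivative (synth (U k)) (at x) = (\<lambda>v. synth (\<lambda>\<xi>. \<i> * of_real (\<xi> \<bullet> v) * U k \<xi>) x)"
      using frechet_derivative_at[OF synth_has_derivative[OF U]] by simp
    also have "synth (\<lambda>\<xi>. \<i> * of_real (\<xi> \<bullet> v) * U k \<xi>) x = (\<Sum>j\<in>UNIV. v $ j * synth (D k j) x)"
      unfolding D_def by (rule synth_directional[OF U])
    finally show ?thesis .
  qed
  have jac: "jacobian u (at x) $ k $ j = synth (D k j) x" for x k j
    by (simp add: jacobian_def matrix_def du sum_axis)
  have DG: "\<bar>synth (D k j) x\<bar> \<le> G" for k j x
  proof -
    have "\<forall>k j. \<exists>C. \<forall>x. \<bar>synth (D k j) x\<bar> \<le> C" using synth_bounded[OF D] by metis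
    then obtain C where C: "\<And>k j x. \<bar>synth (D k j) x\<bar> \<le> C k j" by metis
    have e: "(\<lambda>x. jacobian u (at x)) = (\<lambda>x. \<chi> k. \<chi> j. synth (D k j) x)"
      by (simp add: vec_eq_iff jac fun_eq_iff)
    have "continuous_on UNIV (\<lambda>x. jacobian u (at x))"
      unfolding e by (intro continuous_intros continuous_on_synth D)
    moreover have "norm (jacobian u (at x)) \<le> (\<Sum>k\<in>UNIV. \<Sum>j\<in>UNIV. C k j)" for x
    proof -
      have "norm (jacobian u (at x)) \<le> (\<Sum>k\<in>UNIV. norm (jacobian u (at x) $ k))"
        by (simp add: norm_vec_def L2_set_le_sum)
      also have "\<dots> \<le> (\<Sum>k\<in>UNIV. \<Sum>j\<in>UNIV. \<bar>jacobian u (at x) $ k $ j\<bar>)"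
        by (intro sum_mono norm_le_l1_cart)
      also have "\<dots> \<le> (\<Sum>k\<in>UNIV. \<Sum>j\<in>UNIV. C k j)" unfolding jac by (intro sum_mono C)
      finally show ?thesis .
    qed
    ultimately have "norm (jacobian u (at x)) \<le> G" unfolding G_def by (rule norm_le_Linf_norm)
    moreover have "\<bar>jacobian u (at x) $ k $ j\<bar> \<le> norm (jacobian u (at x))"
      using order_trans[OF component_le_norm_cart Finite_Cartesian_Product.norm_nth_le] by blast
    ultimately show ?thesis unfolding jac by linarith
  qed
  show G0: "G \<ge> 0" using order_trans[OF abs_ge_zero DG] .
  define P where "P k = (\<lambda>\<xi>. \<Sum>j\<in>UNIV. conv (U j) (D k j) \<xi>)" for k
  have P: "rapid (P k)" for k unfolding P_def by (intro rapid_sum rapid_conv U D)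
  have sP: "synth (P k) x = (\<Sum>j\<in>UNIV. synth (U j) x * synth (D k j) x)" for k x
    unfolding P_def by (subst synth_sum) (auto simp: synth_conv U D intro: rapid_conv U D)
  have cP: "convect u u x $ k = synth (P k) x" for k x
    unfolding convect_def du sP sU ..
  \<comment> \<open>Products of square integrable functions are integrable; this makes
    \<open>fourier_synth\<close> available for the convective term.\<close>
  have iP: "integrable lborel (synth (P k))" for k
    unfolding sP by (intro Bochner_Integration.integrable_sum integrable_synth_mult U D)
  have L1: "frac_laplacian_vec (1/2) (convect u u) x $ k = synth (dir_mult None (P k)) x" for k x
  proof -
    have "fourier (\<lambda>x. complex_of_real (synth (P k) x)) = P k"
      by (rule HOL.ext) (rule fourier_synth[OF P iP])
    then show ?thesis unfolding frac_laplacian_vec_def frac_laplacian_half cP by simp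
  qed
  have w: "frac_laplacian_vec (1/2) u = (\<lambda>x. \<chi> k. synth (dir_mult None (U k)) x)"
    unfolding frac_laplacian_vec_def frac_laplacian_half U_def ..
  have L2: "convect u (frac_laplacian_vec (1/2) u) x $ k = (\<Sum>j\<in>UNIV. synth (U j) x * synth (dir_mult None (D k j)) x)" for x k
  proof -
    have "((\<lambda>x. \<chi> k. synth (dir_mult None (U k)) x) has_derivative (\<lambda>v. \<chi> k. synth (\<lambda>\<xi>. \<i> * of_real (\<xi> \<bullet> v) * dir_mult None (U k) \<xi>) x)) (at x)"
      by (intro has_derivative_vec_lambda synth_has_derivative rapid_dir_mult U)
    then have "frechet_derivative (frac_laplacian_vec (1/2) u) (at x) = (\<lambda>v. \<chi> k. synth (\<lambda>\<xi>. \<i> * of_real (\<xi> \<bullet> v) * dir_mult None (U k) \<xi>) x)"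
      unfolding w by (rule frechet_derivative_at[symmetric])
    then have "convect u (frac_laplacian_vec (1/2) u) x $ k = (\<Sum>j\<in>UNIV. u x $ j * synth (dir_mult (Some (axis j 1)) (dir_mult None (U k))) x)"
      unfolding convect_def by (simp only: vec_lambda_beta synth_directional[OF rapid_dir_mult[OF U]])
    moreover have "dir_mult (Some (axis j 1)) (dir_mult None (U k)) = dir_mult None (D k j)" for j
      unfolding D_def dir_mult_def by (simp add: mult.left_commute)
    ultimately show ?thesis by (simp add: sU)
  qed
  \<comment> \<open>\<open>C\<close> is the product commutator with both one-sided terms removed;
    \<open>B\<close> restores the one that the commutator of the statement does not
    subtract.\<close>
  define C where "C k j = (\<lambda>\<xi>. dir_mult None (conv (U j) (D k j)) \<xi> - conv (U j) (dir_mult None (D k j)) \<xi> - conv (dir_mult None (U j)) (D k j) \<xi>)" for k j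
  define B where "B k = (\<lambda>\<xi>. \<Sum>j\<in>UNIV. C k j \<xi> + conv (dir_mult None (U j)) (D k j) \<xi>)" for k
  have rc: "rapid (dir_mult None (conv (U j) (D k j)))" "rapid (conv (U j) (dir_mult None (D k j)))" "rapid (conv (dir_mult None (U j)) (D k j))" for k j
    by (intro rapid_dir_mult rapid_conv U D)+
  have C: "rapid (C k j)" for k j unfolding C_def by (intro rapid_diff rc)
  have B: "rapid (B k)" for k unfolding B_def by (intro rapid_sum rapid_add C rc)
  have sB: "synth (B k) x = (\<Sum>j\<in>UNIV. synth (C k j) x + synth (dir_mult None (U j)) x * synth (D k j) x)" for k x
    unfolding B_def by (subst synth_sum) (auto simp: synth_add C rc synth_conv rapid_dir_mult U D intro: rapid_add)
  have sC: "synth (C k j) x = synth (dir_mult None (conv (U j) (D k j))) x - synth (U j) x * synth (dir_mult None (D k j)) x - synth (dir_mult None (U j)) x * synth (D k j) x" for k j x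
    unfolding C_def by (simp add: synth_diff rapid_diff rc synth_conv rapid_dir_mult U D)
  have sLP: "synth (dir_mult None (P k)) x = (\<Sum>j\<in>UNIV. synth (dir_mult None (conv (U j) (D k j))) x)" for k x
  proof -
    have "dir_mult None (P k) = (\<lambda>\<xi>. \<Sum>j\<in>UNIV. dir_mult None (conv (U j) (D k j)) \<xi>)"
      by (simp add: dir_mult_def P_def sum_distrib_left fun_eq_iff)
    then show ?thesis by (simp add: synth_sum rc)
  qed
  have comm: "commutator (1/2) u = (\<lambda>x. \<chi> k. synth (B k) x)"
    by (simp add: fun_eq_iff vec_eq_iff commutator_def L1 L2 sLP sB sC sum_subtractf[symmetric])
  have nsq: "(norm (commutator (1/2) u x))\<^sup>2 = (\<Sum>k\<in>UNIV. (synth (B k) x)\<^sup>2)" for x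
    unfolding norm_sq_vec comm by simp
  have "continuous_on UNIV (commutator (1/2) u)"
    unfolding comm by (intro continuous_intros continuous_on_synth B)
  then show "in_L2 (commutator (1/2) u)"
    unfolding in_L2_def nsq
    by (auto intro!: borel_measurable_continuous_onI Bochner_Integration.integrable_sum integrable_synth_sq B)
  have N: "N \<ge> 1" unfolding N_def by (simp add: Suc_le_eq)
  define A where "A = (\<Sum>j\<in>UNIV. energy (dir_mult None (U j)))"
  define c where "c = (100 * (N + 1))\<^sup>2"
  have c1: "c \<ge> 1" unfolding c_def using N by (intro one_le_power) auto
  have A_eq: "(L2_norm (frac_laplacian_vec (1/2) u))\<^sup>2 = A"
  proof -
    have "(LINT x|lborel. (norm (frac_laplacian_vec (1/2) u x))\<^sup>2) = A"
      unfolding norm_sq_vec w A_def energy_def vec_lambda_beta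
      by (rule Bochner_Integration.integral_sum) (intro integrable_synth_sq rapid_dir_mult U)
    moreover have "A \<ge> 0" unfolding A_def by (intro sum_nonneg energy_nonneg)
    ultimately show ?thesis unfolding L2_norm_def by simp
  qed
  \<comment> \<open>One factor \<open>N\<close> is Cauchy-Schwarz over \<open>j\<close>, the other
    counts the components \<open>k\<close>. One factor 2 comes from the square of a sum, the other
    from bounding both summands by the larger constant, as \<open>c \<ge> 1\<close>.\<close>
  have "(\<Sum>k\<in>UNIV. energy (B k)) \<le> (4 * N\<^sup>2 * c * A) * G\<^sup>2"
  proof (rule le_square_of_forall_gt)
    fix M assume M: "M > G"
    then have M0: "M > 0" using G0 by simp
    have bd: "\<bar>synth (D k j) x\<bar> \<le> M" for k j x using DG[of k j x] M by simp
    \<comment> \<open>Integrability does not come from \<open>rapid\<close>: the entries of the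
      gradient are themselves test functions.\<close>
    have iD: "integrable lborel (synth (D k j))" for k j
    proof -
      have "synth (D k j) = (\<lambda>x. frechet_derivative (\<lambda>x. u x $ k) (at x) (axis j 1))"
        unfolding Cinf_component(2)[OF u] du by (simp add: sum_axis)
      then show ?thesis using Cinf_integrable[OF Cinf_deriv[OF uk]] by simp
    qed
    have EC: "energy (C k j) \<le> c * M\<^sup>2 * energy (dir_mult None (U j))" for k j
      using product_commutator_bound(2)[OF U D iD bd M0, of j k j] unfolding C_def c_def N_def by (simp add: add.commute)
    have EB: "energy (B k) \<le> 4 * N * c * M\<^sup>2 * A" for k
    proof -
      let ?a = "\<lambda>j x. synth (C k j) x" and ?b = "\<lambda>j x. synth (dir_mult None (U j)) x"
      have pw: "(synth (B k) x)\<^sup>2 \<le> (\<Sum>j\<in>UNIV. 2 * N * ((?a j x)\<^sup>2 + M\<^sup>2 * (?b j x)\<^sup>2))" for x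
      proof -
        have "(synth (B k) x)\<^sup>2 \<le> (\<Sum>j\<in>UNIV. (?a j x + ?b j x * synth (D k j) x)\<^sup>2) * N"
          unfolding sB N_def by (rule sum_squared_le_sum_of_squares)
        also have "\<dots> \<le> (\<Sum>j\<in>UNIV. 2 * ((?a j x)\<^sup>2 + M\<^sup>2 * (?b j x)\<^sup>2)) * N"
        proof (intro mult_right_mono sum_mono)
          fix j
          have s: "(p + q)\<^sup>2 \<le> 2 * (p\<^sup>2 + q\<^sup>2)" for p q :: real
            using sum_squares_bound[of p q] by (simp add: power2_sum)
          have "(synth (D k j) x)\<^sup>2 \<le> M\<^sup>2" using power_mono[OF bd abs_ge_zero, of k j x 2] by simp
          then have "(synth (D k j) x)\<^sup>2 * (?b j x)\<^sup>2 \<le> M\<^sup>2 * (?b j x)\<^sup>2" by (rule mult_right_mono) simp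
          then show "(?a j x + ?b j x * synth (D k j) x)\<^sup>2 \<le> 2 * ((?a j x)\<^sup>2 + M\<^sup>2 * (?b j x)\<^sup>2)"
            using s[of "?a j x" "?b j x * synth (D k j) x"] by (simp add: power_mult_distrib mult.commute)
        qed (use N in simp)
        also have "\<dots> = (\<Sum>j\<in>UNIV. 2 * N * ((?a j x)\<^sup>2 + M\<^sup>2 * (?b j x)\<^sup>2))"
          unfolding sum_distrib_right by (intro sum.cong refl) simp
        finally show ?thesis .
      qed
      have i: "integrable lborel (\<lambda>x. (?a j x)\<^sup>2)" "integrable lborel (\<lambda>x. (?b j x)\<^sup>2)" for j
        by (intro integrable_synth_sq rapid_dir_mult C U)+
      have "energy (B k) \<le> (LINT x|lborel. (\<Sum>j\<in>UNIV. 2 * N * ((?a j x)\<^sup>2 + M\<^sup>2 * (?b j x)\<^sup>2)))"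
        unfolding energy_def
        by (intro integral_mono integrable_synth_sq B Bochner_Integration.integrable_sum integrable_mult_right
            Bochner_Integration.integrable_add i pw)
      also have "\<dots> = (\<Sum>j\<in>UNIV. 2 * N * (energy (C k j) + M\<^sup>2 * energy (dir_mult None (U j))))"
        unfolding energy_def using i by (subst Bochner_Integration.integral_sum) auto
      also have "\<dots> \<le> (\<Sum>j\<in>UNIV. 2 * N * (2 * (c * M\<^sup>2 * energy (dir_mult None (U j)))))"
      proof (intro sum_mono mult_left_mono)
        fix j
        have "1 * (M\<^sup>2 * energy (dir_mult None (U j))) \<le> c * (M\<^sup>2 * energy (dir_mult None (U j)))"
          using c1 by (intro mult_right_mono) (auto simp: energy_nonneg)
        then show "energy (C k j) + M\<^sup>2 * energy (dir_mult None (U j)) \<le> 2 * (c * M\<^sup>2 * energy (dir_mult None (U j)))"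
          using EC[of k j] by (simp add: mult.assoc)
      qed (use N in simp)
      also have "\<dots> = 4 * N * c * M\<^sup>2 * A"
        unfolding A_def by (simp add: sum_distrib_left mult_ac)
      finally show ?thesis .
    qed
    have "(\<Sum>k\<in>UNIV. energy (B k)) \<le> (\<Sum>k\<in>(UNIV::'n set). 4 * N * c * M\<^sup>2 * A)" by (intro sum_mono EB)
    also have "\<dots> = (4 * N\<^sup>2 * c * A) * M\<^sup>2" by (simp add: N_def power2_eq_square mult_ac)
    finally show "(\<Sum>k\<in>UNIV. energy (B k)) \<le> (4 * N\<^sup>2 * c * A) * M\<^sup>2" .
  qed
  moreover have "(LINT x|lborel. (norm (commutator (1/2) u x))\<^sup>2) = (\<Sum>k\<in>UNIV. energy (B k))"
    unfolding nsq energy_def by (rule Bochner_Integration.integral_sum) (intro integrable_synth_sq B)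
  ultimately have "(LINT x|lborel. (norm (commutator (1/2) u x))\<^sup>2) \<le> (4 * N\<^sup>2 * c * A) * G\<^sup>2" by simp
  also have "\<dots> = (200 * N * (N + 1) * G * L2_norm (frac_laplacian_vec (1/2) u))\<^sup>2"
    unfolding power_mult_distrib A_eq c_def by (simp add: mult_ac)
  finally have "L2_norm (commutator (1/2) u) \<le> \<bar>200 * N * (N + 1) * G * L2_norm (frac_laplacian_vec (1/2) u)\<bar>"
    unfolding L2_norm_def[of "commutator _ _"] by (simp add: real_sqrt_le_iff flip: real_sqrt_abs)
  also have "\<dots> = 200 * N * (N + 1) * (G * L2_norm (frac_laplacian_vec (1/2) u))"
  proof -
    have "0 \<le> L2_norm (frac_laplacian_vec (1/2) u)" by (simp add: L2_norm_def)
    then show ?thesis using G0 N by (simp add: abs_mult)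
  qed
  also have "\<dots> \<le> 200 * (N + 1)\<^sup>2 * (G * L2_norm (frac_laplacian_vec (1/2) u))"
    using N G0 by (intro mult_right_mono) (auto simp: power2_eq_square L2_norm_def)
  finally show "L2_norm (commutator (1/2) u) \<le> 200 * (N + 1)\<^sup>2 * G * L2_norm (frac_laplacian_vec (1/2) u)"
    by (simp add: mult.assoc)
qed

section \<open>Nested logarithms and the factors \<open>F1_inf\<close> and
  \<open>F2_inf\<close>\<close>

lemma nested_log_Suc_ge_1:
  assumes "z \<ge> 0" shows "nested_log (Suc k) z \<ge> 1"
proof -
  have ge: "ln (exp 1 + y) \<ge> 1" if "y \<ge> 0" for y :: real
    using that by (subst ln_ge_iff) (auto intro: add_pos_nonneg)
  show ?thesis
  proof (induction k)
    case (Suc k)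
    have "nested_log (Suc (Suc k)) z = ln (exp 1 + nested_log (Suc k) z)" by simp
    also have "\<dots> \<ge> 1" using Suc by (intro ge) linarith
    finally show ?case .
  qed (use assms ge in simp)
qed

text \<open>The slope at 0 is 1/e, hence below 1/2; a slope of 1/2 is small enough to keep the
  iterated logarithms bounded.\<close>

lemma ln_e_plus_le: "y \<ge> 0 \<Longrightarrow> ln (exp 1 + y) \<le> 1 + y / (2::real)"
proof -
  assume y: "y \<ge> 0"
  have "ln (exp 1 + y) = ln (exp 1 * (1 + y / exp 1))" by (simp add: distrib_left)
  also have "\<dots> = 1 + ln (1 + y / exp 1)"
  proof -
    have "1 + y / exp 1 > 0" using y by (intro add_pos_nonneg) auto
    then show ?thesis by (subst ln_mult) auto
  qed
  also have "\<dots> \<le> 1 + y / exp 1" using y by (intro add_left_mono ln_add_one_self_le_self) simp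
  also have "\<dots> \<le> 1 + y / 2" using y exp_ge_add_one_self[of 1] by (intro add_left_mono divide_left_mono) auto
  finally show ?thesis .
qed

text \<open>The map taking \<open>y\<close> to \<open>1 + y / 2\<close> sends numbers up to
  \<open>1 + nested_log 2 z\<close> to numbers up to the same bound, because
  \<open>nested_log 2 z \<ge> 1\<close>. Uniformity in \<open>j\<close> is what makes the weighted
  series of logarithms converge.\<close>

lemma nested_log_bounded:
  assumes z: "z \<ge> 0" shows "nested_log (j + 2) z \<le> 1 + nested_log 2 z"
proof (induction j)
  case (Suc j)
  have l2: "nested_log 2 z \<ge> 1" using nested_log_Suc_ge_1[OF z, of 1] by (simp add: numeral_2_eq_2)
  have "nested_log (Suc j + 2) z = ln (exp 1 + nested_log (j + 2) z)" by simp
  also have "\<dots> \<le> 1 + nested_log (j + 2) z / 2"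
    using nested_log_Suc_ge_1[OF z, of "Suc j"] by (intro ln_e_plus_le) simp
  also have "\<dots> \<le> 1 + nested_log 2 z" using Suc l2 by linarith
  finally show ?case .
next
  case 0
  have "nested_log (0 + 2) z = nested_log 2 z" by (simp only: add_0)
  then show ?case by linarith
qed

text \<open>Logarithms turn the product into a series dominated by a multiple of the series of the
  \<open>\<delta>\<close>. The sign \<open>s\<close> is -1 for the first factor and 1 for the
  second.\<close>

lemma log_product:
  fixes \<delta> :: "nat \<Rightarrow> real"
  assumes pos: "\<And>j. j \<ge> 1 \<Longrightarrow> \<delta> j > 0" and sm: "summable (\<lambda>j. \<delta> (j + 1))" and z: "z \<ge> 0"
  shows "summable (\<lambda>j. \<delta> (j + 2) * ln (1 + nested_log (j + 2) z))"
    and "(\<Sum>j. \<delta> (j + 2) * ln (1 + nested_log (j + 2) z)) \<le> (\<Sum>j. \<delta> (j + 2)) * ln (2 + nested_log 2 z)"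
    and "(\<Prod>j. (1 + nested_log (j + 2) z) powr (s * \<delta> (j + 2)))
       = exp (s * (\<Sum>j. \<delta> (j + 2) * ln (1 + nested_log (j + 2) z)))"
proof -
  let ?f = "\<lambda>j. \<delta> (j + 2) * ln (1 + nested_log (j + 2) z)" and ?b = "ln (2 + nested_log 2 z)"
  have s2: "summable (\<lambda>j. \<delta> (j + 2))" using summable_ignore_initial_segment[OF sm, of 1] by simp
  have L: "nested_log (j + 2) z \<ge> 1" for j using nested_log_Suc_ge_1[OF z, of "Suc j"] by simp
  have b: "0 \<le> ?f j" "?f j \<le> \<delta> (j + 2) * ?b" for j
  proof -
    have d: "\<delta> (j + 2) \<ge> 0" using pos[of "j + 2"] by simp
    show "0 \<le> ?f j" using d L[of j] by (intro mult_nonneg_nonneg ln_ge_zero) auto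
    show "?f j \<le> \<delta> (j + 2) * ?b"
      using d L[of j] nested_log_bounded[OF z, of j] by (intro mult_left_mono ln_mono) auto
  qed
  have sb: "summable (\<lambda>j. \<delta> (j + 2) * ?b)" using s2 by (rule summable_mult2)
  show s: "summable ?f" by (rule summable_comparison_test[OF _ sb]) (use b in auto)
  show "suminf ?f \<le> (\<Sum>j. \<delta> (j + 2)) * ?b"
    using suminf_le[OF b(2) s sb] suminf_mult2[OF s2, of ?b] by simp
  have "(1 + nested_log (j + 2) z) powr (s * \<delta> (j + 2)) = exp (s * ?f j)" for j
    using L[of j] by (simp add: powr_def mult.assoc)
  then have "(\<Prod>j. (1 + nested_log (j + 2) z) powr (s * \<delta> (j + 2))) = (\<Prod>j. exp (s * ?f j))" by simp
  also have "\<dots> = exp (\<Sum>j. s * ?f j)" by (rule prodinf_exp) (rule summable_mult[OF s])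
  also have "(\<Sum>j. s * ?f j) = s * suminf ?f" by (rule suminf_mult[OF s])
  finally show "(\<Prod>j. (1 + nested_log (j + 2) z) powr (s * \<delta> (j + 2))) = exp (s * suminf ?f)" .
qed

lemma F2_inf_nonneg:
  assumes "\<And>j. j \<ge> 1 \<Longrightarrow> \<delta> j > 0" "summable (\<lambda>j. \<delta> (j + 1))" "z \<ge> 0"
  shows "F2_inf \<delta> z \<ge> 0"
proof -
  have "nested_log 1 z \<ge> 1" using nested_log_Suc_ge_1[OF assms(3), of 0] by simp
  then show ?thesis using log_product(3)[OF assms, of 1] unfolding F2_inf_def by simp
qed

text \<open>With \<open>w = 2 + nested_log 2 z\<close>, the product lowers
  \<open>nested_log 1 z\<close> by at most the power \<open>w ^ n\<close>, where \<open>n\<close> is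
  the sum \<open>D\<close> rounded up. One term of the exponential series gives
  \<open>w ^ n \<le> fact n * exp w\<close>, and \<open>exp w\<close> is linear in
  \<open>nested_log 1 z\<close>; this also yields the constant \<open>?c\<close>.\<close>

lemma F1_inf_lower_bound:
  assumes pos: "\<And>j. j \<ge> 1 \<Longrightarrow> \<delta> j > 0" and sm: "summable (\<lambda>j. \<delta> (j + 1))"
  shows "\<exists>c>0. \<forall>z\<ge>0. F1_inf \<delta> z \<ge> c"
proof -
  define D where "D = (\<Sum>j. \<delta> (j + 2))"
  define n where "n = nat \<lceil>D\<rceil>"
  let ?c = "1 / (fact n * exp 2 * (exp 1 + 1)) :: real"
  have "F1_inf \<delta> z \<ge> ?c" if z: "z \<ge> 0" for z
  proof -
    let ?y = "nested_log 1 z" and ?w = "2 + nested_log 2 z"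
    have y: "?y \<ge> 1" using nested_log_Suc_ge_1[OF z, of 0] by simp
    have l2: "nested_log 2 z = ln (exp 1 + ?y)" by (simp add: numeral_2_eq_2)
    have w: "?w \<ge> 1" using nested_log_Suc_ge_1[OF z, of 1] by (simp add: numeral_2_eq_2)
    let ?S = "\<Sum>j. \<delta> (j + 2) * ln (1 + nested_log (j + 2) z)"
    have "exp ?S \<le> exp (real n * ln ?w)"
    proof -
      have "?S \<le> D * ln ?w" using log_product(2)[OF pos sm z] by (simp add: D_def)
      also have "\<dots> \<le> real n * ln ?w" using w unfolding n_def by (intro mult_right_mono ln_ge_zero) linarith+
      finally show ?thesis by simp
    qed
    also have "\<dots> = ?w ^ n" using w by (simp add: exp_of_nat_mult)
    also have "\<dots> \<le> fact n * exp ?w"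
    proof -
      have "?w ^ n /\<^sub>R fact n \<le> exp ?w"
        using w sum_le_suminf[OF summable_exp_generic[of ?w], of "{n}"] by (simp add: exp_def)
      then show ?thesis by (simp add: divide_simps scaleR_conv_of_real mult.commute)
    qed
    also have "exp ?w = exp 2 * (exp 1 + ?y)" using y l2 by (simp add: exp_add add_pos_nonneg)
    also have "\<dots> \<le> exp 2 * ((exp 1 + 1) * ?y)" using y by (intro mult_left_mono) (auto simp: distrib_right)
    finally have S: "exp ?S \<le> (fact n * exp 2 * (exp 1 + 1)) * ?y" by (simp add: mult_ac)
    have "F1_inf \<delta> z = ?y * exp (- ?S)"
      unfolding F1_inf_def using log_product(3)[OF pos sm z, of "-1"] by simp
    then have F: "F1_inf \<delta> z = ?y / exp ?S" by (simp add: exp_minus divide_inverse)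
    have "0 < fact n * exp 2 * (exp 1 + (1::real))" by (intro mult_pos_pos add_pos_pos) auto
    then show ?thesis unfolding F using S by (simp add: divide_simps mult.commute)
  qed
  moreover have "?c > 0" by (simp add: add_pos_pos)
  ultimately show ?thesis by blast
qed

theorem theorem3:
  fixes \<delta> :: "nat \<Rightarrow> real"
  assumes "\<And>j. j \<ge> 1 \<Longrightarrow> \<delta> j > 0"
    and "summable (\<lambda>j. \<delta> (j + 1))"
  shows "\<exists>\<sigma>0>0. \<forall>\<sigma>. 0 < \<sigma> \<and> \<sigma> < \<sigma>0 \<longrightarrow>
    (\<exists>C>0. \<forall>u :: real^3 \<Rightarrow> real^3.
      Cinf_compact_support u \<and> (\<forall>x. divergence u x = 0) \<longrightarrow>
      (let Z = L2_norm (frac_laplacian_vec (1/2 + \<sigma>) u);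
           G = Linf_norm (\<lambda>x. jacobian u (at x))
       in in_L2 (commutator (1/2) u) \<and>
          L2_norm (commutator (1/2) u) \<le>
            C * G * L2_norm (frac_laplacian_vec (1/2) u) * F1_inf \<delta> Z
          + C * G * L2_norm (frac_laplacian_vec 1 u) * F2_inf \<delta> Z))"
proof -
  obtain c where c: "c > 0" "\<And>z. z \<ge> 0 \<Longrightarrow> F1_inf \<delta> z \<ge> c"
    using F1_inf_lower_bound[OF assms] by blast
  define K :: real where "K = 200 * (real CARD(3) + 1)\<^sup>2"
  have K: "K > 0" by (simp add: K_def)
  have L0: "L2_norm f \<ge> 0" for f :: "real^3 \<Rightarrow> real^3" by (simp add: L2_norm_def)
  have bound: "L2_norm (commutator (1/2) u) \<le> K / c * G * L2_norm (frac_laplacian_vec (1/2) u) * F1_inf \<delta> Z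
          + K / c * G * L2_norm (frac_laplacian_vec 1 u) * F2_inf \<delta> Z"
    if u: "Cinf_compact_support u" and Z: "Z = L2_norm (frac_laplacian_vec (1/2 + \<sigma>) u)" and G: "G = Linf_norm (\<lambda>x. jacobian u (at x))"
    for u :: "real^3 \<Rightarrow> real^3" and \<sigma> Z G
  proof -
    let ?A = "L2_norm (frac_laplacian_vec (1/2) u)"
    have G0: "G \<ge> 0" unfolding G by (rule commutator_estimate(2)[OF u])
    have Z0: "Z \<ge> 0" unfolding Z by (rule L0)
    have "L2_norm (commutator (1/2) u) \<le> K * G * ?A"
      using commutator_estimate(3)[OF u] unfolding K_def G .
    also have "\<dots> = (K / c * G * ?A) * c" using c by simp
    also have "\<dots> \<le> (K / c * G * ?A) * F1_inf \<delta> Z"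
      using c K G0 L0 Z0 by (intro mult_left_mono) auto
    also have "\<dots> \<le> K / c * G * ?A * F1_inf \<delta> Z + K / c * G * L2_norm (frac_laplacian_vec 1 u) * F2_inf \<delta> Z"
      using c K G0 L0 F2_inf_nonneg[OF assms Z0] by simp
    finally show ?thesis .
  qed
  \<comment> \<open>The constant \<open>K / c\<close> is independent of \<open>\<sigma>\<close>, so
    any positive threshold serves; 1 is taken.\<close>
  show ?thesis
    unfolding Let_def
    using bound commutator_estimate(1) K c(1) by (intro exI[of _ 1] conjI allI impI exI[of _ "K / c"]) auto
qed

end
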